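(* Let $G$ be a finite group of (holomorphic) automorphisms of a complex torus $T$ which acts freely on $T$, and let $X_G=T/G$ be the quotient complex manifold. Then the complex structure on $X_G$ may be continuously deformed to a projective structure.
   Context: Write $T=(\mathbb{R}^{2k}/\Lambda,J_0)$ with $\Lambda$ a lattice and $J_0$ a linear complex structure ($J_0^2=-\mathrm{id}$) on $\mathbb{R}^{2k}$. Each $g\in G$ acts on $T$ by an affine transformation with linear part $\mu(g)\in\mathrm{GL}(2k,\mathbb{R})$ preserving $\Lambda$ and commuting with $J_0$. The deformation space of complex structures for $X_G$ is $\mathfrak{D}(G)=\{J\in\mathrm{End}(\mathbb{R}^{2k}) : J^2=-\mathrm{id},\ \mu(g)J=J\mu(g)\ \text{for all } g\in G\}$, with the subspace topology; every $J\in\mathfrak{D}(G)$ defines a complex torus $(\mathbb{R}^{2k}/\Lambda,J)$ on which $G$ acts freely and holomorphically by the same affine maps, hence a complex structure on the quotient manifold $T/G$. A continuous deformation of the complex structure of $X_G$ is the family of complex structures on $T/G$ given by a continuous path $t\mapsto J_t$, $t\in[0,1]$, in $\mathfrak{D}(G)$ starting at $J_0$. A complex structure is projective if the resulting compact complex manifold embeds holomorphically as a subvariety of some complex projective space. *)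

theory Defs
  imports "HOL-Analysis.Analysis" "HOL-Algebra.Bij"
begin

section \<open>Complex spaces as spaces with a sheaf of holomorphic functions\<close>

text \<open>
  A complex structure is recorded by a topology together with the holomorphic functions on each
  of its open sets.  Functions are total, but membership in \<open>holfuns X U\<close> depends only on the
  values on \<open>U\<close>, and \<open>holfuns X U\<close> is meaningful only for \<open>U\<close> open in \<open>cs_top X\<close>.
\<close>

record 'a cspace =
  cs_top :: "'a topology"
  holfuns :: "'a set \<Rightarrow> ('a \<Rightarrow> complex) set"

definition quotient_topology :: "('a \<Rightarrow> 'b) \<Rightarrow> 'a topology \<Rightarrow> 'b topology" where
  "quotient_topology q X =
     topology (\<lambda>U. U \<subseteq> q ` topspace X \<and> openin X {x \<in> topspace X. q x \<in> U})"

lemma openin_quotient_topology: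
  "openin (quotient_topology q X) U \<longleftrightarrow>
     U \<subseteq> q ` topspace X \<and> openin X {x \<in> topspace X. q x \<in> U}"
proof -
  let ?P = "\<lambda>U. U \<subseteq> q ` topspace X \<and> openin X {x \<in> topspace X. q x \<in> U}"
  have "istopology ?P"
    unfolding istopology_def
  proof (intro conjI allI impI)
    fix S T assume S: "?P S" and T: "?P T"
    have "{x \<in> topspace X. q x \<in> S \<inter> T} =
        {x \<in> topspace X. q x \<in> S} \<inter> {x \<in> topspace X. q x \<in> T}"
      by auto
    with S T show "openin X {x \<in> topspace X. q x \<in> S \<inter> T}"
      by auto
    from S show "S \<inter> T \<subseteq> q ` topspace X"
      by auto
  next
    fix K assume K: "\<forall>S\<in>K. ?P S"
    have "{x \<in> topspace X. q x \<in> \<Union>K} = (\<Union>S\<in>K. {x \<in> topspace X. q x \<in> S})"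
      by auto
    with K show "openin X {x \<in> topspace X. q x \<in> \<Union>K}"
      by auto
    from K show "\<Union>K \<subseteq> q ` topspace X"
      by auto
  qed
  then show ?thesis
    by (simp add: quotient_topology_def topology_inverse')
qed

lemma topspace_quotient_topology [simp]:
  "topspace (quotient_topology q X) = q ` topspace X"
proof
  show "topspace (quotient_topology q X) \<subseteq> q ` topspace X"
    by (meson openin_quotient_topology openin_topspace)
  have "{x \<in> topspace X. q x \<in> q ` topspace X} = topspace X"
    by auto
  then have "openin (quotient_topology q X) (q ` topspace X)"
    by (simp add: openin_quotient_topology)
  then show "q ` topspace X \<subseteq> topspace (quotient_topology q X)"
    by (rule openin_subset)
qed

text \<open>
  The quotient of \<open>X\<close> by a map \<open>q\<close>: a function on an open set \<open>U\<close> is holomorphic iff its pullback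
  along \<open>q\<close> is holomorphic on the preimage of \<open>U\<close>.  When \<open>q\<close> is the quotient map of a free and
  properly discontinuous group of automorphisms, the local inverses of \<open>q\<close> are charts of this
  structure.
\<close>

definition quotient_cspace :: "('a \<Rightarrow> 'b) \<Rightarrow> 'a cspace \<Rightarrow> 'b cspace" where
  "quotient_cspace q X =
     \<lparr>cs_top = quotient_topology q (cs_top X),
      holfuns = (\<lambda>U. {f. f \<circ> q \<in> holfuns X {x \<in> topspace (cs_top X). q x \<in> U}})\<rparr>"

text \<open>
  The structure induced on a subset \<open>Z\<close>: the holomorphic functions are those which are locally
  restrictions of holomorphic functions of the ambient space.
\<close>

definition induced_cspace :: "'a cspace \<Rightarrow> 'a set \<Rightarrow> 'a cspace" where
  "induced_cspace Y Z =
     \<lparr>cs_top = subtopology (cs_top Y) Z,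
      holfuns = (\<lambda>V. {f. \<forall>p\<in>V. \<exists>U h. openin (cs_top Y) U \<and> p \<in> U \<and> h \<in> holfuns Y U \<and>
                          (\<forall>x \<in> U \<inter> V. f x = h x)})\<rparr>"

definition biholomorphism :: "'a cspace \<Rightarrow> 'b cspace \<Rightarrow> ('a \<Rightarrow> 'b) \<Rightarrow> bool" where
  "biholomorphism X Y \<phi> \<longleftrightarrow>
     homeomorphic_map (cs_top X) (cs_top Y) \<phi> \<and>
     (\<forall>V f. openin (cs_top Y) V \<longrightarrow>
        (f \<in> holfuns Y V \<longleftrightarrow> f \<circ> \<phi> \<in> holfuns X {x \<in> topspace (cs_top X). \<phi> x \<in> V}))"

definition analytic_subvariety :: "'a cspace \<Rightarrow> 'a set \<Rightarrow> bool" where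
  "analytic_subvariety Y Z \<longleftrightarrow>
     closedin (cs_top Y) Z \<and>
     (\<forall>p \<in> topspace (cs_top Y). \<exists>U F. openin (cs_top Y) U \<and> p \<in> U \<and>
        finite F \<and> F \<subseteq> holfuns Y U \<and> Z \<inter> U = {x \<in> U. \<forall>h\<in>F. h x = 0})"


section \<open>Complex projective space and projectivity\<close>

text \<open>
  \<open>\<complex>\<^sup>N\<^sup>+\<^sup>1\<close> is realised as the sequences vanishing beyond index \<open>N\<close>, since \<open>N\<close> is
  existentially quantified below; the ambient product topology induces the usual one.
\<close>

definition cvecs :: "nat \<Rightarrow> (nat \<Rightarrow> complex) set" where
  "cvecs N = {z. \<forall>i>N. z i = 0}"

definition cvec_differentiable :: "nat \<Rightarrow> ((nat \<Rightarrow> complex) \<Rightarrow> complex) \<Rightarrow> (nat \<Rightarrow> complex) \<Rightarrow> bool" where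
  "cvec_differentiable N f z \<longleftrightarrow>
     (\<exists>a :: nat \<Rightarrow> complex. \<forall>\<epsilon>>0. \<exists>\<delta>>0. \<forall>w \<in> cvecs N.
        (\<Sum>i\<le>N. cmod (w i - z i)) < \<delta> \<longrightarrow>
        cmod (f w - f z - (\<Sum>i\<le>N. a i * (w i - z i))) \<le> \<epsilon> * (\<Sum>i\<le>N. cmod (w i - z i)))"

definition punctured_cvecs :: "nat \<Rightarrow> (nat \<Rightarrow> complex) cspace" where
  "punctured_cvecs N =
     \<lparr>cs_top = subtopology euclidean (cvecs N - {\<lambda>_. 0}),
      holfuns = (\<lambda>U. {f. \<forall>z\<in>U. cvec_differentiable N f z})\<rparr>"

text \<open>A point of projective space is a complex line through the origin, with the origin removed.\<close>

definition cline :: "(nat \<Rightarrow> complex) \<Rightarrow> (nat \<Rightarrow> complex) set" where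
  "cline z = {\<lambda>i. c * z i | c. c \<noteq> 0}"

definition CP :: "nat \<Rightarrow> (nat \<Rightarrow> complex) set cspace" where
  "CP N = quotient_cspace cline (punctured_cvecs N)"

definition projective_cspace :: "'a cspace \<Rightarrow> bool" where
  "projective_cspace X \<longleftrightarrow>
     (\<exists>N Z \<phi>. analytic_subvariety (CP N) Z \<and> biholomorphism X (induced_cspace (CP N) Z) \<phi>)"


section \<open>Complex tori, their quotients, and the deformation space\<close>

definition linear_complex_structure :: "real^'n^'n \<Rightarrow> bool" where
  "linear_complex_structure J \<longleftrightarrow> J ** J = - mat 1"

definition full_lattice :: "(real^'n) set \<Rightarrow> bool" where
  "full_lattice \<Lambda> \<longleftrightarrow>
     (\<exists>b :: 'n \<Rightarrow> real^'n. inj b \<and> independent (range b) \<and>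
        \<Lambda> = {\<Sum>i\<in>UNIV. of_int (c i) *\<^sub>R b i | c :: 'n \<Rightarrow> int. True})"

text \<open>The complex vector space \<open>(\<real>\<^sup>n, J)\<close>; holomorphic means real differentiable with derivative
  complex linear with respect to \<open>J\<close>.\<close>

definition linear_cspace :: "real^'n^'n \<Rightarrow> (real^'n) cspace" where
  "linear_cspace J =
     \<lparr>cs_top = euclidean,
      holfuns = (\<lambda>U. {f. \<forall>x\<in>U. \<exists>D. (f has_derivative D) (at x) \<and>
                            (\<forall>v. D (J *v v) = \<i> * D v)})\<rparr>"

definition lattice_coset :: "(real^'n) set \<Rightarrow> real^'n \<Rightarrow> (real^'n) set" where
  "lattice_coset \<Lambda> x = {x + l | l. l \<in> \<Lambda>}"

definition torus_points :: "(real^'n) set \<Rightarrow> (real^'n) set set" where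
  "torus_points \<Lambda> = range (lattice_coset \<Lambda>)"

definition complex_torus :: "(real^'n) set \<Rightarrow> real^'n^'n \<Rightarrow> (real^'n) set cspace" where
  "complex_torus \<Lambda> J = quotient_cspace (lattice_coset \<Lambda>) (linear_cspace J)"

definition acts_freely :: "('a \<Rightarrow> 'a) set \<Rightarrow> 'a set \<Rightarrow> bool" where
  "acts_freely G S \<longleftrightarrow> (\<forall>g\<in>G. \<forall>p\<in>S. g p = p \<longrightarrow> g = \<one>\<^bsub>BijGroup S\<^esub>)"

definition group_quotient :: "'a cspace \<Rightarrow> ('a \<Rightarrow> 'a) set \<Rightarrow> 'a set cspace" where
  "group_quotient X G = quotient_cspace (\<lambda>p. {g p | g. g \<in> G}) X"

text \<open>
  The linear part of an affine transformation of the torus.  Every holomorphic automorphism of a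
  complex torus is affine, and its linear part is unique since \<open>\<Lambda>\<close> is discrete.
\<close>

definition linear_part :: "(real^'n) set \<Rightarrow> ((real^'n) set \<Rightarrow> (real^'n) set) \<Rightarrow> real^'n^'n" where
  "linear_part \<Lambda> g =
     (THE A. \<exists>b. \<forall>x. g (lattice_coset \<Lambda> x) = lattice_coset \<Lambda> (A *v x + b))"

definition deformation_space ::
    "(real^'n) set \<Rightarrow> ((real^'n) set \<Rightarrow> (real^'n) set) set \<Rightarrow> (real^'n^'n) set" where
  "deformation_space \<Lambda> G =
     {J. linear_complex_structure J \<and> (\<forall>g\<in>G. linear_part \<Lambda> g ** J = J ** linear_part \<Lambda> g)}"

end

theory Submission
  imports Defs "HOL-Complex_Analysis.Complex_Analysis"
begin

text \<open>
  Every automorphism of the torus lifts to an affine map, and the linear parts of \<open>G\<close> form a finite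
  group \<open>S\<close> of automorphisms of \<open>\<Lambda>\<close>.  For an inner product \<open>G0\<close> invariant under \<open>S\<close> and \<open>J0\<close>, the
  alternating form \<open>G0 J0\<close> is a limit of \<open>S\<close>-invariant rational alternating forms \<open>G0 B\<close>.  The polar
  part \<open>J = B (-B\<^sup>2)\<^bsup>-1/2\<^esup>\<close> of \<open>B\<close> commutes with \<open>S\<close>, is polarized by a multiple of \<open>G0 B\<close>, and lies
  so close to \<open>J0\<close> that it can be joined to \<open>J0\<close> inside the deformation space.

  For the polarized structure, Poincare series of Gaussian coherent states give theta functions of
  every large weight, and since a state of large weight is concentrated at its centre, theta
  functions with prescribed behaviour at finitely many points exist.  Their norms, the products over
  the \<open>G\<close>-translates, have a common automorphy factor along \<open>G\<close>-orbits.  By freeness of the action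
  such products separate orbits and tangent directions, and compactness together with the Segre map
  combines finitely many of them into a holomorphic embedding of \<open>X\<^sub>G\<close> into projective space.
\<close>

text \<open>A general complex torus of dimension at least two has no compatible rational alternating
  form, hence no embedding by theta functions; this is why the structure has to move. Approximating
  \<open>J0\<close> directly by rational data would conflict with \<open>J ** J = - mat 1\<close>.
  The approximation is therefore made on alternating forms, where skewness and rationality are easy
  to keep, and the equation is restored afterwards by the polar part. Averaging over the finite
  group keeps rationality because the group preserves \<Lambda>. The form is scaled to be even on
  \<Lambda>, so that the factor of automorphy needs no semicharacter. Theta functions transform well
  under \<Lambda> but not under G; only products over G descend. Their zeros can be controlled
  because the points of an orbit are distinct modulo \<Lambda>: a theta function may vanish at one
  of them and at no other. The weight needed varies with the points and directions to be separated;
  Segre products make a common weight unnecessary.\<close>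

no_notation fps_nth (infixl "$" 75)

section \<open>Polarizable deformations\<close>

lemma full_lattice_matrix:
  fixes \<Lambda> :: "(real^'n) set"
  assumes "full_lattice \<Lambda>"
  obtains M N :: "real^'n^'n" where "N ** M = mat 1" "M ** N = mat 1"
    "\<Lambda> = {M *v x |x. \<forall>i. x $ i \<in> \<int>}"
proof -
  obtain b :: "'n \<Rightarrow> real^'n" where b: "inj b" "independent (range b)"
    and L: "\<Lambda> = {\<Sum>i\<in>UNIV. of_int (c i) *\<^sub>R b i | c :: 'n \<Rightarrow> int. True}"
    using assms unfolding full_lattice_def by blast
  define M :: "real^'n^'n" where "M = (\<chi> i j. b j $ i)"
  have Mv: "M *v x = (\<Sum>i\<in>UNIV. (x $ i) *\<^sub>R b i)" for x
    by (simp add: M_def matrix_vector_mult_def vec_eq_iff sum_component mult.commute)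
  have "x = 0" if "M *v x = 0" for x
  proof -
    have "(\<Sum>v\<in>range b. (x $ (inv_into UNIV b v)) *\<^sub>R v) = 0"
      using that b(1) by (simp add: Mv sum.reindex)
    then have "x $ (inv_into UNIV b (b i)) = 0" for i
      using b(2) independentD[of "range b" "range b" "\<lambda>v. x $ (inv_into UNIV b v)" "b i"] by auto
    then show ?thesis using b(1) by (simp add: vec_eq_iff)
  qed
  then obtain N where N: "N ** M = mat 1"
    by (metis matrix_left_invertible_ker)
  moreover have "M ** N = mat 1" using N matrix_left_right_inverse by blast
  moreover have "\<Lambda> = {M *v x |x. \<forall>i. x $ i \<in> \<int>}"
  proof safe
    fix l assume "l \<in> \<Lambda>"
    then obtain c :: "'n \<Rightarrow> int" where "l = (\<Sum>i\<in>UNIV. of_int (c i) *\<^sub>R b i)" using L by auto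
    then have "l = M *v (\<chi> i. of_int (c i))" by (simp add: Mv)
    then show "\<exists>x. l = M *v x \<and> (\<forall>i. x $ i \<in> \<int>)" by fastforce
  next
    fix x :: "real^'n" assume "\<forall>i. x $ i \<in> \<int>"
    then have "\<forall>i. \<exists>k::int. x $ i = of_int k" by (auto elim: Ints_cases)
    then obtain c :: "'n \<Rightarrow> int" where "\<forall>i. x $ i = of_int (c i)" by metis
    then show "M *v x \<in> \<Lambda>" unfolding L Mv by auto
  qed
  ultimately show thesis using that by blast
qed

section \<open>Matrix products, square roots and paths of complex structures\<close>

lemma bounded_bilinear_matrix_matrix_mult:
  "bounded_bilinear ((**) :: real^'n^'m \<Rightarrow> real^'p^'n \<Rightarrow> real^'p^'m)"
  unfolding bilinear_conv_bounded_bilinear[symmetric] bilinear_def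
  by (auto intro!: linearI simp: matrix_matrix_mult_def vec_eq_iff sum.distrib
      algebra_simps sum_distrib_left)

lemma bounded_bilinear_matrix_vector_mult:
  "bounded_bilinear ((*v) :: real^'n^'m \<Rightarrow> real^'n \<Rightarrow> real^'m)"
  unfolding bilinear_conv_bounded_bilinear[symmetric] bilinear_def
  by (auto intro!: linearI simp: matrix_vector_mult_def vec_eq_iff sum.distrib
      algebra_simps sum_distrib_left)

lemma linear_transpose: "linear (transpose :: real^'n^'m \<Rightarrow> real^'m^'n)"
  by (auto intro!: linearI simp: transpose_def vec_eq_iff)

interpretation mmult: bounded_bilinear "(**) :: real^'n^'n \<Rightarrow> real^'n^'n \<Rightarrow> real^'n^'n"
  by (rule bounded_bilinear_matrix_matrix_mult)

lemma matrix_commute_mult: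
  fixes C D F :: "'a::semiring_1^'n^'n"
  assumes "C ** D = D ** C" "C ** F = F ** C"
  shows "C ** (D ** F) = D ** F ** C"
proof -
  have "C ** (D ** F) = (C ** D) ** F" by (rule matrix_mul_assoc)
  also have "\<dots> = D ** (C ** F)" unfolding assms(1) by (rule matrix_mul_assoc[symmetric])
  also have "\<dots> = D ** F ** C" unfolding assms(2) by (rule matrix_mul_assoc)
  finally show ?thesis .
qed

lemma matrix_selfadjoint_mult:
  fixes G D F :: "'a::comm_semiring_1^'n^'n"
  assumes "G ** D = transpose D ** G" "G ** F = transpose F ** G" "D ** F = F ** D"
  shows "G ** (D ** F) = transpose (D ** F) ** G"
proof -
  have "G ** (D ** F) = (G ** D) ** F" by (rule matrix_mul_assoc)
  also have "\<dots> = transpose D ** (G ** F)" unfolding assms(1) by (rule matrix_mul_assoc[symmetric])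
  also have "\<dots> = transpose D ** transpose F ** G" unfolding assms(2) by (rule matrix_mul_assoc)
  also have "\<dots> = transpose (D ** F) ** G" unfolding assms(3) by (simp add: matrix_transpose_mul)
  finally show ?thesis .
qed

text \<open>The inverse square root of A is found by Banach's fixed point theorem on a closed set
  that already carries every relation wanted of Y, so commutation and selfadjointness come with the
  limit. They are what makes the deformed structure commute with the group and respect the
  form.\<close>

lemma inverse_sqrt_near_one:
  fixes r :: real
  assumes "r > 0"
  obtains \<eta> where "\<eta> > 0"
    "\<And>A :: real^'n^'n. norm (A - mat 1) < \<eta> \<Longrightarrow>
       \<exists>Y. norm (Y - mat 1) \<le> r \<and> Y ** Y ** A = mat 1 \<and> (\<forall>C. C ** A = A ** C \<longrightarrow> C ** Y = Y ** C) \<and>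
         (\<forall>G. G ** A = transpose A ** G \<longrightarrow> G ** Y = transpose Y ** G)"
proof -
  obtain K where K: "K > 0"
    and nK: "\<And>(A::real^'n^'n) (B::real^'n^'n). norm (A ** B) \<le> norm A * norm B * K"
    using mmult.pos_bounded by metis
  \<comment> \<open>With K * \<rho> at most 1/8, multiplying by X or by an admissible Z shrinks
    norms by a factor 8; this leaves room for \<Phi> to preserve the ball and to contract by
    1/2.\<close>
  define \<rho> where "\<rho> = min r (1 / (8 * K))"
  have \<rho>: "\<rho> > 0" "\<rho> \<le> r" "K * \<rho> \<le> 1/8"
    using assms K by (auto simp: \<rho>_def min_def field_simps)
  have "\<exists>Y. norm (Y - mat 1) \<le> r \<and> Y ** Y ** A = mat 1 \<and> (\<forall>C. C ** A = A ** C \<longrightarrow> C ** Y = Y ** C) \<and>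
         (\<forall>G. G ** A = transpose A ** G \<longrightarrow> G ** Y = transpose Y ** G)"
    if A: "norm (A - mat 1) < \<rho>" for A :: "real^'n^'n"
  proof -
    define X where "X = A - mat 1"
    \<comment> \<open>Expanding (1 + Z)(1 + Z)(1 + X) gives 1 + 2 Z minus twice \<Phi> Z, so fixed
      points of \<Phi> are solutions Y = 1 + Z.\<close>
    define \<Phi> where "\<Phi> Z = (-1/2) *\<^sub>R (X + 2 *\<^sub>R (Z ** X) + Z ** Z + Z ** Z ** X)" for Z
    \<comment> \<open>Each relation is a closed linear condition on Z. The first family includes C =
      X, which supplies Z X = X Z for the products in \<Phi>.\<close>
    define s where "s = {Z. norm Z \<le> \<rho>} \<inter> (\<Inter>C\<in>{C. C ** X = X ** C}. {Z. C ** Z = Z ** C}) \<inter>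
        (\<Inter>G\<in>{G. G ** X = transpose X ** G}. {Z. G ** Z = transpose Z ** G})"
    have X: "norm X < \<rho>" using A by (simp add: X_def)
    have KX: "K * norm X \<le> 1/8" using X \<rho>(3) K
      by (smt (verit, best) mult_left_mono)
    have lim: "continuous_on UNIV (\<lambda>Z::real^'n^'n. G ** Z)" "continuous_on UNIV (\<lambda>Z::real^'n^'n. Z ** G)"
      "continuous_on UNIV (\<lambda>Z::real^'n^'n. transpose Z ** G)" for G :: "real^'n^'n"
      using linear_continuous_on[OF linear_conv_bounded_linear[THEN iffD1, OF linear_transpose], of UNIV]
      by (auto intro!: mmult.continuous_on continuous_on_const continuous_on_id)
    have "closed s" unfolding s_def
      by (intro closed_Int closed_INT ballI closed_Collect_eq lim closed_Collect_le continuous_intros)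
    then have cs: "complete s" by (simp add: complete_eq_closed)
    have "0 \<in> s" using \<rho> by (simp add: s_def mmult.zero_left mmult.zero_right linear_0[OF linear_transpose])
    then have ne: "s \<noteq> {}" by blast
    have nKX: "norm (Z ** X) \<le> norm Z * (1/8)" for Z :: "real^'n^'n"
    proof -
      have "norm (Z ** X) \<le> norm Z * (K * norm X)" using nK[of Z X] by (simp add: mult_ac)
      also have "\<dots> \<le> norm Z * (1/8)" using KX by (intro mult_left_mono) auto
      finally show ?thesis .
    qed
    have nKZ: "norm (D ** Z) \<le> norm D * (1/8)" "norm (Z ** D) \<le> norm D * (1/8)" if "norm Z \<le> \<rho>" for Z D :: "real^'n^'n"
    proof -
      have "K * norm Z \<le> 1/8" using that \<rho>(3) K by (smt (verit, best) mult_left_mono)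
      then have "norm D * (K * norm Z) \<le> norm D * (1/8)" by (intro mult_left_mono) auto
      then show "norm (D ** Z) \<le> norm D * (1/8)" "norm (Z ** D) \<le> norm D * (1/8)"
        using nK[of D Z] nK[of Z D] by (auto simp: mult_ac)
    qed
    have self: "\<Phi> ` s \<subseteq> s"
    proof
      fix Z' assume "Z' \<in> \<Phi> ` s"
      then obtain Z where Z: "Z \<in> s" and Z': "Z' = \<Phi> Z" by auto
      have nZ: "norm Z \<le> \<rho>" using Z by (simp add: s_def)
      have ZX: "Z ** X = X ** Z" using Z by (simp add: s_def)
      have "norm Z' = 1/2 * norm (X + 2 *\<^sub>R (Z ** X) + Z ** Z + Z ** Z ** X)"
        by (simp add: Z' \<Phi>_def)
      also have "\<dots> \<le> 1/2 * (norm X + 2 * norm (Z ** X) + norm (Z ** Z) + norm (Z ** Z ** X))"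
        using norm_triangle_ineq[of "X + 2 *\<^sub>R (Z ** X) + Z ** Z" "Z ** Z ** X"]
          norm_triangle_ineq[of "X + 2 *\<^sub>R (Z ** X)" "Z ** Z"] norm_triangle_ineq[of X "2 *\<^sub>R (Z ** X)"]
        by simp
      also have "\<dots> \<le> \<rho>"
        using X nKX[of Z] nKZ[OF nZ, of Z] nKX[of "Z ** Z"] nZ \<rho>(1) by argo
      finally have 1: "norm Z' \<le> \<rho>" .
      have 2: "C ** Z' = Z' ** C" if C: "C ** X = X ** C" for C :: "real^'n^'n"
      proof -
        have CZ: "C ** Z = Z ** C" using Z C by (simp add: s_def)
        have "C ** (Z ** X) = Z ** X ** C" "C ** (Z ** Z) = Z ** Z ** C"
          "C ** (Z ** Z ** X) = Z ** Z ** X ** C"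
          using C CZ by (intro matrix_commute_mult; simp)+
        then show ?thesis using C
          by (simp add: Z' \<Phi>_def mmult.add_left mmult.add_right mmult.scaleR_left mmult.scaleR_right
              mmult.minus_left mmult.minus_right)
      qed
      have 3: "G ** Z' = transpose Z' ** G" if G: "G ** X = transpose X ** G" for G
      proof -
        have GZ: "G ** Z = transpose Z ** G" using Z G by (simp add: s_def)
        have "G ** (Z ** X) = transpose (Z ** X) ** G" "G ** (Z ** Z) = transpose (Z ** Z) ** G"
          using G GZ ZX by (intro matrix_selfadjoint_mult; simp)+
        moreover from this have "G ** (Z ** Z ** X) = transpose (Z ** Z ** X) ** G"
          using matrix_selfadjoint_mult[OF _ G matrix_commute_mult[OF ZX[symmetric] ZX[symmetric], symmetric]]
          by blast
        ultimately show ?thesis using G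
          by (simp add: Z' \<Phi>_def mmult.add_left mmult.add_right mmult.scaleR_left mmult.scaleR_right
              mmult.minus_left mmult.minus_right linear_add[OF linear_transpose] linear_scale[OF linear_transpose]
              linear_neg[OF linear_transpose])
      qed
      show "Z' \<in> s" using 1 2 3 by (simp add: s_def)
    qed
    have lip: "dist (\<Phi> Z) (\<Phi> W) \<le> 1/2 * dist Z W" if "Z \<in> s" "W \<in> s" for Z W
    proof -
      let ?D = "Z - W"
      have n: "norm Z \<le> \<rho>" "norm W \<le> \<rho>" using that by (auto simp: s_def)
      have sq: "Z ** Z - W ** W = Z ** ?D + ?D ** W"
        by (simp add: mmult.diff_left mmult.diff_right)
      have nsq: "norm (Z ** Z - W ** W) \<le> 1/4 * norm ?D"
        unfolding sq using nKZ(2)[OF n(1), of ?D] nKZ(1)[OF n(2), of ?D]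
          norm_triangle_ineq[of "Z ** ?D" "?D ** W"] by argo
      have "\<Phi> Z - \<Phi> W = (-1/2) *\<^sub>R (2 *\<^sub>R (?D ** X) + (Z ** Z - W ** W) + (Z ** Z - W ** W) ** X)"
        by (simp add: \<Phi>_def mmult.diff_left algebra_simps)
      then have "norm (\<Phi> Z - \<Phi> W) = 1/2 * norm (2 *\<^sub>R (?D ** X) + (Z ** Z - W ** W) + (Z ** Z - W ** W) ** X)"
        by simp
      also have "\<dots> \<le> 1/2 * (2 * norm (?D ** X) + norm (Z ** Z - W ** W) + norm ((Z ** Z - W ** W) ** X))"
        using norm_triangle_ineq[of "2 *\<^sub>R (?D ** X) + (Z ** Z - W ** W)" "(Z ** Z - W ** W) ** X"]
          norm_triangle_ineq[of "2 *\<^sub>R (?D ** X)" "Z ** Z - W ** W"]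
        by simp
      also have "\<dots> \<le> 1/2 * norm ?D"
        using nKX[of ?D] nsq nKX[of "Z ** Z - W ** W"] norm_ge_zero[of ?D] by argo
      finally show ?thesis by (simp add: dist_norm)
    qed
    obtain Z where Z: "Z \<in> s" "\<Phi> Z = Z"
      using Banach_fix[OF cs ne _ _ self, of "1/2"] lip by auto
    have A': "A = mat 1 + X" by (simp add: X_def)
    define Y where "Y = mat 1 + Z"
    have "norm (Y - mat 1) \<le> r" using Z \<rho> by (simp add: Y_def s_def)
    moreover have "Y ** Y ** A = mat 1 + 2 *\<^sub>R Z + (X + 2 *\<^sub>R (Z ** X) + Z ** Z + Z ** Z ** X)"
      by (simp only: Y_def A' mmult.add_left mmult.add_right scaleR_2 matrix_mul_lid matrix_mul_rid add_ac)
    then have "Y ** Y ** A = mat 1 + 2 *\<^sub>R Z - 2 *\<^sub>R \<Phi> Z" by (simp add: \<Phi>_def)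
    then have "Y ** Y ** A = mat 1" using Z by simp
    moreover have "C ** Y = Y ** C" if "C ** A = A ** C" for C
    proof -
      have "C ** X = X ** C" using that by (simp add: X_def mmult.diff_left mmult.diff_right)
      then show ?thesis using Z by (simp add: Y_def s_def mmult.add_left mmult.add_right)
    qed
    moreover have "G ** Y = transpose Y ** G" if "G ** A = transpose A ** G" for G
    proof -
      have "G ** X = transpose X ** G" using that
        by (simp add: X_def mmult.diff_left mmult.diff_right linear_diff[OF linear_transpose] transpose_mat)
      then show ?thesis using Z
        by (simp add: Y_def s_def mmult.add_left mmult.add_right linear_add[OF linear_transpose] transpose_mat)
    qed
    ultimately show ?thesis by blast
  qed
  then show thesis using that \<rho>(1) by blast
qed

text \<open>The path conjugates J0 by matrices T t, so every p t squares to -1 automatically. Since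
  T t is a polynomial in J0 and J1, whatever commutes with both commutes with the whole
  path.\<close>

lemma complex_structures_joined_by_path:
  fixes J0 :: "real^'n^'n"
  assumes J0: "J0 ** J0 = - mat 1"
  obtains \<epsilon> where "\<epsilon> > 0"
    "\<And>J1. J1 ** J1 = - mat 1 \<Longrightarrow> norm (J1 - J0) < \<epsilon> \<Longrightarrow>
       \<exists>p. path p \<and> pathstart p = J0 \<and> pathfinish p = J1 \<and>
         (\<forall>t\<in>{0..1}. p t ** p t = - mat 1 \<and>
           (\<forall>C. C ** J0 = J0 ** C \<longrightarrow> C ** J1 = J1 ** C \<longrightarrow> C ** p t = p t ** C))"
proof -
  obtain K where K: "K > 0"
    and nK: "\<And>(A::real^'n^'n) (B::real^'n^'n). norm (A ** B) \<le> norm A * norm B * K"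
    using mmult.pos_bounded by metis
  obtain K' where K': "K' > 0"
    and nK': "\<And>(A :: real^'n^'n) x. norm (A *v x) \<le> norm A * norm x * K'"
    using bounded_bilinear.pos_bounded[OF bounded_bilinear_matrix_vector_mult] by metis
  \<comment> \<open>This size makes norm W times K and norm W times K' at most 1/2: K' then gives
    injectivity of T t, and K a uniform bound on its inverse.\<close>
  define \<epsilon> where "\<epsilon> = 1 / (2 * (K + K') * (norm J0 * K + 1))"
  have pos: "K + K' > 0" "norm J0 * K + 1 > 0" using K K' by (auto intro: add_nonneg_pos)
  then have \<epsilon>: "\<epsilon> > 0" unfolding \<epsilon>_def by simp
  have "\<exists>p. path p \<and> pathstart p = J0 \<and> pathfinish p = J1 \<and>
         (\<forall>t\<in>{0..1}. p t ** p t = - mat 1 \<and>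
           (\<forall>C. C ** J0 = J0 ** C \<longrightarrow> C ** J1 = J1 ** C \<longrightarrow> C ** p t = p t ** C))"
    if J1: "J1 ** J1 = - mat 1" and near: "norm (J1 - J0) < \<epsilon>" for J1
  proof -
    \<comment> \<open>This W gives T 1 = (1 - J1 J0) / 2, which intertwines the two structures: both
      T 1 J0 and J1 T 1 equal (J0 + J1) / 2.\<close>
    define W where "W = (-1/2) *\<^sub>R ((J1 - J0) ** J0)"
    define T where "T t = mat 1 + t *\<^sub>R W" for t
    have "norm W \<le> norm (J1 - J0) * (norm J0 * K)"
      using nK[of "J1 - J0" J0] norm_ge_zero[of "(J1 - J0) ** J0"]
      by (simp add: W_def mult.assoc del: norm_ge_zero)
    also have "\<dots> \<le> \<epsilon> * (norm J0 * K + 1)"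
      using near K \<epsilon> by (intro mult_mono) auto
    also have "\<dots> = 1 / (2 * (K + K'))" using pos by (simp add: \<epsilon>_def)
    finally have "norm W * (2 * (K + K')) \<le> 1" using pos by (simp add: field_simps)
    then have W: "norm W * K + norm W * K' \<le> 1/2" by (simp add: algebra_simps)
    have W1: "norm W * K \<le> 1/2" and W2: "norm W * K' \<le> 1/2"
      using W K K' by (smt (verit, best) mult_nonneg_nonneg norm_ge_zero)+
    have tW: "norm (t *\<^sub>R W) \<le> norm W" if "t \<in> {0..1}" for t
      using that by (simp add: mult_left_le_one_le)
    have "\<exists>R. R ** T t = mat 1" if t: "t \<in> {0..1}" for t
    proof -
      have "x = 0" if "T t *v x = 0" for x
      proof -
        have "x = - ((t *\<^sub>R W) *v x)"
          using that by (simp add: T_def matrix_vector_mult_add_rdistrib add_eq_0_iff2)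
        then have "norm x = norm ((t *\<^sub>R W) *v x)" by (metis norm_minus_cancel)
        also have "\<dots> \<le> norm (t *\<^sub>R W) * norm x * K'" by (rule nK')
        also have "\<dots> \<le> norm W * norm x * K'" using tW[OF t] K' by (intro mult_right_mono) auto
        also have "\<dots> = (norm W * K') * norm x" by simp
        also have "\<dots> \<le> 1/2 * norm x" using W2 by (intro mult_right_mono) auto
        finally show ?thesis by simp
      qed
      then show ?thesis using matrix_left_invertible_ker by blast
    qed
    then obtain R where R: "\<And>t. t \<in> {0..1} \<Longrightarrow> R t ** T t = mat 1" by metis
    then have R': "\<And>t. t \<in> {0..1} \<Longrightarrow> T t ** R t = mat 1" using matrix_left_right_inverse by blast
    have nR: "norm (R t) \<le> 2 * norm (mat 1 :: real^'n^'n)" if t: "t \<in> {0..1}" for t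
    proof -
      have "R t + R t ** (t *\<^sub>R W) = mat 1" using R[OF t] by (simp add: T_def mmult.add_right)
      then have "R t = mat 1 - R t ** (t *\<^sub>R W)" by (simp add: eq_diff_eq)
      then have "norm (R t) \<le> norm (mat 1 :: real^'n^'n) + norm (R t ** (t *\<^sub>R W))"
        by (metis norm_triangle_ineq4)
      also have "norm (R t ** (t *\<^sub>R W)) \<le> norm (R t) * norm (t *\<^sub>R W) * K" by (rule nK)
      also have "\<dots> \<le> norm (R t) * norm W * K" using tW[OF t] K
        by (intro mult_right_mono mult_left_mono) auto
      also have "\<dots> = norm (R t) * (norm W * K)" by simp
      also have "\<dots> \<le> norm (R t) * (1/2)" using W1 by (intro mult_left_mono) auto
      finally show ?thesis by simp
    qed
    \<comment> \<open>Continuity of the inverse follows from R s - R t = R s (T t - T s) R t and the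
      uniform bound on R.\<close>
    have "lipschitz_on ((2 * norm (mat 1 :: real^'n^'n))\<^sup>2 * norm W * K\<^sup>2) {0..1} R"
    proof (rule lipschitz_onI)
      fix s t :: real assume st: "s \<in> {0..1}" "t \<in> {0..1}"
      let ?c = "2 * norm (mat 1 :: real^'n^'n)"
      have "R s - R t = R s ** (T t - T s) ** R t"
        using R[OF st(1)] R'[OF st(2)] 
        by (simp add: mmult.diff_left mmult.diff_right) (simp add: matrix_mul_assoc[symmetric])
      also have "T t - T s = (t - s) *\<^sub>R W" by (simp add: T_def algebra_simps)
      finally have "norm (R s - R t) = norm (R s ** ((t - s) *\<^sub>R W) ** R t)" by simp
      also have "\<dots> \<le> norm (R s ** ((t - s) *\<^sub>R W)) * norm (R t) * K" by (rule nK)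
      also have "\<dots> \<le> (norm (R s) * norm ((t - s) *\<^sub>R W) * K) * norm (R t) * K"
        using K by (intro mult_right_mono nK) auto
      also have "\<dots> \<le> (?c * norm ((t - s) *\<^sub>R W) * K) * ?c * K"
        using nR[OF st(1)] nR[OF st(2)] K
        by (intro mult_right_mono mult_mono) (auto intro!: mult_nonneg_nonneg)
      finally show "dist (R s) (R t) \<le> ?c\<^sup>2 * norm W * K\<^sup>2 * dist s t"
        by (simp add: dist_norm power2_eq_square mult_ac abs_minus_commute)
    qed (use K in auto)
    then have contR: "continuous_on {0..1} R" by (rule lipschitz_on_continuous_on)
    define p where "p t = T t ** J0 ** R t" for t
    have contT: "continuous_on {0..1} T" unfolding T_def by (intro continuous_intros)
    have "path p" unfolding path_def p_def
      by (intro mmult.continuous_on contR contT continuous_intros)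
    moreover have "pathstart p = J0"
      using R'[of 0] by (simp add: pathstart_def p_def T_def matrix_mul_assoc[symmetric])
    moreover have "pathfinish p = J1"
    proof -
      have "2 *\<^sub>R T 1 = mat 1 - J1 ** J0"
        by (simp add: T_def W_def mmult.diff_left J0 algebra_simps scaleR_2)
      then have "(1/2) *\<^sub>R (2 *\<^sub>R T 1) = (1/2) *\<^sub>R (mat 1 - J1 ** J0)" by simp
      then have T1: "T 1 = (1/2) *\<^sub>R (mat 1 - J1 ** J0)" by simp
      have "T 1 ** J0 = J1 ** T 1"
        unfolding T1 
        by (simp add: mmult.scaleR_left mmult.scaleR_right mmult.diff_left mmult.diff_right matrix_mul_assoc J1)
           (simp add: matrix_mul_assoc[symmetric] J0 mmult.minus_left mmult.minus_right)
      then show ?thesis using R'[of 1]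
        by (simp add: pathfinish_def p_def matrix_mul_assoc[symmetric])
    qed
    moreover have "p t ** p t = - mat 1" if t: "t \<in> {0..1}" for t
    proof -
      have "p t ** p t = T t ** J0 ** (R t ** T t) ** J0 ** R t" by (simp add: p_def matrix_mul_assoc)
      also have "\<dots> = T t ** (J0 ** J0) ** R t" by (simp add: R[OF t] matrix_mul_assoc)
      also have "\<dots> = - mat 1" using R'[OF t] by (simp add: J0 mmult.minus_left mmult.minus_right)
      finally show ?thesis .
    qed
    moreover have "C ** p t = p t ** C"
      if t: "t \<in> {0..1}" and C: "C ** J0 = J0 ** C" "C ** J1 = J1 ** C" for t C
    proof -
      have "C ** W = W ** C" 
        unfolding W_def mmult.scaleR_left mmult.scaleR_right mmult.diff_left mmult.diff_right
        using matrix_commute_mult[OF C(1) C(1)] matrix_commute_mult[OF C(2) C(1)] by simp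
      then have CT: "C ** T t = T t ** C"
        by (simp add: T_def mmult.add_left mmult.add_right mmult.scaleR_left mmult.scaleR_right)
      have "C ** R t = R t ** (T t ** C) ** R t" 
        by (simp add: matrix_mul_assoc R[OF t])
      also have "\<dots> = R t ** C" 
        unfolding CT[symmetric] by (simp add: matrix_mul_assoc[symmetric] R'[OF t])
      finally show ?thesis unfolding p_def
        using matrix_commute_mult[OF matrix_commute_mult[OF CT C(1)]] by blast
    qed
    ultimately show ?thesis by blast
  qed
  then show thesis using that \<epsilon> by blast
qed

lemma floor_quotient_tendsto:
  fixes a :: real
  shows "(\<lambda>n. of_int \<lfloor>real (Suc n) * a\<rfloor> / real (Suc n)) \<longlonglongrightarrow> a"
proof (rule real_tendsto_sandwich)
  show "(\<lambda>n. a - inverse (real (Suc n))) \<longlonglongrightarrow> a"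
    using tendsto_diff[OF tendsto_const LIMSEQ_inverse_real_of_nat] by simp
  show "(\<lambda>n. a) \<longlonglongrightarrow> a" by simp
  show "\<forall>\<^sub>F n in sequentially. a - inverse (real (Suc n)) \<le> of_int \<lfloor>real (Suc n) * a\<rfloor> / real (Suc n)"
  proof (intro always_eventually allI)
    fix n
    have "real (Suc n) * a - 1 \<le> of_int \<lfloor>real (Suc n) * a\<rfloor>" by linarith
    then have "(real (Suc n) * a - 1) / real (Suc n) \<le> of_int \<lfloor>real (Suc n) * a\<rfloor> / real (Suc n)"
      by (intro divide_right_mono) auto
    then show "a - inverse (real (Suc n)) \<le> of_int \<lfloor>real (Suc n) * a\<rfloor> / real (Suc n)"
      by (simp only: diff_divide_distrib) (simp add: inverse_eq_divide del: of_nat_Suc)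
  qed
  show "\<forall>\<^sub>F n in sequentially. of_int \<lfloor>real (Suc n) * a\<rfloor> / real (Suc n) \<le> a"
    by (intro always_eventually allI) (simp add: divide_le_eq mult.commute del: of_nat_Suc)
qed

text \<open>Entries are rounded down to multiples of 1 / (n + 1). Rounding alone would lose
  skewness, so the result is antisymmetrized; the halving in this step is the extra factor 2 in the
  denominator.\<close>

lemma skew_rational_approximation:
  fixes N :: "real^'n^'n"
  assumes "transpose N = - N"
  obtains F :: "nat \<Rightarrow> real^'n^'n" where "F \<longlonglongrightarrow> N" "\<And>n. transpose (F n) = - F n"
    "\<And>n i j. 2 * real (Suc n) * F n $ i $ j \<in> \<int>"
proof -
  let ?q = "\<lambda>n (a::real). of_int \<lfloor>real (Suc n) * a\<rfloor> / real (Suc n)"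
  define F where "F n = (\<chi> i j. (?q n (N $ i $ j) - ?q n (N $ j $ i)) / 2)" for n
  have skew: "N $ j $ i = - N $ i $ j" for i j
    using arg_cong[OF assms, of "\<lambda>A. A $ i $ j"] by (simp add: transpose_def)
  have "(\<lambda>n. F n $ i $ j) \<longlonglongrightarrow> N $ i $ j" for i j
  proof -
    have "(\<lambda>n. (?q n (N $ i $ j) - ?q n (N $ j $ i)) / 2) \<longlonglongrightarrow> (N $ i $ j - N $ j $ i) / 2"
      by (intro tendsto_intros floor_quotient_tendsto) auto
    then show ?thesis by (simp add: F_def skew[of j i] del: of_nat_Suc)
  qed
  then have "F \<longlonglongrightarrow> N" by (intro vec_tendstoI) auto
  moreover have "transpose (F n) = - F n" for n
    by (simp add: F_def transpose_def vec_eq_iff minus_divide_left)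
  moreover have "2 * real (Suc n) * F n $ i $ j \<in> \<int>" for n i j
  proof -
    have "2 * real (Suc n) * F n $ i $ j = of_int (\<lfloor>real (Suc n) * N $ i $ j\<rfloor> - \<lfloor>real (Suc n) * N $ j $ i\<rfloor>)"
      by (simp add: F_def field_simps del: of_nat_Suc)
    then show ?thesis by (metis Ints_of_int)
  qed
  ultimately show thesis using that by blast
qed

lemma transpose_sum: "transpose (\<Sum>x\<in>S. f x :: real^'n^'m) = (\<Sum>x\<in>S. transpose (f x))"
  by (rule linear_sum[OF linear_transpose])

text \<open>Right multiplication by \<nu> is injective and therefore permutes the finite set S, so
  the sum is only reindexed.\<close>

lemma sum_congruence_invariant:
  fixes E :: "real^'n^'n"
  assumes fin: "finite S" and mult: "\<And>\<mu> \<nu>. \<mu> \<in> S \<Longrightarrow> \<nu> \<in> S \<Longrightarrow> \<mu> ** \<nu> \<in> S"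
    and inv: "\<And>\<mu>. \<mu> \<in> S \<Longrightarrow> invertible \<mu>" and \<nu>: "\<nu> \<in> S"
  shows "transpose \<nu> ** (\<Sum>\<mu>\<in>S. transpose \<mu> ** E ** \<mu>) ** \<nu> = (\<Sum>\<mu>\<in>S. transpose \<mu> ** E ** \<mu>)"
proof -
  obtain \<nu>' where \<nu>': "\<nu> ** \<nu>' = mat 1" using inv[OF \<nu>] by (auto simp: invertible_def)
  have inj: "inj_on (\<lambda>\<mu>. \<mu> ** \<nu>) S"
    by (rule inj_on_inverseI[where g = "\<lambda>\<mu>. \<mu> ** \<nu>'"]) (simp add: matrix_mul_assoc[symmetric] \<nu>')
  then have "(\<lambda>\<mu>. \<mu> ** \<nu>) ` S = S"
    using fin mult[OF _ \<nu>] by (intro card_subset_eq) (auto simp: card_image)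
  then have "(\<Sum>\<mu>\<in>S. transpose \<mu> ** E ** \<mu>) = (\<Sum>\<mu>\<in>S. transpose (\<mu> ** \<nu>) ** E ** (\<mu> ** \<nu>))"
    using sum.reindex[OF inj, of "\<lambda>\<mu>. transpose \<mu> ** E ** \<mu>"] by simp
  also have "\<dots> = transpose \<nu> ** (\<Sum>\<mu>\<in>S. transpose \<mu> ** E ** \<mu>) ** \<nu>"
    by (simp add: mmult.sum_left mmult.sum_right matrix_transpose_mul matrix_mul_assoc)
  finally show ?thesis ..
qed

lemma inner_vector_matrix_mult:
  fixes A :: "real^'n^'m"
  shows "x \<bullet> (w v* A) = (A *v x) \<bullet> w"
  by (metis dot_lmul_matrix inner_commute)

text \<open>The last four conclusions are Riemann's conditions on J and E. In the proof b is
  skew-adjoint for the inner product G0, so A = - b b is self-adjoint, and its inverse square root Y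
  is self-adjoint and commutes with b. Hence J = b Y squares to -1 and the form G0 b is
  J-invariant.\<close>

proposition polarizable_deformation:
  fixes \<Lambda> :: "(real^'n) set" and J0 :: "real^'n^'n"
  assumes lat: "full_lattice \<Lambda>" and J0: "J0 ** J0 = - mat 1"
    and fin: "finite S" and one: "mat 1 \<in> S"
    and mult: "\<And>\<mu> \<nu>. \<mu> \<in> S \<Longrightarrow> \<nu> \<in> S \<Longrightarrow> \<mu> ** \<nu> \<in> S"
    and inv: "\<And>\<mu>. \<mu> \<in> S \<Longrightarrow> invertible \<mu>"
    and comm: "\<And>\<mu>. \<mu> \<in> S \<Longrightarrow> \<mu> ** J0 = J0 ** \<mu>"
    and pres: "\<And>\<mu> l. \<mu> \<in> S \<Longrightarrow> l \<in> \<Lambda> \<Longrightarrow> \<mu> *v l \<in> \<Lambda>"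
  obtains p and J E :: "real^'n^'n" where
    "path p" "pathstart p = J0" "pathfinish p = J"
    "\<And>t. t \<in> {0..1} \<Longrightarrow> p t ** p t = - mat 1"
    "\<And>t \<mu>. t \<in> {0..1} \<Longrightarrow> \<mu> \<in> S \<Longrightarrow> \<mu> ** p t = p t ** \<mu>"
    "transpose E = - E" "transpose J ** E ** J = E"
    "\<And>x. x \<noteq> 0 \<Longrightarrow> (J *v x) \<bullet> (E *v x) > 0"
    "\<And>l l'. l \<in> \<Lambda> \<Longrightarrow> l' \<in> \<Lambda> \<Longrightarrow> \<exists>k::int. l \<bullet> (E *v l') = 2 * of_int k"
proof -
  let ?av = "\<lambda>E. (\<Sum>\<mu>\<in>S. transpose \<mu> ** E ** \<mu>) :: real^'n^'n"
  have inv_av: "transpose \<nu> ** ?av E ** \<nu> = ?av E" if "\<nu> \<in> S" for \<nu> E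
    using sum_congruence_invariant[OF fin mult inv that] .
  have tav: "transpose (?av E) = ?av (transpose E)" for E
    by (simp add: transpose_sum matrix_transpose_mul matrix_mul_assoc)
  have avm: "?av (- E) = - ?av E" for E
    by (simp add: mmult.minus_left mmult.minus_right sum_negf)
  \<comment> \<open>The two summands are exchanged by conjugation with J0, and every \<mu> commutes
    with J0; this makes G0 invariant under J0 as well as under S.\<close>
  define G0 where "G0 = ?av (mat 1 + transpose J0 ** J0)"
  have sym: "transpose G0 = G0"
    unfolding G0_def tav by (simp add: linear_add[OF linear_transpose] transpose_mat matrix_transpose_mul)
  have tJ0: "transpose J0 ** transpose J0 = - mat 1"
    using arg_cong[OF J0, of transpose]
    by (simp add: matrix_transpose_mul linear_neg[OF linear_transpose] transpose_mat)
  have J0_inv: "transpose J0 ** G0 ** J0 = G0"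
  proof -
    have "transpose J0 ** (transpose \<mu> ** (mat 1 + transpose J0 ** J0) ** \<mu>) ** J0 =
        transpose \<mu> ** (mat 1 + transpose J0 ** J0) ** \<mu>" if "\<mu> \<in> S" for \<mu>
    proof -
      have "transpose J0 ** transpose \<mu> = transpose \<mu> ** transpose J0"
        using arg_cong[OF comm[OF that], of transpose] by (simp add: matrix_transpose_mul)
      then have "transpose J0 ** (transpose \<mu> ** (mat 1 + transpose J0 ** J0) ** \<mu>) ** J0 =
          transpose \<mu> ** transpose J0 ** (mat 1 + transpose J0 ** J0) ** (\<mu> ** J0)"
        by (simp add: matrix_mul_assoc)
      also have "\<dots> = transpose \<mu> ** (transpose J0 ** (mat 1 + transpose J0 ** J0) ** J0) ** \<mu>"
        unfolding comm[OF that] by (simp add: matrix_mul_assoc)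
      also have "transpose J0 ** (mat 1 + transpose J0 ** J0) ** J0 =
          transpose J0 ** J0 + (transpose J0 ** transpose J0) ** (J0 ** J0)"
        by (simp add: mmult.add_left mmult.add_right matrix_mul_assoc)
      also have "\<dots> = mat 1 + transpose J0 ** J0" by (simp add: tJ0 J0 mmult.minus_left mmult.minus_right)
      finally show ?thesis .
    qed
    then show ?thesis unfolding G0_def by (simp add: mmult.sum_left mmult.sum_right)
  qed
  have G0J0: "G0 ** J0 = - (transpose J0 ** G0)"
  proof -
    have "transpose J0 ** (transpose J0 ** G0 ** J0) = transpose J0 ** G0" by (simp add: J0_inv)
    then have "transpose J0 ** transpose J0 ** (G0 ** J0) = transpose J0 ** G0"
      by (simp add: matrix_mul_assoc)
    then have "- (G0 ** J0) = transpose J0 ** G0" by (simp add: tJ0 mmult.minus_left)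
    then show ?thesis by (metis minus_minus)
  qed
  have G0_pos: "x \<bullet> (G0 *v x) \<ge> x \<bullet> x" for x
  proof -
    have "x \<bullet> (G0 *v x) = (\<Sum>\<mu>\<in>S. x \<bullet> ((transpose \<mu> ** (mat 1 + transpose J0 ** J0) ** \<mu>) *v x))"
      unfolding G0_def
      by (simp add: bounded_bilinear.sum_left[OF bounded_bilinear_matrix_vector_mult] inner_sum_right)
    also have "\<dots> = (\<Sum>\<mu>\<in>S. (\<mu> *v x) \<bullet> (\<mu> *v x) + (J0 *v (\<mu> *v x)) \<bullet> (J0 *v (\<mu> *v x)))"
      by (simp add: matrix_vector_mul_assoc[symmetric] inner_vector_matrix_mult
          matrix_vector_mult_add_rdistrib inner_add_right)
    also have "\<dots> \<ge> (mat 1 *v x) \<bullet> (mat 1 *v x) + (J0 *v (mat 1 *v x)) \<bullet> (J0 *v (mat 1 *v x))"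
      by (rule member_le_sum[OF one _ fin]) auto
    finally have "x \<bullet> x + (J0 *v x) \<bullet> (J0 *v x) \<le> x \<bullet> (G0 *v x)" by simp
    then show ?thesis using inner_ge_zero[of "J0 *v x"] by linarith
  qed
  obtain P0 where P0: "P0 ** G0 = mat 1"
  proof -
    have "x = 0" if "G0 *v x = 0" for x
      using G0_pos[of x] that by simp (metis inner_eq_zero_iff inner_ge_zero order_antisym)
    then show thesis using that matrix_left_invertible_ker by blast
  qed
  have P0': "G0 ** P0 = mat 1" using P0 matrix_left_right_inverse by blast
  obtain M N :: "real^'n^'n" where MN: "N ** M = mat 1" "M ** N = mat 1"
    and L: "\<Lambda> = {M *v x |x. \<forall>i. x $ i \<in> \<int>}"
    by (rule full_lattice_matrix[OF lat])
  have "transpose (G0 ** J0) = transpose J0 ** G0" by (simp only: matrix_transpose_mul sym)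
  then have "transpose (G0 ** J0) = - (G0 ** J0)" by (simp only: G0J0 minus_minus)
  moreover have "transpose (transpose M ** (G0 ** J0) ** M) = transpose M ** transpose (G0 ** J0) ** M"
    by (simp only: matrix_transpose_mul transpose_transpose matrix_mul_assoc)
  ultimately have "transpose (transpose M ** (G0 ** J0) ** M) = - (transpose M ** (G0 ** J0) ** M)"
    by (simp only: mmult.minus_left mmult.minus_right)
  then obtain F where F: "F \<longlonglongrightarrow> transpose M ** (G0 ** J0) ** M" "\<And>n. transpose (F n) = - F n"
    "\<And>n i j. 2 * real (Suc n) * F n $ i $ j \<in> \<int>"
    by (rule skew_rational_approximation) (rule that)
  define c where "c = inverse (real (card S))"
  have cS: "card S > 0" using fin one by (auto simp: card_gt_0_iff)
  \<comment> \<open>N passes to lattice coordinates, in which F n has rational entries. The constant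
    c makes the sum over S an average, so that the S-invariant limit G0 ** J0 is kept.\<close>
  define E where "E n = c *\<^sub>R ?av (transpose N ** F n ** N)" for n
  define B where "B n = P0 ** E n" for n
  have EB: "E n = G0 ** B n" for n by (simp add: B_def matrix_mul_assoc P0')
  have limE: "E \<longlonglongrightarrow> G0 ** J0"
  proof -
    have "E \<longlonglongrightarrow> c *\<^sub>R ?av (transpose N ** (transpose M ** (G0 ** J0) ** M) ** N)"
      unfolding E_def by (intro tendsto_intros tendsto_scaleR tendsto_sum mmult.tendsto F(1))
    also have "transpose N ** (transpose M ** (G0 ** J0) ** M) ** N = transpose (M ** N) ** (G0 ** J0) ** (M ** N)"
      by (simp add: matrix_transpose_mul matrix_mul_assoc)
    also have "\<dots> = G0 ** J0" by (simp add: MN transpose_mat)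
    also have "?av (G0 ** J0) = (\<Sum>\<mu>\<in>S. G0 ** J0)"
    proof (rule sum.cong)
      fix \<mu> assume "\<mu> \<in> S"
      have "transpose \<mu> ** (G0 ** J0) ** \<mu> = (transpose \<mu> ** G0 ** \<mu>) ** J0"
        using comm[OF \<open>\<mu> \<in> S\<close>] by (simp add: matrix_mul_assoc[symmetric])
      then show "transpose \<mu> ** (G0 ** J0) ** \<mu> = G0 ** J0"
        using inv_av[OF \<open>\<mu> \<in> S\<close>] unfolding G0_def by simp
    qed simp
    finally have "E \<longlonglongrightarrow> c *\<^sub>R (real (card S) *\<^sub>R (G0 ** J0))" by (simp only: sum_constant_scaleR)
    then show ?thesis using cS by (simp add: c_def)
  qed
  have limB: "B \<longlonglongrightarrow> J0"
  proof -
    have "B \<longlonglongrightarrow> P0 ** (G0 ** J0)" unfolding B_def by (intro mmult.tendsto tendsto_const limE)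
    then show ?thesis by (simp add: matrix_mul_assoc P0)
  qed
  have skewE: "transpose (E n) = - E n" for n
  proof -
    have "transpose (transpose N ** F n ** N) = - (transpose N ** F n ** N)"
      by (simp add: matrix_transpose_mul F(2) matrix_mul_assoc mmult.minus_left mmult.minus_right)
    then show ?thesis by (simp add: E_def linear_scale[OF linear_transpose] tav avm)
  qed
  \<comment> \<open>B n relates two S-invariant forms, G0 and E n, and is therefore
    S-equivariant.\<close>
  have commB: "\<mu> ** B n = B n ** \<mu>" if \<mu>: "\<mu> \<in> S" for \<mu> n
  proof -
    obtain \<mu>' where \<mu>': "\<mu> ** \<mu>' = mat 1" "\<mu>' ** \<mu> = mat 1" using inv[OF \<mu>] by (auto simp: invertible_def)
    have G: "transpose \<mu> ** G0 ** \<mu> = G0" using inv_av[OF \<mu>] by (simp add: G0_def)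
    have Ei: "transpose \<mu> ** E n ** \<mu> = E n"
      using inv_av[OF \<mu>] by (simp add: E_def mmult.scaleR_left mmult.scaleR_right)
    have e1: "transpose \<mu> ** (G0 ** (\<mu> ** B n)) = transpose \<mu> ** (G0 ** (B n ** \<mu>))"
      using G Ei by (simp add: EB matrix_mul_assoc)
    have e2: "transpose \<mu>' ** transpose \<mu> = mat 1"
      using arg_cong[OF \<mu>'(1), of transpose] by (simp only: matrix_transpose_mul transpose_mat)
    have "transpose \<mu>' ** transpose \<mu> ** (G0 ** (\<mu> ** B n)) = transpose \<mu>' ** transpose \<mu> ** (G0 ** (B n ** \<mu>))"
      unfolding matrix_mul_assoc[symmetric, of "transpose \<mu>'"] e1 ..
    then have "G0 ** (\<mu> ** B n) = G0 ** (B n ** \<mu>)" by (simp only: e2 matrix_mul_lid)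
    then have "P0 ** (G0 ** (\<mu> ** B n)) = P0 ** (G0 ** (B n ** \<mu>))" by (rule arg_cong)
    then show ?thesis by (simp only: matrix_mul_assoc P0 matrix_mul_lid)
  qed
  obtain K where K: "K > 0" and nK: "\<And>(A :: real^'n^'n) x. norm (A *v x) \<le> norm A * norm x * K"
    using bounded_bilinear.pos_bounded[OF bounded_bilinear_matrix_vector_mult] by metis
  obtain \<epsilon> where "\<epsilon> > 0" and joined:
    "\<And>J1. J1 ** J1 = - mat 1 \<Longrightarrow> norm (J1 - J0) < \<epsilon> \<Longrightarrow>
       \<exists>p. path p \<and> pathstart p = J0 \<and> pathfinish p = J1 \<and>
         (\<forall>t\<in>{0..1}. p t ** p t = - mat 1 \<and>
           (\<forall>C. C ** J0 = J0 ** C \<longrightarrow> C ** J1 = J1 ** C \<longrightarrow> C ** p t = p t ** C))"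
    by (rule complex_structures_joined_by_path[OF J0]) (rule that)
  \<comment> \<open>Both requirements are continuous in the pair (b, Y) and hold at (J0, mat 1). The
    first allows b Y to be joined to J0, the second keeps the form positive.\<close>
  have ev: "\<forall>\<^sub>F z in nhds J0 \<times>\<^sub>F nhds (mat 1).
      norm (fst z ** snd z - J0) < \<epsilon> \<and> norm (G0 ** (fst z ** fst z ** snd z) + G0) * K < 1"
  proof -
    have f: "((\<lambda>z. fst z) \<longlongrightarrow> J0) (nhds J0 \<times>\<^sub>F nhds (mat 1 :: real^'n^'n))"
      and s: "((\<lambda>z. snd z) \<longlongrightarrow> mat 1) (nhds J0 \<times>\<^sub>F nhds (mat 1 :: real^'n^'n))"
      by (rule filterlim_fst, rule filterlim_snd)
    have "((\<lambda>z. norm (fst z ** snd z - J0)) \<longlongrightarrow> norm (J0 ** mat 1 - J0)) (nhds J0 \<times>\<^sub>F nhds (mat 1))"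
      by (intro tendsto_intros mmult.tendsto f s)
    moreover have "((\<lambda>z. norm (G0 ** (fst z ** fst z ** snd z) + G0) * K) \<longlongrightarrow>
        norm (G0 ** (J0 ** J0 ** mat 1) + G0) * K) (nhds J0 \<times>\<^sub>F nhds (mat 1))"
      by (intro tendsto_intros mmult.tendsto f s)
    ultimately show ?thesis using \<open>\<epsilon> > 0\<close>
      by (intro eventually_conj order_tendstoD(2)) (auto simp: J0 mmult.minus_right)
  qed
  then obtain Pf Qf where Pf: "eventually Pf (nhds J0)" and Qf: "eventually Qf (nhds (mat 1 :: real^'n^'n))"
    and PQ': "\<forall>x y. Pf x \<longrightarrow> Qf y \<longrightarrow>
       norm (fst (x, y) ** snd (x, y) - J0) < \<epsilon> \<and> norm (G0 ** (fst (x, y) ** fst (x, y) ** snd (x, y)) + G0) * K < 1"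
    unfolding eventually_prod_filter by (elim exE conjE) (rule that)
  have PQ: "norm (x ** y - J0) < \<epsilon>" "norm (G0 ** (x ** x ** y) + G0) * K < 1" if "Pf x" "Qf y" for x y
    using PQ' that by simp_all
  obtain r where r: "r > 0" "\<And>Y. norm (Y - mat 1) < r \<Longrightarrow> Qf Y"
    using Qf unfolding eventually_nhds_metric dist_norm by blast
  obtain \<eta> where \<eta>: "\<eta> > 0" "\<And>A :: real^'n^'n. norm (A - mat 1) < \<eta> \<Longrightarrow>
       \<exists>Y. norm (Y - mat 1) \<le> r/2 \<and> Y ** Y ** A = mat 1 \<and> (\<forall>C. C ** A = A ** C \<longrightarrow> C ** Y = Y ** C) \<and>
         (\<forall>G. G ** A = transpose A ** G \<longrightarrow> G ** Y = transpose Y ** G)"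
    by (rule inverse_sqrt_near_one[OF half_gt_zero[OF r(1)]]) (rule that)
  have "(\<lambda>n. - (B n ** B n)) \<longlonglongrightarrow> - (J0 ** J0)"
    by (intro tendsto_intros mmult.tendsto limB)
  then have "\<forall>\<^sub>F n in sequentially. norm (- (B n ** B n) - mat 1) < \<eta>"
    using \<eta>(1) by (auto simp: J0 tendsto_iff dist_norm)
  moreover have "\<forall>\<^sub>F n in sequentially. Pf (B n)"
    using limB Pf by (simp add: filterlim_iff)
  ultimately obtain n where n: "norm (- (B n ** B n) - mat 1) < \<eta>" "Pf (B n)"
    using eventually_happens[OF eventually_conj] by fastforce
  define b where "b = B n"
  define A where "A = - (b ** b)"
  obtain Y where Y: "norm (Y - mat 1) \<le> r/2" "Y ** Y ** A = mat 1" "\<And>C. C ** A = A ** C \<Longrightarrow> C ** Y = Y ** C"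
      "\<And>G. G ** A = transpose A ** G \<Longrightarrow> G ** Y = transpose Y ** G"
    using \<eta>(2)[OF n(1)] unfolding A_def b_def by blast
  have QY: "Qf Y" using r(1) Y(1) by (intro r(2)) linarith
  define J where "J = b ** Y"
  have nearJ: "norm (J - J0) < \<epsilon>" and nearA: "norm (G0 ** (b ** b ** Y) + G0) * K < 1"
    using PQ[OF n(2) QY] by (simp_all add: J_def b_def)
  have bA: "b ** A = A ** b" by (simp add: A_def mmult.minus_left mmult.minus_right matrix_mul_assoc)
  then have bY: "b ** Y = Y ** b" by (rule Y(3))
  have tb: "transpose b ** G0 = - (G0 ** b)"
    using skewE[of n] by (simp add: EB b_def matrix_transpose_mul sym)
  have bbYY: "b ** b ** (Y ** Y) = - mat 1"
  proof -
    have "A ** Y = Y ** A" using Y(3)[of A] by simp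
    then have "A ** (Y ** Y) = Y ** Y ** A" by (rule matrix_commute_mult) fact
    then have "A ** (Y ** Y) = mat 1" using Y(2) by simp
    then have "- (b ** b ** (Y ** Y)) = mat 1" by (simp only: A_def mmult.minus_left)
    then show ?thesis by (metis minus_minus)
  qed
  have JJ: "J ** J = - mat 1"
  proof -
    have "J ** J = b ** (Y ** b) ** Y" by (simp add: J_def matrix_mul_assoc)
    also have "\<dots> = b ** b ** (Y ** Y)" unfolding bY[symmetric] by (simp add: matrix_mul_assoc)
    finally show ?thesis using bbYY by simp
  qed
  have GA: "G0 ** A = transpose A ** G0"
  proof -
    have "transpose (b ** b) ** G0 = transpose b ** (transpose b ** G0)"
      by (simp add: matrix_transpose_mul matrix_mul_assoc)
    also have "\<dots> = G0 ** (b ** b)"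
      by (simp add: tb mmult.minus_right matrix_mul_assoc) (simp add: tb mmult.minus_left)
    finally show ?thesis by (simp add: A_def mmult.minus_left mmult.minus_right linear_neg[OF linear_transpose])
  qed
  have GY: "G0 ** Y = transpose Y ** G0" using Y(4)[OF GA] .
  \<comment> \<open>Here card S cancels the averaging constant, 2 (n + 1) clears the denominators of
    F n, and the remaining 2 makes the form even on \<Lambda>.\<close>
  define k where "k = 4 * real (Suc n) * real (card S)"
  have k: "k > 0" using cS by (simp add: k_def)
  have compat: "transpose J ** (G0 ** b) ** J = G0 ** b"
  proof -
    have "transpose J ** (G0 ** b) ** J = transpose Y ** (transpose b ** G0) ** b ** J"
      by (simp add: J_def matrix_transpose_mul matrix_mul_assoc)
    also have "\<dots> = - (transpose Y ** G0 ** b ** b ** J)"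
      by (simp add: tb mmult.minus_left mmult.minus_right matrix_mul_assoc)
    also have "\<dots> = - (G0 ** (b ** Y) ** b ** J)" unfolding GY[symmetric] bY by (simp add: matrix_mul_assoc)
    also have "\<dots> = - (G0 ** b ** (Y ** b) ** J)" by (simp add: matrix_mul_assoc)
    also have "\<dots> = - (G0 ** b ** (J ** J))" unfolding bY[symmetric] by (simp add: J_def matrix_mul_assoc)
    finally show ?thesis by (simp add: JJ mmult.minus_right)
  qed
  have pos: "(J *v x) \<bullet> ((G0 ** b) *v x) > 0" if "x \<noteq> 0" for x
  proof -
    \<comment> \<open>D is the deviation of - G0 b b Y from G0, which is 0 at (J0, mat 1). The
      quadratic form to be bounded below is that of G0 - D.\<close>
    define D where "D = G0 ** (b ** b ** Y) + G0"
    have "\<bar>x \<bullet> (D *v x)\<bar> \<le> norm x * norm (D *v x)" by (rule Cauchy_Schwarz_ineq2)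
    also have "\<dots> \<le> norm x * (norm D * norm x * K)" by (intro mult_left_mono nK) auto
    also have "\<dots> = (norm D * K) * (x \<bullet> x)" by (simp add: dot_square_norm power2_eq_square)
    also have "\<dots> < 1 * (x \<bullet> x)" using nearA that by (intro mult_strict_right_mono) (auto simp: D_def)
    finally have D: "x \<bullet> (D *v x) < x \<bullet> x" by simp
    have "(J *v x) \<bullet> ((G0 ** b) *v x) = x \<bullet> ((transpose J ** G0 ** b) *v x)"
      by (simp add: matrix_vector_mul_assoc[symmetric] inner_vector_matrix_mult)
    also have "transpose J ** G0 ** b = transpose Y ** (transpose b ** G0) ** b"
      by (simp add: J_def matrix_transpose_mul matrix_mul_assoc)
    also have "\<dots> = - (transpose Y ** G0 ** b ** b)"
      by (simp add: tb mmult.minus_left mmult.minus_right matrix_mul_assoc)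
    also have "\<dots> = - (G0 ** (b ** Y) ** b)" unfolding GY[symmetric] bY by (simp add: matrix_mul_assoc)
    also have "\<dots> = - (G0 ** b ** (Y ** b))" by (simp add: matrix_mul_assoc)
    also have "\<dots> = G0 - D" unfolding bY[symmetric] by (simp add: D_def matrix_mul_assoc)
    finally have "(J *v x) \<bullet> ((G0 ** b) *v x) = x \<bullet> (G0 *v x) - x \<bullet> (D *v x)"
      by (simp add: matrix_vector_mult_diff_rdistrib inner_diff_right)
    then show ?thesis using D G0_pos[of x] by linarith
  qed
  have integral: "\<exists>m::int. l \<bullet> ((k *\<^sub>R (G0 ** b)) *v l') = 2 * of_int m" if l: "l \<in> \<Lambda>" "l' \<in> \<Lambda>" for l l'
  proof -
    have 1: "2 * real (Suc n) * (u \<bullet> ((transpose N ** F n ** N) *v u')) \<in> \<int>" if u: "u \<in> \<Lambda>" "u' \<in> \<Lambda>" for u u'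
    proof -
      obtain x y where x: "u = M *v x" "\<And>i. x $ i \<in> \<int>" and y: "u' = M *v y" "\<And>i. y $ i \<in> \<int>"
        using u unfolding L mem_Collect_eq by (elim exE conjE) (rule that; blast)
      have "u \<bullet> ((transpose N ** F n ** N) *v u') = (N *v u) \<bullet> (F n *v (N *v u'))"
        by (simp add: matrix_vector_mul_assoc[symmetric] inner_vector_matrix_mult)
      also have "\<dots> = x \<bullet> (F n *v y)" by (simp add: x(1) y(1) matrix_vector_mul_assoc MN)
      also have "\<dots> = (\<Sum>i\<in>UNIV. \<Sum>j\<in>UNIV. x $ i * (F n $ i $ j * y $ j))"
        by (simp add: inner_vec_def matrix_vector_mult_def sum_distrib_left)
      finally have "2 * real (Suc n) * (u \<bullet> ((transpose N ** F n ** N) *v u')) =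
          (\<Sum>i\<in>UNIV. \<Sum>j\<in>UNIV. x $ i * ((2 * real (Suc n) * F n $ i $ j) * y $ j))"
        by (simp add: sum_distrib_left mult_ac del: of_nat_Suc)
      also have "\<dots> \<in> \<int>" by (intro Ints_sum Ints_mult x(2) y(2) F(3))
      finally show ?thesis .
    qed
    have "k *\<^sub>R (G0 ** b) = (4 * real (Suc n)) *\<^sub>R ?av (transpose N ** F n ** N)"
      using cS by (simp add: b_def EB[symmetric] E_def c_def k_def del: of_nat_Suc)
    then have "l \<bullet> ((k *\<^sub>R (G0 ** b)) *v l') =
        4 * real (Suc n) * (\<Sum>\<mu>\<in>S. l \<bullet> ((transpose \<mu> ** (transpose N ** F n ** N) ** \<mu>) *v l'))"
      by (simp add: scaleR_matrix_vector_assoc[symmetric]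
          bounded_bilinear.sum_left[OF bounded_bilinear_matrix_vector_mult] inner_sum_right del: of_nat_Suc)
    also have "\<dots> = 2 * (\<Sum>\<mu>\<in>S. 2 * real (Suc n) * ((\<mu> *v l) \<bullet> ((transpose N ** F n ** N) *v (\<mu> *v l'))))"
      by (simp add: sum_distrib_left matrix_vector_mul_assoc[symmetric] inner_vector_matrix_mult mult.assoc
          del: of_nat_Suc)
    finally have eq: "l \<bullet> ((k *\<^sub>R (G0 ** b)) *v l') =
      2 * (\<Sum>\<mu>\<in>S. 2 * real (Suc n) * ((\<mu> *v l) \<bullet> ((transpose N ** F n ** N) *v (\<mu> *v l'))))" .
    have "(\<Sum>\<mu>\<in>S. 2 * real (Suc n) * ((\<mu> *v l) \<bullet> ((transpose N ** F n ** N) *v (\<mu> *v l')))) \<in> \<int>"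
      by (intro Ints_sum 1 pres l)
    then obtain m where m: "(\<Sum>\<mu>\<in>S. 2 * real (Suc n) * ((\<mu> *v l) \<bullet> ((transpose N ** F n ** N) *v (\<mu> *v l')))) = of_int m"
      by (rule Ints_cases)
    show ?thesis unfolding eq m by blast
  qed
  obtain p where p: "path p" "pathstart p = J0" "pathfinish p = J"
    and p': "\<forall>t\<in>{0..1}. p t ** p t = - mat 1 \<and>
           (\<forall>C. C ** J0 = J0 ** C \<longrightarrow> C ** J = J ** C \<longrightarrow> C ** p t = p t ** C)"
    using joined[OF JJ nearJ] by (elim exE conjE) (rule that)
  have commJ: "\<mu> ** J = J ** \<mu>" if "\<mu> \<in> S" for \<mu>
  proof -
    have \<mu>b: "\<mu> ** b = b ** \<mu>" using commB[OF that] by (simp add: b_def)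
    have "\<mu> ** A = A ** \<mu>" using matrix_commute_mult[OF \<mu>b \<mu>b] by (simp add: A_def mmult.minus_left mmult.minus_right)
    then show ?thesis unfolding J_def by (intro matrix_commute_mult \<mu>b Y(3))
  qed
  show thesis
  proof (rule that[of p J "k *\<^sub>R (G0 ** b)"])
    show "\<mu> ** p t = p t ** \<mu>" if "t \<in> {0..1}" "\<mu> \<in> S" for t \<mu>
      using p' comm[OF that(2)] commJ[OF that(2)] that(1) by simp
    show "transpose (k *\<^sub>R (G0 ** b)) = - (k *\<^sub>R (G0 ** b))"
      using skewE[of n] by (simp add: linear_scale[OF linear_transpose] EB b_def)
    show "transpose J ** (k *\<^sub>R (G0 ** b)) ** J = k *\<^sub>R (G0 ** b)"
      using compat by (simp add: mmult.scaleR_left mmult.scaleR_right)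
    show "(J *v x) \<bullet> ((k *\<^sub>R (G0 ** b)) *v x) > 0" if "x \<noteq> 0" for x
      using pos[OF that] k by (simp add: scaleR_matrix_vector_assoc[symmetric])
  qed (use p p' integral in auto)
qed

section \<open>Holomorphic maps to projective space\<close>

abbreviation cvec_dist :: "nat \<Rightarrow> (nat \<Rightarrow> complex) \<Rightarrow> (nat \<Rightarrow> complex) \<Rightarrow> real" where
  "cvec_dist N w z \<equiv> (\<Sum>i\<le>N. cmod (w i - z i))"

text \<open>A real derivative, split along the coordinate axes and with values in any normed space:
  the maps built below pass through real vector spaces, and complex linearity is verified only for
  the final composite.\<close>

definition has_cvec_derivative ::
    "nat \<Rightarrow> ((nat \<Rightarrow> complex) \<Rightarrow> 'b::real_normed_vector) \<Rightarrow> (nat \<Rightarrow> complex \<Rightarrow> 'b) \<Rightarrow> (nat \<Rightarrow> complex) \<Rightarrow> bool"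
  where
  "has_cvec_derivative N f D z \<longleftrightarrow> (\<forall>i\<le>N. bounded_linear (D i)) \<and>
     (\<forall>\<epsilon>>0. \<exists>\<delta>>0. \<forall>w \<in> cvecs N. cvec_dist N w z < \<delta> \<longrightarrow>
        norm (f w - f z - (\<Sum>i\<le>N. D i (w i - z i))) \<le> \<epsilon> * cvec_dist N w z)"

lemma has_cvec_derivativeE:
  assumes "has_cvec_derivative N f D z" "\<epsilon> > 0"
  obtains \<delta> where "\<delta> > 0" "\<And>w. w \<in> cvecs N \<Longrightarrow> cvec_dist N w z < \<delta> \<Longrightarrow>
        norm (f w - f z - (\<Sum>i\<le>N. D i (w i - z i))) \<le> \<epsilon> * cvec_dist N w z"
proof -
  have "\<exists>\<delta>>0. \<forall>w \<in> cvecs N. cvec_dist N w z < \<delta> \<longrightarrow>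
        norm (f w - f z - (\<Sum>i\<le>N. D i (w i - z i))) \<le> \<epsilon> * cvec_dist N w z"
    using assms unfolding has_cvec_derivative_def by simp
  then show thesis by (elim exE conjE) (rule that, assumption, blast)
qed

lemma cvec_dist_nonneg: "cvec_dist N w z \<ge> 0"
  by (intro sum_nonneg) auto

lemma cvec_linear_bound:
  assumes "\<forall>i\<le>N. bounded_linear (D i :: complex \<Rightarrow> 'b::real_normed_vector)"
  obtains B where "B > 0" "\<And>w z. norm (\<Sum>i\<le>N. D i (w i - z i)) \<le> B * cvec_dist N w z"
proof -
  have "\<forall>i. \<exists>b. i \<le> N \<longrightarrow> b > 0 \<and> (\<forall>c. norm (D i c) \<le> cmod c * b)"
    using assms bounded_linear.pos_bounded by metis
  then obtain b where b: "\<And>i. i \<le> N \<Longrightarrow> b i > 0" "\<And>i c. i \<le> N \<Longrightarrow> norm (D i c) \<le> cmod c * b i"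
    by metis
  define B where "B = (\<Sum>i\<le>N. b i)"
  have bB: "b i \<le> B" if "i \<le> N" for i
    unfolding B_def using that b(1) by (intro member_le_sum) (auto intro: less_imp_le)
  have "norm (\<Sum>i\<le>N. D i (w i - z i)) \<le> B * cvec_dist N w z" for w z
  proof -
    have "norm (\<Sum>i\<le>N. D i (w i - z i)) \<le> (\<Sum>i\<le>N. B * cmod (w i - z i))"
    proof (rule sum_norm_le)
      fix i assume "i \<in> {..N}"
      then have "norm (D i (w i - z i)) \<le> cmod (w i - z i) * b i" using b(2) by simp
      also have "\<dots> \<le> B * cmod (w i - z i)" using bB \<open>i \<in> {..N}\<close> by (simp add: mult.commute mult_right_mono)
      finally show "norm (D i (w i - z i)) \<le> B * cmod (w i - z i)" .
    qed
    then show ?thesis by (simp add: sum_distrib_left)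
  qed
  moreover have "B > 0" unfolding B_def using b(1) by (intro sum_pos) auto
  ultimately show thesis using that by blast
qed

lemma has_cvec_derivative_linear:
  assumes "\<And>i. i \<le> N \<Longrightarrow> bounded_linear (D i)"
  shows "has_cvec_derivative N (\<lambda>w. \<Sum>i\<le>N. D i (w i)) D z"
proof -
  have "(\<Sum>i\<le>N. D i (w i)) - (\<Sum>i\<le>N. D i (z i)) - (\<Sum>i\<le>N. D i (w i - z i)) = 0" for w
    using assms by (simp add: sum_subtractf[symmetric] linear_diff bounded_linear.linear)
  then show ?thesis unfolding has_cvec_derivative_def
    using assms by (auto intro!: exI[of _ 1] mult_nonneg_nonneg cvec_dist_nonneg)
qed

lemma has_cvec_derivative_compose:
  assumes f: "has_cvec_derivative N f D z" and u: "(u has_derivative u') (at (f z))"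
  shows "has_cvec_derivative N (\<lambda>w. u (f w)) (\<lambda>i c. u' (D i c)) z"
  unfolding has_cvec_derivative_def
proof (intro conjI allI impI)
  have bu: "bounded_linear u'" using u by (rule has_derivative_bounded_linear)
  have bD: "\<forall>i\<le>N. bounded_linear (D i)" using f by (simp add: has_cvec_derivative_def)
  then show "\<And>i. i \<le> N \<Longrightarrow> bounded_linear (\<lambda>c. u' (D i c))"
    by (auto intro: bounded_linear_compose[OF bu])
  fix \<epsilon> :: real assume "\<epsilon> > 0"
  obtain B where B: "B > 0" "\<And>w z. norm (\<Sum>i\<le>N. D i (w i - z i)) \<le> B * cvec_dist N w z"
    by (rule cvec_linear_bound[OF bD]) (rule that)
  obtain K where K: "K > 0" "\<And>v. norm (u' v) \<le> norm v * K"
    using bounded_linear.pos_bounded[OF bu] by metis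
  define e where "e = \<epsilon> / (2 * (B + 1))"
  have e: "e > 0" "e * (B + 1) = \<epsilon> / 2" using \<open>\<epsilon> > 0\<close> B by (auto simp: e_def field_simps)
  obtain d where d: "d > 0"
    "\<And>y. norm (y - f z) < d \<Longrightarrow> norm (u y - u (f z) - u' (y - f z)) \<le> e * norm (y - f z)"
    using u e(1) unfolding has_derivative_at_alt by metis
  \<comment> \<open>The bound 1 on m gives norm (f w - f z) at most B + 1 times the distance; the
    bounds on m K and e (B + 1) limit the two error terms to \<epsilon> / 2 each.\<close>
  define m where "m = min 1 (\<epsilon> / (2 * K))"
  have m: "m > 0" "m \<le> 1" "m * K \<le> \<epsilon> / 2" using \<open>\<epsilon> > 0\<close> K by (auto simp: m_def min_def field_simps)
  obtain d' where d': "d' > 0"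
    "\<And>w. w \<in> cvecs N \<Longrightarrow> cvec_dist N w z < d' \<Longrightarrow>
        norm (f w - f z - (\<Sum>i\<le>N. D i (w i - z i))) \<le> m * cvec_dist N w z"
    by (rule has_cvec_derivativeE[OF f m(1)]) (rule that)
  show "\<exists>\<delta>>0. \<forall>w\<in>cvecs N. cvec_dist N w z < \<delta> \<longrightarrow>
      norm (u (f w) - u (f z) - (\<Sum>i\<le>N. u' (D i (w i - z i)))) \<le> \<epsilon> * cvec_dist N w z"
  proof (intro exI[of _ "min d' (d / (B + 1))"] conjI ballI impI)
    show "min d' (d / (B + 1)) > 0" using d d' B by simp
    fix w assume w: "w \<in> cvecs N" "cvec_dist N w z < min d' (d / (B + 1))"
    let ?c = "cvec_dist N w z" and ?L = "\<Sum>i\<le>N. D i (w i - z i)"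
    have c0: "?c \<ge> 0" by (rule cvec_dist_nonneg)
    have 1: "norm (f w - f z - ?L) \<le> m * ?c" using d'(2)[OF w(1)] w(2) by simp
    have "norm (f w - f z) \<le> norm (f w - f z - ?L) + norm ?L"
      using norm_triangle_ineq[of "f w - f z - ?L" ?L] by simp
    also have "\<dots> \<le> m * ?c + B * ?c" by (intro add_mono 1 B(2))
    also have "\<dots> \<le> (B + 1) * ?c" using mult_right_mono[OF m(2) c0] by (simp add: algebra_simps)
    finally have 2: "norm (f w - f z) \<le> (B + 1) * ?c" .
    also have "\<dots> < d" using w(2) B(1) by (simp add: less_divide_eq mult.commute)
    finally have "norm (u (f w) - u (f z) - u' (f w - f z)) \<le> e * norm (f w - f z)" by (rule d(2))
    also have "\<dots> \<le> e * ((B + 1) * ?c)" using 2 e(1) by (intro mult_left_mono) auto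
    also have "\<dots> = \<epsilon> / 2 * ?c" unfolding mult.assoc[symmetric] e(2) ..
    finally have 3: "norm (u (f w) - u (f z) - u' (f w - f z)) \<le> \<epsilon> / 2 * ?c" .
    have "norm (u' (f w - f z - ?L)) \<le> norm (f w - f z - ?L) * K" by (rule K(2))
    also have "\<dots> \<le> (m * ?c) * K" using 1 K(1) by (intro mult_right_mono) auto
    also have "\<dots> = (m * K) * ?c" by simp
    also have "\<dots> \<le> \<epsilon> / 2 * ?c" using m(3) c0 by (intro mult_right_mono) auto
    finally have 4: "norm (u' (f w - f z - ?L)) \<le> \<epsilon> / 2 * ?c" .
    have "(\<Sum>i\<le>N. u' (D i (w i - z i))) = u' ?L"
      by (simp add: linear_sum[OF bounded_linear.linear[OF bu]])
    then have eq: "u (f w) - u (f z) - (\<Sum>i\<le>N. u' (D i (w i - z i)))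
        = (u (f w) - u (f z) - u' (f w - f z)) + u' (f w - f z - ?L)"
      by (simp add: linear_diff[OF bounded_linear.linear[OF bu]])
    have "norm (u (f w) - u (f z) - (\<Sum>i\<le>N. u' (D i (w i - z i))))
        \<le> norm (u (f w) - u (f z) - u' (f w - f z)) + norm (u' (f w - f z - ?L))"
      unfolding eq by (rule norm_triangle_ineq)
    then show "norm (u (f w) - u (f z) - (\<Sum>i\<le>N. u' (D i (w i - z i)))) \<le> \<epsilon> * ?c"
      using 3 4 by (simp add: field_simps)
  qed
qed

lemma has_cvec_derivative_add:
  assumes f: "has_cvec_derivative N f D z" and g: "has_cvec_derivative N g E z"
  shows "has_cvec_derivative N (\<lambda>w. f w + g w) (\<lambda>i c. D i c + E i c) z"
  unfolding has_cvec_derivative_def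
proof (intro conjI allI impI)
  show "\<And>i. i \<le> N \<Longrightarrow> bounded_linear (\<lambda>c. D i c + E i c)"
    using f g by (auto simp: has_cvec_derivative_def intro: bounded_linear_add)
  fix \<epsilon> :: real assume "\<epsilon> > 0"
  then have "\<epsilon> / 2 > 0" by simp
  obtain d where d: "d > 0"
    "\<And>w. w \<in> cvecs N \<Longrightarrow> cvec_dist N w z < d \<Longrightarrow>
        norm (f w - f z - (\<Sum>i\<le>N. D i (w i - z i))) \<le> \<epsilon> / 2 * cvec_dist N w z"
    by (rule has_cvec_derivativeE[OF f \<open>\<epsilon> / 2 > 0\<close>]) (rule that)
  obtain d' where d': "d' > 0"
    "\<And>w. w \<in> cvecs N \<Longrightarrow> cvec_dist N w z < d' \<Longrightarrow>
        norm (g w - g z - (\<Sum>i\<le>N. E i (w i - z i))) \<le> \<epsilon> / 2 * cvec_dist N w z"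
    by (rule has_cvec_derivativeE[OF g \<open>\<epsilon> / 2 > 0\<close>]) (rule that)
  show "\<exists>\<delta>>0. \<forall>w\<in>cvecs N. cvec_dist N w z < \<delta> \<longrightarrow>
      norm (f w + g w - (f z + g z) - (\<Sum>i\<le>N. D i (w i - z i) + E i (w i - z i))) \<le> \<epsilon> * cvec_dist N w z"
  proof (intro exI[of _ "min d d'"] conjI ballI impI)
    fix w assume w: "w \<in> cvecs N" "cvec_dist N w z < min d d'"
    have eq: "f w + g w - (f z + g z) - (\<Sum>i\<le>N. D i (w i - z i) + E i (w i - z i)) =
      (f w - f z - (\<Sum>i\<le>N. D i (w i - z i))) + (g w - g z - (\<Sum>i\<le>N. E i (w i - z i)))"
      by (simp add: sum.distrib)
    have "norm (f w + g w - (f z + g z) - (\<Sum>i\<le>N. D i (w i - z i) + E i (w i - z i)))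
      \<le> norm (f w - f z - (\<Sum>i\<le>N. D i (w i - z i))) + norm (g w - g z - (\<Sum>i\<le>N. E i (w i - z i)))"
      unfolding eq by (rule norm_triangle_ineq)
    then show "norm (f w + g w - (f z + g z) - (\<Sum>i\<le>N. D i (w i - z i) + E i (w i - z i))) \<le> \<epsilon> * cvec_dist N w z"
      using d(2)[OF w(1)] d'(2)[OF w(1)] w(2) by (simp add: field_simps)
  qed (use d d' in auto)
qed

lemma has_cvec_derivative_sum:
  assumes "\<And>k. k \<in> I \<Longrightarrow> has_cvec_derivative N (f k) (D k) z"
  shows "has_cvec_derivative N (\<lambda>w. \<Sum>k\<in>I. f k w) (\<lambda>i c. \<Sum>k\<in>I. D k i c) z"
  using assms
proof (induction I rule: infinite_finite_induct)
  case (insert x F)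
  then show ?case using has_cvec_derivative_add[of N "f x" "D x" z] by simp
qed (auto simp: has_cvec_derivative_def intro!: exI[of _ "1::real"] mult_nonneg_nonneg cvec_dist_nonneg)

lemma has_cvec_derivative_quotient:
  assumes "i \<le> N" "j \<le> N" "z j \<noteq> 0"
  obtains D where "has_cvec_derivative N (\<lambda>w. w i / w j) D z" "\<And>k c. D k (\<i> * c) = \<i> * D k c"
proof -
  define L :: "nat \<Rightarrow> complex \<Rightarrow> complex \<times> complex" where
    "L k c = (if k = i then c else 0, if k = j then c else 0)" for k c
  have "bounded_linear (L k)" for k
    unfolding L_def by (intro bounded_linear_Pair) (cases "k = i"; cases "k = j"; simp add: bounded_linear_ident bounded_linear_zero)+
  then have "has_cvec_derivative N (\<lambda>w. \<Sum>k\<le>N. L k (w k)) L z" by (intro has_cvec_derivative_linear)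
  also have "(\<lambda>w. \<Sum>k\<le>N. L k (w k)) = (\<lambda>w. (w i, w j))"
  proof
    fix w :: "nat \<Rightarrow> complex"
    have "(\<Sum>k\<le>N. L k (w k)) = (\<Sum>k\<le>N. if k = i then w k else 0, \<Sum>k\<le>N. if k = j then w k else 0)"
      unfolding L_def by (simp add: sum_prod)
    then show "(\<Sum>k\<le>N. L k (w k)) = (w i, w j)" using assms by (simp add: sum.delta)
  qed
  finally have 1: "has_cvec_derivative N (\<lambda>w. (w i, w j)) L z" .
  have 2: "((\<lambda>p. fst p / snd p) has_derivative
      (\<lambda>h. (fst h * z j - z i * snd h) / (z j * z j))) (at (z i, z j))"
    using assms by (auto intro!: derivative_eq_intros simp: field_simps)
  show thesis
  proof (rule that)
    show "has_cvec_derivative N (\<lambda>w. w i / w j)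
        (\<lambda>k c. (fst (L k c) * z j - z i * snd (L k c)) / (z j * z j)) z"
      using has_cvec_derivative_compose[OF 1 2] by simp
  qed (simp add: L_def algebra_simps diff_divide_distrib)
qed

text \<open>A real linear map of the complex line commuting with multiplication by \<i> is
  multiplication by its value at 1; these values are the coefficients.\<close>

lemma has_cvec_derivative_imp_cvec_differentiable:
  assumes f: "has_cvec_derivative N f D z" and D: "\<And>i c. i \<le> N \<Longrightarrow> D i (\<i> * c) = \<i> * D i c"
  shows "cvec_differentiable N f z"
proof -
  have lin: "D i c = D i 1 * c" if "i \<le> N" for i c
  proof -
    interpret bounded_linear "D i" using f that by (simp add: has_cvec_derivative_def)
    have "D i c = D i (Re c *\<^sub>R 1 + Im c *\<^sub>R (\<i> * 1))"
      by (rule arg_cong[of _ _ "D i"]) (simp add: complex_eq_iff)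
    also have "\<dots> = Re c *\<^sub>R D i 1 + Im c *\<^sub>R (\<i> * D i 1)" unfolding add scaleR D[OF that] ..
    also have "\<dots> = D i 1 * c" by (simp add: complex_eq_iff algebra_simps)
    finally show ?thesis .
  qed
  have "(\<Sum>i\<le>N. D i (w i - z i)) = (\<Sum>i\<le>N. D i 1 * (w i - z i))" for w
    by (intro sum.cong refl lin) simp
  then show ?thesis using f unfolding cvec_differentiable_def has_cvec_derivative_def
    by (intro exI[of _ "\<lambda>i. D i 1"]) simp
qed

text \<open>The composite is split into a linear form in the coordinates of F, differentiated
  termwise, and a remainder with derivative 0. A Lipschitz estimate for F at x turns an error
  measured by \<open>cvec_dist\<close> into one measured in the domain.\<close>

lemma cvec_differentiable_compose:
  fixes F :: "'a::real_normed_vector \<Rightarrow> nat \<Rightarrow> complex"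
  assumes h: "cvec_differentiable N h (F x)"
    and F: "\<And>i. i \<le> N \<Longrightarrow> ((\<lambda>y. F y i) has_derivative F' i) (at x)" and cv: "\<And>y. F y \<in> cvecs N"
  shows "\<exists>a. ((\<lambda>y. h (F y)) has_derivative (\<lambda>v. \<Sum>i\<le>N. a i * F' i v)) (at x)"
proof -
  obtain a where a: "\<forall>\<epsilon>>0. \<exists>\<delta>>0. \<forall>w \<in> cvecs N. cvec_dist N w (F x) < \<delta> \<longrightarrow>
        cmod (h w - h (F x) - (\<Sum>i\<le>N. a i * (w i - F x i))) \<le> \<epsilon> * cvec_dist N w (F x)"
    using h unfolding cvec_differentiable_def by (elim exE) (rule that)
  have bF: "bounded_linear (F' i)" if "i \<le> N" for i using F[OF that] by (rule has_derivative_bounded_linear)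
  have bl: "bounded_linear (\<lambda>v. \<Sum>i\<le>N. a i * F' i v)"
    using bF by (auto intro!: bounded_linear_sum bounded_linear_const_mult)
  have 1: "((\<lambda>y. \<Sum>i\<le>N. a i * F y i) has_derivative (\<lambda>v. \<Sum>i\<le>N. a i * F' i v)) (at x)"
    using F by (intro has_derivative_sum has_derivative_mult_right) auto
  have "\<forall>i. \<exists>k. i \<le> N \<longrightarrow> k > 0 \<and> (\<forall>v. norm (F' i v) \<le> norm v * k)"
    using bF bounded_linear.pos_bounded by metis
  then obtain k where k: "\<And>i. i \<le> N \<Longrightarrow> k i > 0" "\<And>i v. i \<le> N \<Longrightarrow> norm (F' i v) \<le> norm v * k i"
    by metis
  define C where "C = (\<Sum>i\<le>N. k i + 1)"
  have C: "C > 0" unfolding C_def using k(1) by (intro sum_pos) (auto intro: add_pos_pos)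
  have "\<forall>\<^sub>F y in at x. cvec_dist N (F y) (F x) \<le> C * norm (y - x)"
  proof -
    have "\<forall>\<^sub>F y in at x. \<forall>i\<in>{..N}. cmod (F y i - F x i) \<le> (k i + 1) * norm (y - x)"
    proof (rule eventually_ball_finite)
      show "\<forall>i\<in>{..N}. \<forall>\<^sub>F y in at x. cmod (F y i - F x i) \<le> (k i + 1) * norm (y - x)"
      proof
        fix i assume i: "i \<in> {..N}"
        then obtain d where d: "d > 0" "\<And>y. norm (y - x) < d \<Longrightarrow>
            norm (F y i - F x i - F' i (y - x)) \<le> 1 * norm (y - x)"
          using F[of i] unfolding has_derivative_at_alt by (metis atMost_iff zero_less_one)
        have "cmod (F y i - F x i) \<le> (k i + 1) * norm (y - x)" if "norm (y - x) < d" for y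
        proof -
          have "cmod (F y i - F x i) \<le> norm (F y i - F x i - F' i (y - x)) + norm (F' i (y - x))"
            using norm_triangle_ineq[of "F y i - F x i - F' i (y - x)" "F' i (y - x)"] by simp
          then show ?thesis using d(2)[OF that] k(2)[of i "y - x"] i by (simp add: algebra_simps)
        qed
        then show "\<forall>\<^sub>F y in at x. cmod (F y i - F x i) \<le> (k i + 1) * norm (y - x)"
          using d(1) unfolding eventually_at dist_norm by blast
      qed
    qed simp
    then show ?thesis
    proof eventually_elim
      case (elim y)
      then show ?case unfolding C_def sum_distrib_right by (intro sum_mono) auto
    qed
  qed
  then obtain d0 where d0: "d0 > 0"
    and d0': "\<forall>y\<in>UNIV. y \<noteq> x \<and> dist y x < d0 \<longrightarrow> cvec_dist N (F y) (F x) \<le> C * norm (y - x)"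
    unfolding eventually_at by (elim exE conjE) (rule that)
  have d0'': "cvec_dist N (F y) (F x) \<le> C * norm (y - x)" if "norm (y - x) < d0" for y
    using d0' that by (cases "y = x") (simp_all add: dist_norm)
  have 2: "((\<lambda>y. h (F y) - (\<Sum>i\<le>N. a i * F y i)) has_derivative (\<lambda>v. 0)) (at x)"
    unfolding has_derivative_at_alt
  proof (intro conjI allI impI bounded_linear_zero)
    fix e :: real assume "e > 0"
    then have "e / C > 0" using C by simp
    from a[rule_format, OF this] obtain \<delta> where \<delta>: "\<delta> > 0" "\<forall>w\<in>cvecs N. cvec_dist N w (F x) < \<delta> \<longrightarrow>
        cmod (h w - h (F x) - (\<Sum>i\<le>N. a i * (w i - F x i))) \<le> e / C * cvec_dist N w (F x)"
      by (elim exE conjE) (rule that)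
    show "\<exists>d>0. \<forall>y. norm (y - x) < d \<longrightarrow> norm (h (F y) - (\<Sum>i\<le>N. a i * F y i) -
        (h (F x) - (\<Sum>i\<le>N. a i * F x i)) - 0) \<le> e * norm (y - x)"
    proof (intro exI[of _ "min d0 (\<delta> / C)"] conjI allI impI)
      show "min d0 (\<delta> / C) > 0" using d0 \<delta> C by simp
      fix y assume y: "norm (y - x) < min d0 (\<delta> / C)"
      have "cvec_dist N (F y) (F x) \<le> C * norm (y - x)" using d0'' y by simp
      moreover have "\<dots> < \<delta>" using y C by (simp add: less_divide_eq mult.commute)
      ultimately have "cmod (h (F y) - h (F x) - (\<Sum>i\<le>N. a i * (F y i - F x i))) \<le> e / C * cvec_dist N (F y) (F x)"
        using \<delta>(2) cv by simp
      also have "\<dots> \<le> e / C * (C * norm (y - x))" using d0'' y \<open>e / C > 0\<close> by (intro mult_left_mono) auto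
      finally show "norm (h (F y) - (\<Sum>i\<le>N. a i * F y i) - (h (F x) - (\<Sum>i\<le>N. a i * F x i)) - 0) \<le> e * norm (y - x)"
        using C by (simp add: right_diff_distrib sum_subtractf algebra_simps)
    qed
  qed
  show ?thesis using has_derivative_add[OF 2 1] by auto
qed

text \<open>Continuity of the derivative is included for the inverse function theorem and for the
  openness of non-criticality.\<close>

definition c1_holomorphic :: "real^'n^'n \<Rightarrow> (real^'n \<Rightarrow> complex) \<Rightarrow> bool" where
  "c1_holomorphic J f \<longleftrightarrow> (\<forall>x. f differentiable at x) \<and>
     (\<forall>x v. frechet_derivative f (at x) (J *v v) = \<i> * frechet_derivative f (at x) v) \<and>
     (\<forall>v. continuous_on UNIV (\<lambda>x. frechet_derivative f (at x) v))"

lemma c1_holomorphicI: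
  assumes "\<And>x. (f has_derivative f' x) (at x)" "\<And>x v. f' x (J *v v) = \<i> * f' x v"
    "\<And>v. continuous_on UNIV (\<lambda>x. f' x v)"
  shows "c1_holomorphic J f"
proof -
  have "frechet_derivative f (at x) = f' x" for x
    using frechet_derivative_at[OF assms(1)] by simp
  then show ?thesis using assms unfolding c1_holomorphic_def differentiable_def by auto
qed

lemma c1_holomorphicD:
  assumes "c1_holomorphic J f"
  shows "(f has_derivative frechet_derivative f (at x)) (at x)"
    "frechet_derivative f (at x) (J *v v) = \<i> * frechet_derivative f (at x) v"
    "continuous_on UNIV (\<lambda>x. frechet_derivative f (at x) v)"
  using assms unfolding c1_holomorphic_def by (auto simp: frechet_derivative_works[symmetric])

lemma c1_holomorphic_continuous: "c1_holomorphic J f \<Longrightarrow> continuous_on S f"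
  unfolding c1_holomorphic_def
  by (intro continuous_at_imp_continuous_on) (auto intro: differentiable_imp_continuous_within)

text \<open>Least squares: the operator M, the sum of adjoint (d i) after d i, is injective because
  v \<bullet> M v is the sum of the squared norms of the d i v.\<close>

lemma linear_family_left_inverse:
  fixes d :: "'i \<Rightarrow> 'a::euclidean_space \<Rightarrow> 'b::euclidean_space"
  assumes fin: "finite I" and lin: "\<And>i. i \<in> I \<Longrightarrow> linear (d i)"
    and inj: "\<And>v. (\<And>i. i \<in> I \<Longrightarrow> d i v = 0) \<Longrightarrow> v = 0"
  obtains L where "\<And>i. linear (L i)" "\<And>v. (\<Sum>i\<in>I. L i (d i v)) = v"
proof -
  define M where "M v = (\<Sum>i\<in>I. adjoint (d i) (d i v))" for v
  have adj: "linear (adjoint (d i))" if "i \<in> I" for i using lin[OF that] by (rule adjoint_linear)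
  have "linear M" unfolding M_def
    using linear_compose_sum[of I "\<lambda>i v. adjoint (d i) (d i v)"] linear_compose[OF lin adj]
    by (auto simp: o_def)
  moreover have "v = 0" if "M v = 0" for v
  proof -
    have "0 = v \<bullet> M v" using that by simp
    also have "\<dots> = (\<Sum>i\<in>I. d i v \<bullet> d i v)"
      unfolding M_def inner_sum_right using lin by (intro sum.cong) (auto simp: adjoint_works)
    finally have "\<forall>i\<in>I. d i v \<bullet> d i v = 0"
      by (subst (asm) eq_commute) (simp add: sum_nonneg_eq_0_iff[OF fin])
    then show ?thesis by (intro inj) auto
  qed
  ultimately have "inj M" by (simp add: linear_injective_0)
  then obtain M' where M': "linear M'" "M' \<circ> M = id"
    using linear_injective_left_inverse[OF \<open>linear M\<close>] by blast
  define L where "L i = (if i \<in> I then M' \<circ> adjoint (d i) else (\<lambda>_. 0))" for i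
  have "linear (L i)" for i unfolding L_def using linear_compose[OF adj M'(1)] by (auto simp: linear_zero)
  moreover have "(\<Sum>i\<in>I. L i (d i v)) = v" for v
  proof -
    have "(\<Sum>i\<in>I. L i (d i v)) = (\<Sum>i\<in>I. M' (adjoint (d i) (d i v)))"
      unfolding L_def by (intro sum.cong) auto
    also have "\<dots> = M' (M v)" by (simp add: M_def linear_sum[OF M'(1)])
    finally show ?thesis using M'(2) by (simp add: fun_eq_iff)
  qed
  ultimately show thesis using that by blast
qed

text \<open>The real left inverse is made complex linear by averaging over the complex structure.\<close>

lemma complex_linear_family_left_inverse:
  fixes d :: "'i \<Rightarrow> real^'n \<Rightarrow> complex" and J :: "real^'n^'n"
  assumes J: "J ** J = - mat 1" and fin: "finite I" and lin: "\<And>i. i \<in> I \<Longrightarrow> linear (d i)"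
    and dJ: "\<And>i v. i \<in> I \<Longrightarrow> d i (J *v v) = \<i> * d i v"
    and inj: "\<And>v. (\<And>i. i \<in> I \<Longrightarrow> d i v = 0) \<Longrightarrow> v = 0"
  obtains L where "\<And>i. linear (L i)" "\<And>i c. L i (\<i> * c) = J *v L i c" "\<And>v. (\<Sum>i\<in>I. L i (d i v)) = v"
proof -
  obtain R where R: "\<And>i. linear (R i)" "\<And>v. (\<Sum>i\<in>I. R i (d i v)) = v"
    by (rule linear_family_left_inverse[OF fin lin inj]) (assumption | rule that)+
  have JJ: "J *v (J *v x) = - x" for x
    by (simp add: matrix_vector_mul_assoc J bounded_bilinear.minus_left[OF bounded_bilinear_matrix_vector_mult])
  have linJ: "linear (\<lambda>x. J *v x)" by (rule matrix_vector_mul_linear)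
  have lini: "linear (\<lambda>c::complex. \<i> * c)" by (intro linearI) (auto simp: algebra_simps)
  define L where "L i c = (1/2) *\<^sub>R (R i c - J *v R i (\<i> * c))" for i c
  have "linear (L i)" for i
    unfolding L_def
    by (intro linear_compose_scale_right linear_compose_sub R linear_compose[OF linear_compose[OF lini R(1)] linJ, unfolded o_def])
  moreover have "L i (\<i> * c) = J *v L i c" for i c
    by (simp add: L_def linear_cmul[OF linJ] linear_diff[OF linJ] JJ linear_neg[OF R(1)] linear_neg[OF linJ] algebra_simps)
  moreover have "(\<Sum>i\<in>I. L i (d i v)) = v" for v
  proof -
    have "(\<Sum>i\<in>I. L i (d i v)) = (1/2) *\<^sub>R ((\<Sum>i\<in>I. R i (d i v)) - J *v (\<Sum>i\<in>I. R i (d i (J *v v))))"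
      unfolding L_def linear_sum[OF linJ] sum_subtractf[symmetric] scaleR_sum_right
      by (intro sum.cong) (auto simp: dJ)
    also have "\<dots> = (1/2) *\<^sub>R (v + v)" by (simp add: R(2) JJ)
    finally show ?thesis by (simp add: scaleR_2[symmetric])
  qed
  ultimately show thesis using that by blast
qed

text \<open>The affine coordinates \<open>f\<^sub>i / f\<^sub>j\<close> of the map into projective space, composed with a complex
  linear projection, have derivative the identity at the given point.\<close>

lemma immersion_local_inverse:
  fixes F :: "nat \<Rightarrow> real^'n \<Rightarrow> complex" and J :: "real^'n^'n"
  assumes J: "J ** J = - mat 1" and hol: "\<And>i. i \<le> N \<Longrightarrow> c1_holomorphic J (F i)"
    and j: "j \<le> N" "F j x0 \<noteq> 0"
    and imm: "\<And>v \<kappa>. (\<And>i. i \<le> N \<Longrightarrow> frechet_derivative (F i) (at x0) v = \<kappa> * F i x0) \<Longrightarrow> v = 0"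
  obtains L A B g where "\<And>i. linear (L i)" "\<And>i c. L i (\<i> * c) = J *v L i c"
    "open A" "x0 \<in> A" "\<And>x. x \<in> A \<Longrightarrow> F j x \<noteq> 0" "open B"
    "\<And>x. x \<in> A \<Longrightarrow> (\<Sum>i\<le>N. L i (F i x / F j x)) \<in> B"
    "\<And>x. x \<in> A \<Longrightarrow> g (\<Sum>i\<le>N. L i (F i x / F j x)) = x"
    "\<And>y. y \<in> B \<Longrightarrow> g y \<in> A"
    "\<And>y. y \<in> B \<Longrightarrow> \<exists>g'. (g has_derivative g') (at y) \<and> (\<forall>v. g' (J *v v) = J *v g' v)"
proof -
  let ?d = "\<lambda>i x. frechet_derivative (F i) (at x)"
  define U where "U = {x. F j x \<noteq> 0}"
  have cF: "continuous_on S (F i)" if "i \<le> N" for i S using c1_holomorphic_continuous[OF hol[OF that]] .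
  have cd: "continuous_on S (\<lambda>x. ?d i x v)" if "i \<le> N" for i v S
    using continuous_on_subset[OF c1_holomorphicD(3)[OF hol[OF that]]] by blast
  have "open U"
    unfolding U_def using open_Collect_neq[OF cF[OF j(1)] continuous_on_const] by simp
  define h' where "h' i x v = (?d i x v * F j x - F i x * ?d j x v) / (F j x * F j x)" for i x v
  have der: "((\<lambda>x. F i x / F j x) has_derivative h' i x) (at x)" if "i \<le> N" "x \<in> U" for i x
    using has_derivative_divide'[OF c1_holomorphicD(1)[OF hol[OF that(1)]] c1_holomorphicD(1)[OF hol[OF j(1)]], of x] that(2)
    by (simp add: h'_def[abs_def] U_def)
  have h'J: "h' i x (J *v v) = \<i> * h' i x v" if "i \<le> N" for i x v
    using c1_holomorphicD(2)[OF hol[OF that]] c1_holomorphicD(2)[OF hol[OF j(1)]]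
    by (simp add: h'_def algebra_simps diff_divide_distrib)
  have x0: "x0 \<in> U" using j by (simp add: U_def)
  obtain L where L: "\<And>i. linear (L i)" "\<And>i c. L i (\<i> * c) = J *v L i c"
    "\<And>v. (\<Sum>i\<in>{..N}. L i (h' i x0 v)) = v"
  proof (rule complex_linear_family_left_inverse[OF J, of "{..N}" "\<lambda>i. h' i x0"])
    show "linear (h' i x0)" if "i \<in> {..N}" for i
      using has_derivative_linear[OF der[of i x0]] that x0 by simp
    show "h' i x0 (J *v v) = \<i> * h' i x0 v" if "i \<in> {..N}" for i v using h'J that by simp
    fix v assume z: "\<And>i. i \<in> {..N} \<Longrightarrow> h' i x0 v = 0"
    \<comment> \<open>If all quotients F i / F j have derivative 0 along v, the derivatives of the F
      i are proportional to their values, which \<open>imm\<close> excludes unless v = 0.\<close>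
    have "?d i x0 v = (?d j x0 v / F j x0) * F i x0" if "i \<le> N" for i
      using z[of i] that j by (simp add: h'_def field_simps)
    then show "v = 0" by (rule imm)
  qed (use that in auto)
  define \<Psi> where "\<Psi> x = (\<Sum>i\<le>N. L i (F i x / F j x))" for x
  define \<Psi>' where "\<Psi>' x v = (\<Sum>i\<le>N. L i (h' i x v))" for x v
  have bL: "bounded_linear (L i)" for i using L(1) by (simp add: linear_conv_bounded_linear)
  have der\<Psi>: "(\<Psi> has_derivative \<Psi>' x) (at x)" if "x \<in> U" for x
    unfolding \<Psi>_def \<Psi>'_def[abs_def]
    by (intro has_derivative_sum bounded_linear.has_derivative[OF bL] der that) auto
  then have bl: "bounded_linear (\<Psi>' x)" if "x \<in> U" for x using that has_derivative_bounded_linear by blast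
  have c: "continuous_on U (\<lambda>x. \<Psi>' x v)" for v
    unfolding \<Psi>'_def h'_def
    by (intro continuous_on_sum bounded_linear.continuous_on[OF bL] continuous_intros cd j cF) (auto simp: U_def)
  have "continuous_on U (\<lambda>x. Blinfun (\<Psi>' x))"
    by (rule continuous_on_blinfun_componentwise)
      (use c in \<open>simp add: bounded_linear_Blinfun_apply bl cong: continuous_on_cong\<close>)
  moreover have "id_blinfun o\<^sub>L Blinfun (\<Psi>' x0) = id_blinfun"
    by (rule blinfun_eqI) (simp add: bounded_linear_Blinfun_apply bl x0 \<Psi>'_def L(3))
  ultimately obtain A B g g' where AB: "open A" "A \<subseteq> U" "x0 \<in> A" "open B" "\<Psi> x0 \<in> B" "homeomorphism A B \<Psi> g"
    and g': "\<And>y. y \<in> B \<Longrightarrow> (g has_derivative (g' y)) (at y)"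
      "\<And>y. y \<in> B \<Longrightarrow> g' y = inv_into UNIV (blinfun_apply (Blinfun (\<Psi>' (g y))))"
      "\<And>y. y \<in> B \<Longrightarrow> bij (blinfun_apply (Blinfun (\<Psi>' (g y))))"
    using inverse_function_theorem[OF \<open>open U\<close>, of \<Psi> "\<lambda>x. Blinfun (\<Psi>' x)" x0 id_blinfun] der\<Psi> bl x0
    by (simp add: bounded_linear_Blinfun_apply) metis
  show thesis
  proof (rule that[OF L(1,2) AB(1,3) _ AB(4)])
    show "F j x \<noteq> 0" if "x \<in> A" for x using AB(2) that by (auto simp: U_def)
    show "(\<Sum>i\<le>N. L i (F i x / F j x)) \<in> B" "g (\<Sum>i\<le>N. L i (F i x / F j x)) = x" if "x \<in> A" for x
      using AB(6) that unfolding \<Psi>_def[symmetric] homeomorphism_def by auto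
    show gA: "g y \<in> A" if "y \<in> B" for y using AB(6) that unfolding homeomorphism_def by auto
    show "\<exists>g'. (g has_derivative g') (at y) \<and> (\<forall>v. g' (J *v v) = J *v g' v)" if y: "y \<in> B" for y
    proof (intro exI[of _ "g' y"] conjI allI g' y)
      fix v
      have gU: "g y \<in> U" using gA[OF y] AB(2) by blast
      have bij: "bij (\<Psi>' (g y))" and g'y: "g' y = inv_into UNIV (\<Psi>' (g y))"
        using g'(2,3)[OF y] by (simp_all add: bounded_linear_Blinfun_apply bl gU)
      have linJ: "linear (\<lambda>x. J *v x)" by (rule matrix_vector_mul_linear)
      \<comment> \<open>The derivative of \<Psi> commutes with J, hence so does its inverse.\<close>
      have "\<Psi>' (g y) (J *v g' y v) = J *v \<Psi>' (g y) (g' y v)"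
        unfolding \<Psi>'_def linear_sum[OF linJ] by (intro sum.cong) (auto simp: h'J L(2))
      also have "\<Psi>' (g y) (g' y v) = v" using bij g'y by (simp add: bij_is_surj surj_f_inv_f)
      also have "J *v v = \<Psi>' (g y) (g' y (J *v v))" using bij g'y by (simp add: bij_is_surj surj_f_inv_f)
      finally show "g' y (J *v v) = J *v g' y v" using bij by (metis bij_is_inj injD)
    qed
  qed
qed

section \<open>Lines, and the topology of projective space\<close>

abbreviation punctured :: "nat \<Rightarrow> (nat \<Rightarrow> complex) set" where
  "punctured N \<equiv> cvecs N - {\<lambda>_. 0}"

lemma cline_self: "z \<in> cline z"
  unfolding cline_def by (auto intro!: exI[of _ 1])

lemma cline_scale: "c \<noteq> 0 \<Longrightarrow> cline (\<lambda>i. c * z i) = cline z"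
  unfolding cline_def
proof (intro equalityI subsetI)
  fix w assume "c \<noteq> 0" "w \<in> {\<lambda>i. d * z i |d. d \<noteq> 0}"
  then obtain d where "d \<noteq> 0" "w = (\<lambda>i. d * z i)" by auto
  with \<open>c \<noteq> 0\<close> show "w \<in> {\<lambda>i. d * (c * z i) |d. d \<noteq> 0}"
    by (auto intro!: exI[of _ "d / c"])
qed (auto simp: mult.assoc[symmetric])

lemma cline_eq_iff: "cline z = cline w \<longleftrightarrow> (\<exists>c. c \<noteq> 0 \<and> w = (\<lambda>i. c * z i))"
proof
  assume "cline z = cline w"
  then have "w \<in> cline z" using cline_self by simp
  then show "\<exists>c. c \<noteq> 0 \<and> w = (\<lambda>i. c * z i)" by (auto simp: cline_def)
qed (auto simp: cline_scale)

text \<open>An arbitrary representative of the line; it enters only through expressions that are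
  invariant under scaling.\<close>

definition cline_rep :: "(nat \<Rightarrow> complex) set \<Rightarrow> nat \<Rightarrow> complex" where
  "cline_rep p = (SOME z. z \<in> p)"

lemma cline_rep_cline: obtains c where "c \<noteq> 0" "cline_rep (cline z) = (\<lambda>i. c * z i)"
proof -
  have "cline_rep (cline z) \<in> cline z" unfolding cline_rep_def by (rule someI[of _ z]) (rule cline_self)
  then show thesis using that by (auto simp: cline_def)
qed

lemma cline_rep_quotient: "cline_rep (cline z) i / cline_rep (cline z) j = z i / z j"
  by (rule cline_rep_cline[of z]) simp

lemma topspace_CP: "topspace (cs_top (CP N)) = cline ` punctured N"
  by (simp add: CP_def quotient_cspace_def punctured_cvecs_def)

lemma openin_CP: "openin (cs_top (CP N)) U \<longleftrightarrow>
    U \<subseteq> cline ` punctured N \<and> openin (top_of_set (punctured N)) {z \<in> punctured N. cline z \<in> U}"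
  by (simp add: CP_def quotient_cspace_def punctured_cvecs_def openin_quotient_topology)

lemma holfuns_CP: "h \<in> holfuns (CP N) U \<longleftrightarrow>
    (\<forall>z\<in>punctured N. cline z \<in> U \<longrightarrow> cvec_differentiable N (\<lambda>w. h (cline w)) z)"
  by (auto simp: CP_def quotient_cspace_def punctured_cvecs_def o_def)

lemma continuous_map_from_CP:
  fixes f :: "(nat \<Rightarrow> complex) \<Rightarrow> real"
  assumes "continuous_on (punctured N) f" "\<And>z c. c \<noteq> 0 \<Longrightarrow> f (\<lambda>i. c * z i) = f z"
  shows "continuous_map (cs_top (CP N)) euclideanreal (\<lambda>p. f (cline_rep p))"
proof -
  have f: "f (cline_rep (cline z)) = f z" for z
    by (rule cline_rep_cline[of z]) (simp add: assms(2))
  show ?thesis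
    unfolding continuous_map_def
  proof (intro conjI allI impI)
    fix S :: "real set" assume "openin euclideanreal S"
    then have "open S" by simp
    then have "openin (top_of_set (punctured N)) (punctured N \<inter> f -` S)"
      using assms(1) continuous_openin_preimage_gen by blast
    moreover have "{z \<in> punctured N. cline z \<in> {p \<in> topspace (cs_top (CP N)). f (cline_rep p) \<in> S}} = punctured N \<inter> f -` S"
      by (auto simp: topspace_CP f)
    ultimately show "openin (cs_top (CP N)) {p \<in> topspace (cs_top (CP N)). f (cline_rep p) \<in> S}"
      unfolding openin_CP by (auto simp: topspace_CP)
  qed auto
qed

text \<open>For a fixed w, the function D is, up to a factor, the squared length of the exterior
  product of z and w divided by that of z. It is invariant under scaling and vanishes exactly on the
  line of w, so its sublevel and superlevel sets separate the two points.\<close>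

lemma Hausdorff_space_CP: "Hausdorff_space (cs_top (CP N))"
  unfolding Hausdorff_space_def
proof (intro allI impI)
  fix p q assume pq: "p \<in> topspace (cs_top (CP N)) \<and> q \<in> topspace (cs_top (CP N)) \<and> p \<noteq> q"
  then obtain w z where w: "p = cline w" "w \<in> punctured N" and z: "q = cline z" "z \<in> punctured N"
    by (auto simp: topspace_CP)
  define D where "D z = (\<Sum>i\<le>N. \<Sum>j\<le>N. (cmod (z i * w j - z j * w i))\<^sup>2) / (\<Sum>i\<le>N. (cmod (z i))\<^sup>2)"
    for z :: "nat \<Rightarrow> complex"
  have pos: "(\<Sum>i\<le>N. (cmod (z i))\<^sup>2) > 0" if "z \<in> punctured N" for z
  proof -
    obtain i where i: "z i \<noteq> 0" using \<open>z \<in> punctured N\<close> by auto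
    then have "i \<le> N" using \<open>z \<in> punctured N\<close> by (auto simp: cvecs_def)
    then have "(cmod (z i))\<^sup>2 \<le> (\<Sum>i\<le>N. (cmod (z i))\<^sup>2)" by (intro member_le_sum) auto
    then show ?thesis using i by (smt (verit) zero_less_norm_iff zero_less_power)
  qed
  have co: "continuous_on S (\<lambda>z. z i)" for S :: "(nat \<Rightarrow> complex) set" and i
    by (rule continuous_on_subset[OF continuous_on_product_coordinates subset_UNIV])
  have "continuous_on (punctured N) D"
    unfolding D_def by (intro continuous_intros co) (use pos in force)
  moreover have inv: "D (\<lambda>i. c * z i) = D z" if "c \<noteq> 0" for z c
  proof -
    have "c * a * b - c * a' * b' = c * (a * b - a' * b')" for a b a' b' :: complex by (simp add: algebra_simps)
    then show ?thesis using that
      by (simp add: D_def norm_mult power_mult_distrib sum_distrib_left[symmetric])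
  qed
  ultimately have cm: "continuous_map (cs_top (CP N)) euclideanreal (\<lambda>p. D (cline_rep p))"
    by (rule continuous_map_from_CP)
  have Dq: "D (cline_rep (cline z)) = D z" for z
    by (rule cline_rep_cline[of z]) (simp add: inv)
  have "D w = 0" by (simp add: D_def mult.commute)
  have "D z > 0"
  proof (rule ccontr)
    assume "\<not> D z > 0"
    moreover have "(\<Sum>i\<le>N. \<Sum>j\<le>N. (cmod (z i * w j - z j * w i))\<^sup>2) \<ge> 0" by (intro sum_nonneg) auto
    ultimately have "(\<Sum>i\<le>N. \<Sum>j\<le>N. (cmod (z i * w j - z j * w i))\<^sup>2) = 0"
      using pos[OF z(2)] by (simp add: D_def not_less divide_le_0_iff)
    then have "\<forall>i\<in>{..N}. (\<Sum>j\<le>N. (cmod (z i * w j - z j * w i))\<^sup>2) = 0"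
      by (subst (asm) sum_nonneg_eq_0_iff) (auto intro: sum_nonneg)
    then have e: "z i * w j = z j * w i" if "i \<le> N" "j \<le> N" for i j
      using that by (auto simp: sum_nonneg_eq_0_iff)
    obtain j where j: "w j \<noteq> 0" using w by auto
    then have jN: "j \<le> N" using w by (auto simp: cvecs_def)
    have zz: "z i = (z j / w j) * w i" for i
    proof (cases "i \<le> N")
      case True
      then show ?thesis using e[OF True jN] j by (simp add: field_simps)
    next
      case False
      then show ?thesis using w z by (auto simp: cvecs_def)
    qed
    moreover have "z j / w j \<noteq> 0"
    proof
      assume "z j / w j = 0"
      then have "z i = 0" for i using zz[of i] by (simp only: mult_zero_left)
      then have "z = (\<lambda>_. 0)" by (rule ext)
      then show False using z by auto
    qed
    moreover have "z = (\<lambda>i. (z j / w j) * w i)" by (rule ext) (rule zz)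
    ultimately have "cline w = cline z" unfolding cline_eq_iff by (intro exI conjI)
    then show False using pq w z by simp
  qed
  define e where "e = D z / 2"
  let ?U = "{p \<in> topspace (cs_top (CP N)). D (cline_rep p) \<in> {..<e}}"
  let ?V = "{p \<in> topspace (cs_top (CP N)). D (cline_rep p) \<in> {e<..}}"
  have "openin (cs_top (CP N)) ?U" "openin (cs_top (CP N)) ?V"
    by (rule openin_continuous_map_preimage[OF cm]; simp)+
  moreover have "p \<in> ?U" "q \<in> ?V"
    using pq \<open>D z > 0\<close> \<open>D w = 0\<close> w z by (auto simp: Dq e_def)
  moreover have "disjnt ?U ?V" by (auto simp: disjnt_def)
  ultimately show "\<exists>U V. openin (cs_top (CP N)) U \<and> openin (cs_top (CP N)) V \<and> p \<in> U \<and> q \<in> V \<and> disjnt U V"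
    by blast
qed

text \<open>Sections of a line bundle on a compact quotient, given as functions on the covering
  space. The bundle shows only in \<open>coherent\<close>, whose factor e is common to all of
  \<open>fs\<close>. The map is projective, hence the arbitrary factors in \<open>separating\<close>
  and \<open>immersive\<close>. The compact set K meets every fibre of Q.\<close>

locale projective_embedding =
  fixes Q :: "real^'n \<Rightarrow> 'b" and J :: "real^'n^'n" and K :: "(real^'n) set"
    and fs :: "(real^'n \<Rightarrow> complex) list"
  assumes J: "J ** J = - mat 1"
    and K: "compact K" "Q ` K = range Q"
    and Q_open: "open A \<Longrightarrow> open {x. Q x \<in> Q ` A}"
    and hol: "f \<in> set fs \<Longrightarrow> c1_holomorphic J f"
    and coherent: "Q x = Q y \<Longrightarrow> \<exists>e. e \<noteq> 0 \<and> (\<forall>f\<in>set fs. f y = e * f x)"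
    and no_common_zero: "\<exists>f\<in>set fs. f x \<noteq> 0"
    and separating: "(\<forall>f\<in>set fs. f y = e * f x) \<Longrightarrow> Q x = Q y"
    and immersive: "x \<in> K \<Longrightarrow> (\<forall>f\<in>set fs. frechet_derivative f (at x) v = \<kappa> * f x) \<Longrightarrow> v = 0"
begin

definition "N = length fs - 1"

definition vec :: "real^'n \<Rightarrow> nat \<Rightarrow> complex" where
  "vec x i = (if i \<le> N then (fs ! i) x else 0)"

definition "\<Phi> x = cline (vec x)"
definition "\<phi> p = \<Phi> (SOME x. Q x = p)"
definition "Z = range \<Phi>"
definition "X = quotient_cspace Q (linear_cspace J)"

lemma le_N_iff: "i \<le> N \<longleftrightarrow> i < length fs"
proof -
  have "fs \<noteq> []" using no_common_zero by auto
  then show ?thesis unfolding N_def by (cases fs) auto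
qed

lemma set_fs: "set fs = (\<lambda>i. fs ! i) ` {..N}"
  by (auto simp: set_conv_nth le_N_iff)

lemma vec_in: "vec x \<in> punctured N"
proof -
  obtain i where "i \<le> N" "(fs ! i) x \<noteq> 0" using no_common_zero[of x] by (auto simp: set_fs)
  then have "vec x i \<noteq> 0" by (simp add: vec_def)
  then have "vec x \<noteq> (\<lambda>_. 0)" by auto
  then show ?thesis by (auto simp: cvecs_def vec_def)
qed

lemma \<Phi>_eq_iff: "\<Phi> x = \<Phi> y \<longleftrightarrow> Q x = Q y"
proof
  assume "\<Phi> x = \<Phi> y"
  then obtain c where c: "vec y = (\<lambda>i. c * vec x i)" unfolding \<Phi>_def cline_eq_iff by auto
  have "(fs ! i) y = c * (fs ! i) x" if "i \<le> N" for i
    using fun_cong[OF c, of i] that by (simp add: vec_def)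
  then show "Q x = Q y" by (intro separating[of y c x]) (auto simp: set_fs)
next
  assume "Q x = Q y"
  then obtain e where "e \<noteq> 0" "\<forall>f\<in>set fs. f y = e * f x" using coherent by blast
  then have "vec y = (\<lambda>i. e * vec x i)" by (auto simp: vec_def set_fs fun_eq_iff)
  then show "\<Phi> x = \<Phi> y" unfolding \<Phi>_def cline_eq_iff using \<open>e \<noteq> 0\<close> by blast
qed

lemma \<phi>_Q [simp]: "\<phi> (Q x) = \<Phi> x"
proof -
  have "Q (SOME y. Q y = Q x) = Q x" by (rule someI[of _ x]) simp
  then show ?thesis by (simp add: \<phi>_def \<Phi>_eq_iff)
qed

lemma openin_X: "openin (cs_top X) U \<longleftrightarrow> U \<subseteq> range Q \<and> open {x. Q x \<in> U}"
  by (simp add: X_def quotient_cspace_def linear_cspace_def openin_quotient_topology)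

lemma topspace_X: "topspace (cs_top X) = range Q"
  by (simp add: X_def quotient_cspace_def linear_cspace_def)

lemma holfuns_X: "f \<in> holfuns X U \<longleftrightarrow>
    (\<forall>x. Q x \<in> U \<longrightarrow> (\<exists>D. ((\<lambda>y. f (Q y)) has_derivative D) (at x) \<and> (\<forall>v. D (J *v v) = \<i> * D v)))"
  by (auto simp: X_def quotient_cspace_def linear_cspace_def o_def)

lemma vec_holomorphic: "c1_holomorphic J (\<lambda>x. vec x i)"
proof (cases "i \<le> N")
  case True
  then show ?thesis using hol[of "fs ! i"] by (auto simp: vec_def set_fs)
next
  case False
  then show ?thesis by (auto simp: vec_def intro!: c1_holomorphicI[of _ "\<lambda>x v. 0"])
qed

lemma continuous_vec: "continuous_on S vec"
  by (intro continuous_on_coordinatewise_then_product c1_holomorphic_continuous[OF vec_holomorphic])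

lemma \<Phi>_in: "\<Phi> x \<in> topspace (cs_top (CP N))"
  using vec_in by (auto simp: \<Phi>_def topspace_CP)

lemma open_\<Phi>_preimage:
  assumes "openin (cs_top (CP N)) W" shows "open {x. \<Phi> x \<in> W}"
proof -
  have "openin (top_of_set (punctured N)) {z \<in> punctured N. cline z \<in> W}"
    using assms by (simp add: openin_CP)
  moreover have "continuous_on UNIV vec" by (rule continuous_vec)
  ultimately have "openin (top_of_set UNIV) (UNIV \<inter> vec -` {z \<in> punctured N. cline z \<in> W})"
    using vec_in by (intro continuous_openin_preimage) auto
  moreover have "UNIV \<inter> vec -` {z \<in> punctured N. cline z \<in> W} = {x. \<Phi> x \<in> W}"
    using vec_in by (auto simp: \<Phi>_def)
  ultimately show ?thesis by simp
qed

lemma continuous_map_\<Phi>: "continuous_map euclidean (cs_top (CP N)) \<Phi>"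
  unfolding continuous_map_def using \<Phi>_in open_\<Phi>_preimage by auto

lemma closedin_\<Phi>_image:
  assumes "closed S" shows "closedin (cs_top (CP N)) (\<Phi> ` (S \<inter> K))"
proof -
  have "compact (S \<inter> K)" using assms K(1) by (simp add: closed_Int_compact)
  then have "compactin (cs_top (CP N)) (\<Phi> ` (S \<inter> K))"
    using image_compactin[OF _ continuous_map_\<Phi>] by (simp add: compactin_euclidean_iff)
  then show ?thesis using Hausdorff_space_CP compactin_imp_closedin by blast
qed

text \<open>K meets every fibre of Q, so a saturated set has the same image as its part in K. This
  makes images of closed saturated sets compact.\<close>

lemma \<Phi>_image_K: "\<Phi> ` ({x. P (Q x)} \<inter> K) = \<Phi> ` {x. P (Q x)}"
proof
  show "\<Phi> ` {x. P (Q x)} \<subseteq> \<Phi> ` ({x. P (Q x)} \<inter> K)"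
  proof
    fix q assume "q \<in> \<Phi> ` {x. P (Q x)}"
    then obtain x where x: "q = \<Phi> x" "P (Q x)" by auto
    obtain y where "y \<in> K" "Q y = Q x" using K(2) by (metis rangeI imageE)
    then show "q \<in> \<Phi> ` ({x. P (Q x)} \<inter> K)" using x \<Phi>_eq_iff[of x y] by auto
  qed
qed auto

lemma Z_eq: "Z = \<Phi> ` K"
  using \<Phi>_image_K[of "\<lambda>_. True"] by (simp add: Z_def)

lemma closedin_Z: "closedin (cs_top (CP N)) Z"
  using closedin_\<Phi>_image[of UNIV] \<Phi>_image_K[of "\<lambda>_. True"] by (simp add: Z_def)

lemma homeomorphic_map_\<phi>: "homeomorphic_map (cs_top X) (subtopology (cs_top (CP N)) Z) \<phi>"
proof (rule continuous_imp_homeomorphic_map)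
  have "continuous_map euclidean (cs_top X) Q"
    unfolding continuous_map_def by (simp add: topspace_X openin_X)
  then have "compactin (cs_top X) (Q ` K)"
    using image_compactin[of euclidean K] K(1) by (simp add: compactin_euclidean_iff)
  then show "compact_space (cs_top X)" by (simp add: compact_space_def topspace_X K(2))
  show "Hausdorff_space (subtopology (cs_top (CP N)) Z)"
    by (rule Hausdorff_space_subtopology[OF Hausdorff_space_CP])
  show "continuous_map (cs_top X) (subtopology (cs_top (CP N)) Z) \<phi>"
    unfolding continuous_map_in_subtopology
  proof
    show "continuous_map (cs_top X) (cs_top (CP N)) \<phi>"
      unfolding continuous_map_def
    proof (intro conjI allI impI)
      show "\<phi> \<in> topspace (cs_top X) \<rightarrow> topspace (cs_top (CP N))" using \<Phi>_in by (auto simp: topspace_X)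
      fix W assume W: "openin (cs_top (CP N)) W"
      have "{x. Q x \<in> {p \<in> topspace (cs_top X). \<phi> p \<in> W}} = {x. \<Phi> x \<in> W}" by (auto simp: topspace_X)
      then show "openin (cs_top X) {p \<in> topspace (cs_top X). \<phi> p \<in> W}"
        unfolding openin_X using open_\<Phi>_preimage[OF W] by (auto simp: topspace_X)
    qed
    show "\<phi> \<in> topspace (cs_top X) \<rightarrow> Z" by (auto simp: topspace_X Z_def)
  qed
  show "\<phi> ` topspace (cs_top X) = topspace (subtopology (cs_top (CP N)) Z)"
    using \<Phi>_in by (auto simp: topspace_X Z_def image_image)
  show "inj_on \<phi> (topspace (cs_top X))" by (auto simp: topspace_X inj_on_def \<Phi>_eq_iff)
qed

text \<open>The map r leads from lines near \<Phi> x0 back to the covering space: affine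
  coordinates, a complex linear projection, then the local inverse g. It inverts \<Phi> modulo Q on
  all of Z near \<Phi> x0. Its holomorphy is expressed by the functions u pulled back along it, and
  R0 prescribes where it lands.\<close>

lemma local_retraction:
  assumes R0: "open R0" "x0 \<in> R0" and x0K: "x0 \<in> K"
  obtains U r j where "openin (cs_top (CP N)) U" "\<Phi> x0 \<in> U" "j \<le> N"
    "\<And>x. \<Phi> x \<in> U \<Longrightarrow> Q (r (\<Phi> x)) = Q x" "\<And>q. q \<in> U \<Longrightarrow> r q \<in> R0"
    "\<And>z. z \<in> punctured N \<Longrightarrow> cline z \<in> U \<Longrightarrow> z j \<noteq> 0 \<and> vec (r (cline z)) j \<noteq> 0"
    "\<And>z u D. z \<in> punctured N \<Longrightarrow> cline z \<in> U \<Longrightarrow> (u has_derivative D) (at (r (cline z))) \<Longrightarrow>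
       (\<forall>v. D (J *v v) = \<i> * D v) \<Longrightarrow> cvec_differentiable N (\<lambda>w. u (r (cline w))) z"
proof -
  obtain j where j: "j \<le> N" "(fs ! j) x0 \<noteq> 0" using no_common_zero[of x0] by (auto simp: set_fs)
  then have vj: "vec x0 j \<noteq> 0" by (simp add: vec_def)
  have imm: "v = 0" if "\<And>i. i \<le> N \<Longrightarrow> frechet_derivative (\<lambda>x. vec x i) (at x0) v = \<kappa> * vec x0 i" for v \<kappa>
  proof (rule immersive[OF x0K, of v \<kappa>])
    have "(\<lambda>x. vec x i) = fs ! i" if "i \<le> N" for i using that by (simp add: vec_def)
    then show "\<forall>f\<in>set fs. frechet_derivative f (at x0) v = \<kappa> * f x0"
      using that by (auto simp: set_fs vec_def)
  qed
  obtain L A B g where L: "\<And>i. linear (L i)" "\<And>i c. L i (\<i> * c) = J *v L i c"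
    and A: "open A" "x0 \<in> A" "\<And>x. x \<in> A \<Longrightarrow> vec x j \<noteq> 0" and B: "open B"
    and g: "\<And>x. x \<in> A \<Longrightarrow> (\<Sum>i\<le>N. L i (vec x i / vec x j)) \<in> B"
      "\<And>x. x \<in> A \<Longrightarrow> g (\<Sum>i\<le>N. L i (vec x i / vec x j)) = x"
      "\<And>y. y \<in> B \<Longrightarrow> g y \<in> A"
      "\<And>y. y \<in> B \<Longrightarrow> \<exists>g'. (g has_derivative g') (at y) \<and> (\<forall>v. g' (J *v v) = J *v g' v)"
    by (rule immersion_local_inverse[where F = "\<lambda>i x. vec x i", OF J vec_holomorphic j(1) vj imm])
      (assumption, rule that)
  have bL: "bounded_linear (L i)" for i using L(1) by (simp add: linear_conv_bounded_linear)
  have "continuous_on B g"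
    using g(4) by (intro continuous_at_imp_continuous_on ballI) (meson has_derivative_continuous)
  then have oB: "open (B \<inter> g -` R0)" using B R0(1) continuous_open_preimage by blast
  define S where "S z = (\<Sum>i\<le>N. L i (z i / z j))" for z :: "nat \<Rightarrow> complex"
  define r where "r q = g (S (cline_rep q))" for q
  have r: "r (cline z) = g (S z)" for z by (simp add: r_def S_def cline_rep_quotient)
  \<comment> \<open>C consists of the points of Z without a representative in A \<inter> R0. It is
    closed, and removing it discards other sheets of Z that might enter the chart U0.\<close>
  define C where "C = \<Phi> ` ({x. Q x \<notin> Q ` (A \<inter> R0)} \<inter> K)"
  have C_eq: "C = \<Phi> ` {x. Q x \<notin> Q ` (A \<inter> R0)}" unfolding C_def by (rule \<Phi>_image_K)
  have "closed {x. Q x \<notin> Q ` (A \<inter> R0)}"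
    using Q_open[of "A \<inter> R0"] A(1) R0(1) by (simp add: closed_def Collect_neg_eq[symmetric] open_Int)
  then have C: "closedin (cs_top (CP N)) C" unfolding C_def by (rule closedin_\<Phi>_image)
  define U0 where "U0 = cline ` {z \<in> punctured N. z j \<noteq> 0 \<and> S z \<in> B \<inter> g -` R0}"
  have U0_iff: "cline z \<in> U0 \<longleftrightarrow> z j \<noteq> 0 \<and> S z \<in> B \<inter> g -` R0" if "z \<in> punctured N" for z
  proof
    assume "cline z \<in> U0"
    then obtain w where w: "cline w = cline z" "w j \<noteq> 0" "S w \<in> B \<inter> g -` R0" by (auto simp: U0_def)
    then obtain c where c: "c \<noteq> 0" "z = (\<lambda>i. c * w i)" unfolding cline_eq_iff by auto
    then have "S z = S w" by (simp add: S_def)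
    then show "z j \<noteq> 0 \<and> S z \<in> B \<inter> g -` R0" using w c by simp
  qed (use that in \<open>auto simp: U0_def\<close>)
  have "openin (cs_top (CP N)) U0"
  proof -
    have co: "continuous_on T (\<lambda>z. z i)" for T :: "(nat \<Rightarrow> complex) set" and i
      by (rule continuous_on_subset[OF continuous_on_product_coordinates subset_UNIV])
    let ?P = "{z \<in> punctured N. z j \<noteq> 0}"
    have 1: "openin (top_of_set (punctured N)) ?P"
      using continuous_openin_preimage_gen[OF co[of "punctured N" j], of "-{0}"]
      by (simp add: open_delete vimage_def Int_def Compl_eq_Diff_UNIV)
    have "continuous_on ?P S" unfolding S_def
      by (intro continuous_on_sum bounded_linear.continuous_on[OF bL] continuous_on_divide co) auto
    then have 2: "openin (top_of_set ?P) (?P \<inter> S -` (B \<inter> g -` R0))"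
      using oB by (rule continuous_openin_preimage_gen)
    have "{z \<in> punctured N. cline z \<in> U0} = ?P \<inter> S -` (B \<inter> g -` R0)"
      using U0_iff by blast
    then have "openin (top_of_set (punctured N)) {z \<in> punctured N. cline z \<in> U0}"
      using openin_trans[OF 2 1] by simp
    moreover have "U0 \<subseteq> cline ` punctured N" by (auto simp: U0_def)
    ultimately show ?thesis by (simp add: openin_CP)
  qed
  then have openU: "openin (cs_top (CP N)) (U0 - C)" using C by (rule openin_diff)
  have AO: "\<Phi> x \<in> U0 \<and> r (\<Phi> x) = x" if "x \<in> A \<inter> R0" for x
    using that U0_iff[OF vec_in, of x] A(3)[of x] g(1,2)[of x] by (simp add: \<Phi>_def r S_def)
  have near: "\<exists>x'\<in>A \<inter> R0. Q x' = Q x" if "\<Phi> x \<notin> C" for x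
    using that unfolding C_eq by (auto simp: image_iff) (metis IntI)
  show thesis
  proof (rule that[OF openU _ j(1)])
    show "\<Phi> x0 \<in> U0 - C"
    proof -
      have "Q x \<in> Q ` (A \<inter> R0)" if "\<Phi> x0 = \<Phi> x" for x
        using that A(2) R0(2) by (metis IntI \<Phi>_eq_iff imageI)
      then show ?thesis using AO[of x0] A(2) R0(2) by (auto simp: C_eq)
    qed
    show "Q (r (\<Phi> x)) = Q x" if x: "\<Phi> x \<in> U0 - C" for x
    proof -
      obtain x' where x': "x' \<in> A \<inter> R0" "Q x' = Q x" using near[of x] x by blast
      then have "\<Phi> x = \<Phi> x'" by (simp add: \<Phi>_eq_iff)
      then show ?thesis using AO[OF x'(1)] x'(2) by simp
    qed
    show "r q \<in> R0" if q: "q \<in> U0 - C" for q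
    proof -
      obtain z where z: "q = cline z" "z \<in> punctured N" using q unfolding U0_def by blast
      then show ?thesis using q U0_iff[OF z(2)] by (simp add: r)
    qed
    show "z j \<noteq> 0 \<and> vec (r (cline z)) j \<noteq> 0" if "z \<in> punctured N" "cline z \<in> U0 - C" for z
      using that U0_iff[OF that(1)] A(3) g(3) by (simp add: r)
    fix z u D assume z: "z \<in> punctured N" "cline z \<in> U0 - C" and u: "(u has_derivative D) (at (r (cline z)))"
      and D: "\<forall>v. D (J *v v) = \<i> * D v"
    have zj: "z j \<noteq> 0" and zB: "S z \<in> B" using z U0_iff[OF z(1)] by auto
    have "\<exists>E. has_cvec_derivative N (\<lambda>w. w i / w j) E z \<and> (\<forall>k c. E k (\<i> * c) = \<i> * E k c)" if "i \<le> N" for i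
      by (rule has_cvec_derivative_quotient[where z = z and i = i and j = j]) (use that j(1) zj in blast)+
    then obtain E where E: "\<And>i. i \<le> N \<Longrightarrow> has_cvec_derivative N (\<lambda>w. w i / w j) (E i) z"
        "\<And>i k c. i \<le> N \<Longrightarrow> E i k (\<i> * c) = \<i> * E i k c"
      by metis
    have 1: "has_cvec_derivative N S (\<lambda>k c. \<Sum>i\<le>N. L i (E i k c)) z"
      unfolding S_def
      by (intro has_cvec_derivative_sum has_cvec_derivative_compose[OF E(1)] bounded_linear_imp_has_derivative bL) simp
    obtain g' where g': "(g has_derivative g') (at (S z))" "\<And>v. g' (J *v v) = J *v g' v" using g(4)[OF zB] by blast
    have linJ: "linear (\<lambda>x. J *v x)" by (rule matrix_vector_mul_linear)
    have "has_cvec_derivative N (\<lambda>w. u (g (S w))) (\<lambda>k c. D (g' (\<Sum>i\<le>N. L i (E i k c)))) z"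
      by (rule has_cvec_derivative_compose[OF has_cvec_derivative_compose[OF 1 g'(1)]]) (use u in \<open>simp add: r\<close>)
    then show "cvec_differentiable N (\<lambda>w. u (r (cline w))) z"
      unfolding r
    proof (rule has_cvec_derivative_imp_cvec_differentiable)
      fix k c
      have "(\<Sum>i\<le>N. L i (E i k (\<i> * c))) = J *v (\<Sum>i\<le>N. L i (E i k c))"
        unfolding linear_sum[OF linJ] by (intro sum.cong) (auto simp: E(2) L(2))
      then show "D (g' (\<Sum>i\<le>N. L i (E i k (\<i> * c)))) = \<i> * D (g' (\<Sum>i\<le>N. L i (E i k c)))"
        by (simp add: g'(2) D)
    qed
  qed
qed

lemma cvec_differentiable_const: "cvec_differentiable M (\<lambda>_. c) z"
  unfolding cvec_differentiable_def
  by (intro exI[of _ "\<lambda>_. 0"] allI impI exI[of _ 1]) (auto intro!: mult_nonneg_nonneg cvec_dist_nonneg)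

text \<open>Near one of its points, Z is the fixed point set of \<Phi> after r; comparing affine
  coordinates in the chart j gives finitely many holomorphic equations. Away from Z the inconsistent
  equation 1 = 0 serves.\<close>

lemma analytic_subvariety_Z: "analytic_subvariety (CP N) Z"
  unfolding analytic_subvariety_def
proof (intro conjI ballI closedin_Z)
  fix p assume p: "p \<in> topspace (cs_top (CP N))"
  show "\<exists>U F. openin (cs_top (CP N)) U \<and> p \<in> U \<and> finite F \<and> F \<subseteq> holfuns (CP N) U \<and>
      Z \<inter> U = {x \<in> U. \<forall>h\<in>F. h x = 0}"
  proof (cases "p \<in> Z")
    case False
    let ?U = "topspace (cs_top (CP N)) - Z"
    have "openin (cs_top (CP N)) ?U" using closedin_Z by (simp add: openin_diff)
    then show ?thesis using p False
      by (intro exI[of _ ?U] exI[of _ "{\<lambda>_. 1}"]) (auto simp: holfuns_CP cvec_differentiable_const)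
  next
    case True
    then obtain x0 where x0: "p = \<Phi> x0" "x0 \<in> K" by (auto simp: Z_eq)
    obtain U r j where U: "openin (cs_top (CP N)) U" "\<Phi> x0 \<in> U" "j \<le> N"
      and r: "\<And>x. \<Phi> x \<in> U \<Longrightarrow> Q (r (\<Phi> x)) = Q x"
      and nz: "\<And>z. z \<in> punctured N \<Longrightarrow> cline z \<in> U \<Longrightarrow> z j \<noteq> 0 \<and> vec (r (cline z)) j \<noteq> 0"
      and diff: "\<And>z u D. z \<in> punctured N \<Longrightarrow> cline z \<in> U \<Longrightarrow> (u has_derivative D) (at (r (cline z))) \<Longrightarrow>
       (\<forall>v. D (J *v v) = \<i> * D v) \<Longrightarrow> cvec_differentiable N (\<lambda>w. u (r (cline w))) z"
      by (rule local_retraction[of UNIV x0]) (simp, simp, rule x0(2), rule that)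
    define h where "h i q = cline_rep q i / cline_rep q j - vec (r q) i / vec (r q) j" for i q
    have "h i \<in> holfuns (CP N) U" if i: "i \<le> N" for i
      unfolding holfuns_CP
    proof (intro ballI impI)
      fix z assume z: "z \<in> punctured N" "cline z \<in> U"
      note zj = nz[OF z]
      let ?y = "r (cline z)"
      let ?d = "\<lambda>i. frechet_derivative (\<lambda>x. vec x i) (at ?y)"
      have der: "((\<lambda>x. vec x i / vec x j) has_derivative
          (\<lambda>v. (?d i v * vec ?y j - vec ?y i * ?d j v) / (vec ?y j * vec ?y j))) (at ?y)"
        using has_derivative_divide'[OF c1_holomorphicD(1)[OF vec_holomorphic] c1_holomorphicD(1)[OF vec_holomorphic], of ?y j i] zj
        by simp
      have "cvec_differentiable N (\<lambda>w. vec (r (cline w)) i / vec (r (cline w)) j) z"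
        by (rule diff[OF z der])
          (simp add: c1_holomorphicD(2)[OF vec_holomorphic] algebra_simps diff_divide_distrib)
      then obtain b where b: "\<forall>\<epsilon>>0. \<exists>\<delta>>0. \<forall>w \<in> cvecs N. cvec_dist N w z < \<delta> \<longrightarrow>
        cmod (vec (r (cline w)) i / vec (r (cline w)) j - vec (r (cline z)) i / vec (r (cline z)) j - (\<Sum>i\<le>N. b i * (w i - z i))) \<le> \<epsilon> * cvec_dist N w z"
        unfolding cvec_differentiable_def by (elim exE) (rule that)
      have "has_cvec_derivative N (\<lambda>w. vec (r (cline w)) i / vec (r (cline w)) j) (\<lambda>k c. b k * c) z"
        unfolding has_cvec_derivative_def using b by (simp add: bounded_linear_mult_right)
      then have 1: "has_cvec_derivative N (\<lambda>w. - (vec (r (cline w)) i / vec (r (cline w)) j)) (\<lambda>k c. - (b k * c)) z"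
        by (rule has_cvec_derivative_compose) (rule has_derivative_minus[OF has_derivative_ident])
      obtain E where E: "has_cvec_derivative N (\<lambda>w. w i / w j) E z" "\<And>k c. E k (\<i> * c) = \<i> * E k c"
        by (rule has_cvec_derivative_quotient[where z = z, OF i U(3) conjunct1[OF zj]]) (rule that)
      have "cvec_differentiable N (\<lambda>w. w i / w j + - (vec (r (cline w)) i / vec (r (cline w)) j)) z"
        by (rule has_cvec_derivative_imp_cvec_differentiable[OF has_cvec_derivative_add[OF E(1) 1]])
          (simp only: E(2), simp add: algebra_simps)
      then show "cvec_differentiable N (\<lambda>w. h i (cline w)) z" by (simp add: h_def cline_rep_quotient)
    qed
    moreover have "Z \<inter> U = {q \<in> U. \<forall>k\<in>h ` {..N}. k q = 0}"
    proof (intro equalityI subsetI)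
      fix q assume q: "q \<in> Z \<inter> U"
      then obtain x where x: "q = \<Phi> x" by (auto simp: Z_def)
      then have "q = \<Phi> (r q)" using r[of x] q by (simp add: \<Phi>_eq_iff)
      then have "cline_rep q i / cline_rep q j = vec (r q) i / vec (r q) j" for i
        unfolding \<Phi>_def by (metis cline_rep_quotient)
      then show "q \<in> {q \<in> U. \<forall>k\<in>h ` {..N}. k q = 0}" using q by (simp add: h_def)
    next
      fix q assume q: "q \<in> {q \<in> U. \<forall>k\<in>h ` {..N}. k q = 0}"
      then obtain z where z: "q = cline z" "z \<in> punctured N"
        using openin_subset[OF U(1)] by (auto simp: topspace_CP)
      then have zj: "z j \<noteq> 0" "vec (r q) j \<noteq> 0" using nz q by auto
      have zz: "z i = (z j / vec (r q) j) * vec (r q) i" for i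
      proof (cases "i \<le> N")
        case True
        then have "z i / z j = vec (r q) i / vec (r q) j" using q by (simp add: h_def z(1) cline_rep_quotient)
        then show ?thesis using zj by (simp add: field_simps)
      next
        case False
        then show ?thesis using z(2) by (simp add: cvecs_def vec_def)
      qed
      have "z = (\<lambda>i. (z j / vec (r q) j) * vec (r q) i)" by (rule ext) (rule zz)
      moreover have "z j / vec (r q) j \<noteq> 0" using zj by simp
      ultimately have "cline (vec (r q)) = cline z" unfolding cline_eq_iff by (intro exI conjI)
      then have "q = \<Phi> (r q)" by (simp add: \<Phi>_def z(1))
      then show "q \<in> Z \<inter> U" using q by (auto simp: Z_def)
    qed
    ultimately show ?thesis using U x0 by (intro exI[of _ U] exI[of _ "h ` {..N}"]) auto
  qed
qed

text \<open>In one direction the chain rule applies to the holomorphic coordinates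
  \<open>vec\<close>. In the other, f is extended off Z as f after \<Phi> after r, where r is made
  to land in the preimage of W so that f is evaluated only on V.\<close>

lemma biholomorphism_\<phi>: "biholomorphism X (induced_cspace (CP N) Z) \<phi>"
  unfolding biholomorphism_def
proof (intro conjI allI impI)
  show "homeomorphic_map (cs_top X) (cs_top (induced_cspace (CP N) Z)) \<phi>"
    using homeomorphic_map_\<phi> by (simp add: induced_cspace_def)
  fix V f assume V: "openin (cs_top (induced_cspace (CP N) Z)) V"
  then obtain W where W: "openin (cs_top (CP N)) W" "V = W \<inter> Z"
    by (auto simp: induced_cspace_def openin_subtopology)
  have oW: "open {x. \<Phi> x \<in> W}" by (rule open_\<Phi>_preimage[OF W(1)])
  have VW: "\<Phi> x \<in> V \<longleftrightarrow> \<Phi> x \<in> W" for x by (auto simp: W(2) Z_def)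
  have ind: "f \<in> holfuns (induced_cspace (CP N) Z) V \<longleftrightarrow>
     (\<forall>p\<in>V. \<exists>U h. openin (cs_top (CP N)) U \<and> p \<in> U \<and> h \<in> holfuns (CP N) U \<and> (\<forall>x \<in> U \<inter> V. f x = h x))"
    by (simp add: induced_cspace_def)
  have quo: "f \<circ> \<phi> \<in> holfuns X {p \<in> topspace (cs_top X). \<phi> p \<in> V} \<longleftrightarrow>
     (\<forall>x. \<Phi> x \<in> V \<longrightarrow> (\<exists>D. ((\<lambda>y. f (\<Phi> y)) has_derivative D) (at x) \<and> (\<forall>v. D (J *v v) = \<i> * D v)))"
    by (simp add: holfuns_X topspace_X)
  show "f \<in> holfuns (induced_cspace (CP N) Z) V \<longleftrightarrow> f \<circ> \<phi> \<in> holfuns X {p \<in> topspace (cs_top X). \<phi> p \<in> V}"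
    unfolding ind quo
  proof (intro iffI allI impI ballI)
    fix x assume H: "\<forall>p\<in>V. \<exists>U h. openin (cs_top (CP N)) U \<and> p \<in> U \<and> h \<in> holfuns (CP N) U \<and> (\<forall>x \<in> U \<inter> V. f x = h x)"
      and x: "\<Phi> x \<in> V"
    then obtain U h where U: "openin (cs_top (CP N)) U" "\<Phi> x \<in> U" and h: "h \<in> holfuns (CP N) U"
      and fh: "\<forall>x \<in> U \<inter> V. f x = h x"
      by meson
    have "cvec_differentiable N (\<lambda>w. h (cline w)) (vec x)"
      using h U(2) vec_in[of x] by (auto simp: holfuns_CP \<Phi>_def)
    then have "\<exists>a. ((\<lambda>y. h (cline (vec y))) has_derivative
        (\<lambda>v. \<Sum>i\<le>N. a i * frechet_derivative (\<lambda>x. vec x i) (at x) v)) (at x)"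
      by (rule cvec_differentiable_compose) (use c1_holomorphicD(1)[OF vec_holomorphic] vec_in in auto)
    then obtain a where a: "((\<lambda>y. h (\<Phi> y)) has_derivative
        (\<lambda>v. \<Sum>i\<le>N. a i * frechet_derivative (\<lambda>x. vec x i) (at x) v)) (at x)"
      unfolding \<Phi>_def by blast
    let ?O = "{y. \<Phi> y \<in> U} \<inter> {y. \<Phi> y \<in> W}"
    have "((\<lambda>y. f (\<Phi> y)) has_derivative
        (\<lambda>v. \<Sum>i\<le>N. a i * frechet_derivative (\<lambda>x. vec x i) (at x) v)) (at x)"
      by (rule has_derivative_transform_within_open[OF a, of ?O])
        (use open_\<Phi>_preimage[OF U(1)] oW U(2) x fh VW in auto)
    moreover have "(\<Sum>i\<le>N. a i * frechet_derivative (\<lambda>x. vec x i) (at x) (J *v v)) =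
        \<i> * (\<Sum>i\<le>N. a i * frechet_derivative (\<lambda>x. vec x i) (at x) v)" for v
      by (simp add: c1_holomorphicD(2)[OF vec_holomorphic] sum_distrib_left mult.left_commute)
    ultimately show "\<exists>D. ((\<lambda>y. f (\<Phi> y)) has_derivative D) (at x) \<and> (\<forall>v. D (J *v v) = \<i> * D v)"
      by blast
  next
    fix p assume H: "\<forall>x. \<Phi> x \<in> V \<longrightarrow> (\<exists>D. ((\<lambda>y. f (\<Phi> y)) has_derivative D) (at x) \<and> (\<forall>v. D (J *v v) = \<i> * D v))"
      and p: "p \<in> V"
    then obtain x0 where x0: "p = \<Phi> x0" "x0 \<in> K" by (auto simp: W(2) Z_eq)
    then have "x0 \<in> {x. \<Phi> x \<in> W}" using p VW by simp
    with oW x0(2) obtain U r j where U: "openin (cs_top (CP N)) U" "\<Phi> x0 \<in> U"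
      and r: "\<And>x. \<Phi> x \<in> U \<Longrightarrow> Q (r (\<Phi> x)) = Q x" "\<And>q. q \<in> U \<Longrightarrow> r q \<in> {x. \<Phi> x \<in> W}"
      and diff: "\<And>z u D. z \<in> punctured N \<Longrightarrow> cline z \<in> U \<Longrightarrow> (u has_derivative D) (at (r (cline z))) \<Longrightarrow>
       (\<forall>v. D (J *v v) = \<i> * D v) \<Longrightarrow> cvec_differentiable N (\<lambda>w. u (r (cline w))) z"
      by - (rule local_retraction, assumption+, rule that)
    have "(\<lambda>q. f (\<Phi> (r q))) \<in> holfuns (CP N) U"
      unfolding holfuns_CP
    proof (intro ballI impI)
      fix z assume z: "z \<in> punctured N" "cline z \<in> U"
      then have "\<Phi> (r (cline z)) \<in> V" using r(2) VW by simp
      then obtain D where "((\<lambda>y. f (\<Phi> y)) has_derivative D) (at (r (cline z)))" "\<forall>v. D (J *v v) = \<i> * D v"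
        using H by blast
      then show "cvec_differentiable N (\<lambda>w. f (\<Phi> (r (cline w)))) z"
        using diff[OF z, of "\<lambda>y. f (\<Phi> y)" D] by simp
    qed
    moreover have "f q = f (\<Phi> (r q))" if q: "q \<in> U \<inter> V" for q
    proof -
      obtain x where x: "q = \<Phi> x" using q unfolding W(2) Z_def by blast
      then have "\<Phi> (r q) = \<Phi> x" using r(1)[of x] q by (simp add: \<Phi>_eq_iff)
      then show ?thesis using x by simp
    qed
    ultimately show "\<exists>U h. openin (cs_top (CP N)) U \<and> p \<in> U \<and> h \<in> holfuns (CP N) U \<and> (\<forall>x \<in> U \<inter> V. f x = h x)"
      using U x0 by blast
  qed
qed

theorem projective: "projective_cspace (quotient_cspace Q (linear_cspace J))"
  unfolding projective_cspace_def
  using analytic_subvariety_Z biholomorphism_\<phi> unfolding X_def by blast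

end

section \<open>Automorphisms of complex tori\<close>

lemma full_lattice_subgroup:
  fixes \<Lambda> :: "(real^'n) set"
  assumes "full_lattice \<Lambda>"
  shows "0 \<in> \<Lambda>" "x \<in> \<Lambda> \<Longrightarrow> y \<in> \<Lambda> \<Longrightarrow> x + y \<in> \<Lambda>" "x \<in> \<Lambda> \<Longrightarrow> - x \<in> \<Lambda>"
    "x \<in> \<Lambda> \<Longrightarrow> y \<in> \<Lambda> \<Longrightarrow> x - y \<in> \<Lambda>"
proof -
  obtain M N :: "real^'n^'n" where "N ** M = mat 1" "M ** N = mat 1" and L: "\<Lambda> = {M *v x |x. \<forall>i. x $ i \<in> \<int>}"
    by (rule full_lattice_matrix[OF assms]) (rule that)
  have "M *v 0 \<in> \<Lambda>" unfolding L by (intro CollectI exI[of _ 0]) simp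
  then show 0: "0 \<in> \<Lambda>" by simp
  show d: "x - y \<in> \<Lambda>" if xy: "x \<in> \<Lambda>" "y \<in> \<Lambda>" for x y
  proof -
    obtain a b where "x = M *v a" "\<forall>i. a $ i \<in> \<int>" "y = M *v b" "\<forall>i. b $ i \<in> \<int>"
      using xy unfolding L by blast
    then show ?thesis unfolding L
      by (intro CollectI exI[of _ "a - b"]) (simp add: matrix_vector_mult_diff_distrib)
  qed
  show n: "- x \<in> \<Lambda>" if "x \<in> \<Lambda>" for x using d[OF 0 that] by simp
  show "x + y \<in> \<Lambda>" if "x \<in> \<Lambda>" "y \<in> \<Lambda>" for x y using d[OF that(1) n[OF that(2)]] by simp
qed

lemma full_lattice_discrete:
  assumes "full_lattice \<Lambda>"
  obtains \<delta> where "\<delta> > 0" "\<And>l. l \<in> \<Lambda> \<Longrightarrow> l \<noteq> 0 \<Longrightarrow> \<delta> \<le> norm l"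
proof -
  obtain M N :: "real^'a^'a" where MN: "N ** M = mat 1" "M ** N = mat 1" and L: "\<Lambda> = {M *v x |x. \<forall>i. x $ i \<in> \<int>}"
    by (rule full_lattice_matrix[OF assms]) (rule that)
  obtain K where K: "K > 0" "\<And>x. norm (N *v x) \<le> norm x * K"
    using bounded_linear.pos_bounded[OF matrix_vector_mul_bounded_linear[of N]] by metis
  have "1 / K \<le> norm l" if l: "l \<in> \<Lambda>" "l \<noteq> 0" for l
  proof -
    obtain x where x: "l = M *v x" "\<forall>i. x $ i \<in> \<int>" using l(1) L by blast
    then have "x \<noteq> 0" using l(2) by auto
    then obtain i where "x $ i \<noteq> 0" by (auto simp: vec_eq_iff)
    then have "1 \<le> \<bar>x $ i\<bar>" using x(2) Ints_nonzero_abs_ge1 by blast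
    also have "\<dots> \<le> norm x" by (rule component_le_norm_cart)
    also have "x = N *v l" by (simp add: x(1) matrix_vector_mul_assoc MN)
    finally show ?thesis using K by (smt (verit) divide_le_eq)
  qed
  then show thesis using that[of "1 / K"] K(1) by simp
qed

lemma full_lattice_covering:
  fixes \<Lambda> :: "(real^'n) set"
  assumes "full_lattice \<Lambda>"
  obtains R where "R > 0" "\<And>x. \<exists>l\<in>\<Lambda>. norm (x - l) \<le> R"
proof -
  obtain M N :: "real^'n^'n" where MN: "N ** M = mat 1" "M ** N = mat 1" and L: "\<Lambda> = {M *v x |x. \<forall>i. x $ i \<in> \<int>}"
    by (rule full_lattice_matrix[OF assms]) (rule that)
  obtain K where K: "K > 0" "\<And>x. norm (M *v x) \<le> norm x * K"
    using bounded_linear.pos_bounded[OF matrix_vector_mul_bounded_linear[of M]] by metis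
  have "\<exists>l\<in>\<Lambda>. norm (x - l) \<le> real CARD('n) * K" for x
  proof -
    define y where "y = N *v x"
    define z :: "real^'n" where "z = (\<chi> i. of_int \<lfloor>y $ i\<rfloor>)"
    have "M *v z \<in> \<Lambda>" unfolding L by (auto simp: z_def)
    moreover have "x - M *v z = M *v (y - z)"
      by (simp add: y_def matrix_vector_mult_diff_distrib matrix_vector_mul_assoc MN)
    moreover have "norm (y - z) \<le> (\<Sum>i\<in>(UNIV::'n set). 1)"
    proof -
      have "norm (y - z) \<le> (\<Sum>i\<in>UNIV. \<bar>(y - z) $ i\<bar>)" by (rule norm_le_l1_cart)
      also have "\<dots> \<le> (\<Sum>i\<in>(UNIV::'n set). 1)"
        by (intro sum_mono) (simp add: z_def, linarith)
      finally show ?thesis .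
    qed
    then have "norm (y - z) * K \<le> real CARD('n) * K" using K(1) by (intro mult_right_mono) auto
    then have "norm (M *v (y - z)) \<le> real CARD('n) * K" using K(2) order_trans by blast
    ultimately show ?thesis by metis
  qed
  moreover have "real CARD('n) * K > 0" using K by simp
  ultimately show thesis using that by blast
qed

lemma lattice_coset_eq_iff:
  assumes "full_lattice \<Lambda>"
  shows "lattice_coset \<Lambda> x = lattice_coset \<Lambda> y \<longleftrightarrow> x - y \<in> \<Lambda>"
proof
  assume "lattice_coset \<Lambda> x = lattice_coset \<Lambda> y"
  moreover have "x + 0 \<in> lattice_coset \<Lambda> x"
    unfolding lattice_coset_def using full_lattice_subgroup(1)[OF assms] by blast
  ultimately show "x - y \<in> \<Lambda>" by (auto simp: lattice_coset_def)
next
  assume d: "x - y \<in> \<Lambda>"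
  have "lattice_coset \<Lambda> x \<subseteq> lattice_coset \<Lambda> y" if "x - y \<in> \<Lambda>" for x y
  proof
    fix z assume "z \<in> lattice_coset \<Lambda> x"
    then obtain l where l: "z = x + l" "l \<in> \<Lambda>" by (auto simp: lattice_coset_def)
    then have "z = y + ((x - y) + l)" "(x - y) + l \<in> \<Lambda>"
      using full_lattice_subgroup(2)[OF assms that] by auto
    then show "z \<in> lattice_coset \<Lambda> y" unfolding lattice_coset_def by blast
  qed
  from this[OF d] this[of y x] show "lattice_coset \<Lambda> x = lattice_coset \<Lambda> y"
    using full_lattice_subgroup(3)[OF assms d] by auto
qed

text \<open>The distance to a fixed value of f is continuous on a connected space and never lies
  strictly between 0 and the minimal length \<delta>.\<close>

lemma continuous_into_lattice_constant:
  fixes f :: "real^'n \<Rightarrow> real^'n"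
  assumes "full_lattice \<Lambda>" "continuous_on UNIV f" "\<And>x. f x \<in> \<Lambda>"
  shows "f x = f y"
proof -
  obtain \<delta> where \<delta>: "\<delta> > 0" "\<And>l. l \<in> \<Lambda> \<Longrightarrow> l \<noteq> 0 \<Longrightarrow> \<delta> \<le> norm l"
    by (rule full_lattice_discrete[OF assms(1)]) (rule that)
  define h where "h x = norm (f x - f y)" for x
  have "continuous_on UNIV h" unfolding h_def by (intro continuous_intros assms(2))
  then have con: "connected (range h)" using connected_continuous_image connected_UNIV by blast
  show ?thesis
  proof (rule ccontr)
    assume "f x \<noteq> f y"
    then have "\<delta> \<le> h x"
      using \<delta>(2) full_lattice_subgroup(4)[OF assms(1) assms(3) assms(3)] by (simp add: h_def)
    then have "\<delta> / 2 \<in> {h y..h x}" using \<delta>(1) by (simp add: h_def)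
    then have "\<delta> / 2 \<in> range h" using connected_contains_Icc[OF con, of "h y" "h x"] by blast
    then obtain z where z: "norm (f z - f y) = \<delta> / 2" by (auto simp: h_def)
    then have "\<delta> \<le> \<delta> / 2"
      using \<delta> full_lattice_subgroup(4)[OF assms(1) assms(3) assms(3), of z y] by (metis half_gt_zero less_irrefl norm_zero)
    then show False using \<delta>(1) by simp
  qed
qed

text \<open>Two affine maps that induce g differ by a continuous map into \<Lambda>, which is
  constant.\<close>

lemma linear_part_eq:
  assumes lat: "full_lattice \<Lambda>" and g: "\<And>x. g (lattice_coset \<Lambda> x) = lattice_coset \<Lambda> (A *v x + b)"
  shows "linear_part \<Lambda> g = A"
  unfolding linear_part_def
proof (rule the_equality)
  show "\<exists>b. \<forall>x. g (lattice_coset \<Lambda> x) = lattice_coset \<Lambda> (A *v x + b)" using g by blast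
  fix A' assume "\<exists>b. \<forall>x. g (lattice_coset \<Lambda> x) = lattice_coset \<Lambda> (A' *v x + b)"
  then obtain b' where b': "\<And>x. g (lattice_coset \<Lambda> x) = lattice_coset \<Lambda> (A' *v x + b')" by blast
  have in_L: "(A' *v x + b') - (A *v x + b) \<in> \<Lambda>" for x
    using g[of x] b'[of x] lattice_coset_eq_iff[OF lat] by metis
  have "continuous_on UNIV (\<lambda>x. (A' *v x + b') - (A *v x + b))"
    by (intro continuous_intros)
  then have "(A' *v x + b') - (A *v x + b) = (A' *v 0 + b') - (A *v 0 + b)" for x
    by (rule continuous_into_lattice_constant[OF lat _ in_L])
  then have "A' *v x = A *v x" for x by (simp add: algebra_simps)
  then show "A' = A" by (simp add: matrix_eq)
qed

lemma torus_topology: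
  "topspace (cs_top (complex_torus \<Lambda> J)) = torus_points \<Lambda>"
  "openin (cs_top (complex_torus \<Lambda> J)) U \<longleftrightarrow> U \<subseteq> torus_points \<Lambda> \<and> open {x. lattice_coset \<Lambda> x \<in> U}"
  by (simp_all add: complex_torus_def quotient_cspace_def linear_cspace_def torus_points_def openin_quotient_topology)

lemma holfuns_torus:
  "f \<in> holfuns (complex_torus \<Lambda> J) U \<longleftrightarrow>
    (\<forall>x. lattice_coset \<Lambda> x \<in> U \<longrightarrow> (\<exists>D. ((\<lambda>y. f (lattice_coset \<Lambda> y)) has_derivative D) (at x) \<and> (\<forall>v. D (J *v v) = \<i> * D v)))"
  by (auto simp: complex_torus_def quotient_cspace_def linear_cspace_def o_def)

text \<open>The lift is obtained from continuous logarithms of the lattice characters.\<close>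

lemma torus_map_lift:
  fixes \<Lambda> :: "(real^'n) set"
  assumes lat: "full_lattice \<Lambda>"
    and g: "continuous_map (cs_top (complex_torus \<Lambda> J)) (cs_top (complex_torus \<Lambda> J)) g"
  obtains F where "continuous_on UNIV F" "\<And>x. g (lattice_coset \<Lambda> x) = lattice_coset \<Lambda> (F x)"
proof -
  let ?q = "lattice_coset \<Lambda>" and ?T = "cs_top (complex_torus \<Lambda> J)"
  obtain M N :: "real^'n^'n" where MN: "N ** M = mat 1" "M ** N = mat 1"
    and L: "\<Lambda> = {M *v x |x. \<forall>i. x $ i \<in> \<int>}"
    by (rule full_lattice_matrix[OF lat]) (rule that)
  define e where "e i x = exp (of_real (2 * pi * (N *v x) $ i) * \<i>)" for i x
  have e_eq: "e i x = e i y \<longleftrightarrow> (N *v (x - y)) $ i \<in> \<int>" for i x y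
  proof -
    have "e i x = e i y \<longleftrightarrow> (\<exists>n::int. 2 * pi * (N *v x) $ i = 2 * pi * (N *v y) $ i + of_int (2 * n) * pi)"
      unfolding e_def exp_eq by (simp add: complex_eq_iff)
    also have "\<dots> \<longleftrightarrow> (\<exists>n::int. 2 * pi * (N *v x) $ i = 2 * pi * ((N *v y) $ i + of_int n))"
      by (simp add: algebra_simps)
    also have "\<dots> \<longleftrightarrow> (\<exists>n::int. (N *v (x - y)) $ i = of_int n)"
      by (simp add: matrix_vector_mult_diff_distrib diff_eq_eq add.commute)
    finally show ?thesis by (auto elim: Ints_cases)
  qed
  have L_iff: "x - y \<in> \<Lambda> \<longleftrightarrow> (\<forall>i. e i x = e i y)" for x y
  proof
    assume "x - y \<in> \<Lambda>"
    then obtain z where "x - y = M *v z" "\<forall>i. z $ i \<in> \<int>" using L by blast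
    then show "\<forall>i. e i x = e i y" by (simp add: e_eq matrix_vector_mul_assoc MN)
  next
    assume "\<forall>i. e i x = e i y"
    then have "\<forall>i. (N *v (x - y)) $ i \<in> \<int>" by (simp add: e_eq)
    moreover have "x - y = M *v (N *v (x - y))" by (simp add: matrix_vector_mul_assoc MN)
    ultimately show "x - y \<in> \<Lambda>" unfolding L by blast
  qed
  have cont_e: "continuous_on S (e i)" for i S
    unfolding e_def by (intro continuous_intros)
  define rep where "rep p = (SOME x. ?q x = p)" for p
  have rep: "?q (rep p) = p" if p: "p \<in> torus_points \<Lambda>" for p
  proof -
    obtain x where "?q x = p" using p by (auto simp: torus_points_def)
    then show ?thesis unfolding rep_def by (rule someI)
  qed
  have e_rep: "e i (rep (?q x)) = e i x" for i x
    using rep[of "?q x"] L_iff lattice_coset_eq_iff[OF lat] by (auto simp: torus_points_def)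
  have cm: "continuous_map ?T euclidean (\<lambda>p. e i (rep p))" for i
    unfolding continuous_map_def
  proof (intro conjI allI impI)
    fix S :: "complex set" assume "openin euclidean S"
    then have "open (e i -` S)" using cont_e[of UNIV i] by (simp add: continuous_on_open_vimage)
    moreover have "{x. ?q x \<in> {p \<in> topspace ?T. e i (rep p) \<in> S}} = e i -` S"
      by (auto simp: torus_topology(1) torus_points_def e_rep)
    ultimately show "openin ?T {p \<in> topspace ?T. e i (rep p) \<in> S}"
      unfolding torus_topology(2) by (auto simp: torus_topology(1))
  qed auto
  have cq: "continuous_map euclidean ?T ?q"
    unfolding continuous_map_def by (auto simp: torus_topology torus_points_def)
  define h where "h i x = e i (rep (g (?q x)))" for i x
  have "continuous_on UNIV (h i)" for i
    using continuous_map_compose[OF continuous_map_compose[OF cq g] cm[of i]]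
    by (simp add: h_def[abs_def] o_def)
  moreover have "h i x \<noteq> 0" for i x by (simp add: h_def e_def)
  ultimately have "\<exists>k. continuous_on UNIV k \<and> (\<forall>x. h i x = exp (k x))" for i
    by (rule continuous_logarithm_on_contractible[OF _ contractible_UNIV]) blast
  then obtain k where k: "\<And>i. continuous_on UNIV (k i)" "\<And>i x. h i x = exp (k i x)" by metis
  have Re: "Re (k i x) = 0" for i x
  proof -
    have "cmod (h i x) = 1" by (simp add: h_def e_def)
    then show ?thesis by (simp add: k(2))
  qed
  \<comment> \<open>The functions h i have modulus 1, so their logarithms are purely imaginary and
    the imaginary parts, divided by 2 pi, are real lattice coordinates of a lift.\<close>
  define F where "F x = M *v (\<chi> i. Im (k i x) / (2 * pi))" for x
  have "continuous_on UNIV F"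
    unfolding F_def
    by (intro linear_continuous_on_compose[OF _ matrix_vector_mul_linear] continuous_on_vec_lambda continuous_intros k(1)) simp
  moreover have "g (?q x) = ?q (F x)" for x
  proof -
    have gq: "g (?q x) \<in> torus_points \<Lambda>"
      using continuous_map_image_subset_topspace[OF g] by (auto simp: torus_topology(1) torus_points_def)
    have "e i (F x) = e i (rep (g (?q x)))" for i
    proof -
      have "e i (F x) = exp (of_real (Im (k i x)) * \<i>)"
        by (simp add: e_def F_def matrix_vector_mul_assoc MN)
      also have "of_real (Im (k i x)) * \<i> = k i x" using Re[of i x] by (simp add: complex_eq_iff)
      finally show ?thesis by (simp add: k(2)[symmetric] h_def)
    qed
    then have "F x - rep (g (?q x)) \<in> \<Lambda>" by (simp add: L_iff)
    then show ?thesis using rep[OF gq] lattice_coset_eq_iff[OF lat] by metis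
  qed
  ultimately show thesis using that by blast
qed

text \<open>On each complex line, Re t times v plus Im t times J v, the functions l i after F are
  entire of at most linear growth, hence affine by Liouville's theorem. Their real parts recover
  F.\<close>

lemma holomorphic_lift_affine:
  fixes F :: "real^'n \<Rightarrow> real^'n"
  assumes J: "J ** J = - mat 1"
    and hol: "\<And>i x. \<exists>D. ((\<lambda>y. Complex (F y $ i) (- (J *v F y) $ i)) has_derivative D) (at x) \<and>
       (\<forall>v. D (J *v v) = \<i> * D v)"
    and growth: "\<And>x. norm (F x) \<le> C * (1 + norm x)"
  obtains A b where "\<And>x. F x = A *v x + b" "A ** J = J ** A"
proof -
  \<comment> \<open>The J-linear form whose real part is the coordinate i.\<close>
  define l where "l i v = Complex (v $ i) (- (J *v v) $ i)" for i and v :: "real^'n"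
  have JJ: "J *v (J *v x) = - x" for x
    by (simp add: matrix_vector_mul_assoc J bounded_bilinear.minus_left[OF bounded_bilinear_matrix_vector_mult])
  have lJ: "l i (J *v v) = \<i> * l i v" for i v by (simp add: l_def JJ complex_eq_iff)
  have l_diff: "l i (v - w) = l i v - l i w" for i v w
    by (simp add: l_def matrix_vector_mult_diff_distrib complex_eq_iff)
  have "\<forall>i x. \<exists>D. ((\<lambda>y. l i (F y)) has_derivative D) (at x) \<and> (\<forall>v. D (J *v v) = \<i> * D v)"
    unfolding l_def by (intro allI hol)
  then obtain D where "\<forall>i x. ((\<lambda>y. l i (F y)) has_derivative D i x) (at x) \<and> (\<forall>v. D i x (J *v v) = \<i> * D i x v)"
    unfolding choice_iff by (elim exE) (rule that)
  then have D: "((\<lambda>y. l i (F y)) has_derivative D i x) (at x)" "D i x (J *v v) = \<i> * D i x v" for i x v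
    by simp_all
  obtain B where B: "B > 0" "\<And>i v. cmod (l i v) \<le> B * norm v"
  proof -
    obtain K where K: "K > 0" "\<And>x. norm (J *v x) \<le> norm x * K"
      using bounded_linear.pos_bounded[OF matrix_vector_mul_bounded_linear[of J]] by metis
    have "cmod (l i v) \<le> (1 + K) * norm v" for i v
    proof -
      have "cmod (l i v) \<le> \<bar>v $ i\<bar> + \<bar>(J *v v) $ i\<bar>"
        using cmod_le[of "l i v"] by (simp add: l_def)
      also have "\<dots> \<le> norm v + norm (J *v v)" by (intro add_mono component_le_norm_cart)
      also have "\<dots> \<le> (1 + K) * norm v" using K(2)[of v] by (simp add: algebra_simps)
      finally show ?thesis .
    qed
    then show thesis using that[of "1 + K"] K(1) by simp
  qed
  have C0: "C \<ge> 0" using order_trans[OF norm_ge_zero growth[of 0]] by simp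
  have affine: "l i (F v) = l i (F 0) + D i 0 v" for i v
  proof -
    define p where "p t = Re t *\<^sub>R v + Im t *\<^sub>R (J *v v)" for t
    define u where "u t = l i (F (p t))" for t
    have der: "(u has_field_derivative D i (p t) v) (at t)" for t
    proof -
      have "bounded_linear p" unfolding p_def[abs_def]
        by (intro bounded_linear_add bounded_linear_compose[OF bounded_linear_scaleR_left bounded_linear_Re]
            bounded_linear_compose[OF bounded_linear_scaleR_left bounded_linear_Im])
      then have "(p has_derivative p) (at t)" by (rule bounded_linear_imp_has_derivative)
      then have "((\<lambda>t. l i (F (p t))) has_derivative (\<lambda>h. D i (p t) (p h))) (at t)"
        using has_derivative_compose[of p p t UNIV "\<lambda>y. l i (F y)" "D i (p t)"] D(1) by simp
      moreover have "D i (p t) (p h) = D i (p t) v * h" for h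
      proof -
        have lin: "linear (D i (p t))" using D(1) by (rule has_derivative_linear)
        show ?thesis unfolding p_def[of h]
          by (simp add: linear_add[OF lin] linear_scale[OF lin] D(2) complex_eq_iff algebra_simps)
      qed
      ultimately show ?thesis unfolding has_field_derivative_def u_def by (simp add: fun_eq_iff)
    qed
    have hol_u: "u holomorphic_on UNIV"
      using der by (meson holomorphic_on_def field_differentiable_def field_differentiable_at_within)
    have np: "norm (p t) \<le> cmod t * (norm v + norm (J *v v))" for t
    proof -
      have "norm (p t) \<le> \<bar>Re t\<bar> * norm v + \<bar>Im t\<bar> * norm (J *v v)"
        unfolding p_def using norm_triangle_ineq[of "Re t *\<^sub>R v" "Im t *\<^sub>R (J *v v)"] by simp
      also have "\<dots> \<le> cmod t * norm v + cmod t * norm (J *v v)"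
        by (intro add_mono mult_right_mono abs_Re_le_cmod abs_Im_le_cmod norm_ge_zero)
      finally show ?thesis by (simp add: algebra_simps)
    qed
    have "cmod (u t) \<le> (B * C * (1 + (norm v + norm (J *v v)))) * cmod t ^ 1" if "1 \<le> cmod t" for t
    proof -
      have "cmod (u t) \<le> B * norm (F (p t))" unfolding u_def by (rule B(2))
      also have "\<dots> \<le> B * (C * (1 + norm (p t)))" using growth B(1) by (intro mult_left_mono) auto
      also have "\<dots> \<le> B * (C * (cmod t + cmod t * (norm v + norm (J *v v))))"
        using B(1) C0 np[of t] that by (intro mult_left_mono add_mono) auto
      finally show ?thesis by (simp add: algebra_simps)
    qed
    then have "u 1 = (\<Sum>k\<le>1. (deriv ^^ k) u 0 / fact k * 1 ^ k)"
      by (rule Liouville_polynomial[OF hol_u])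
    then have "u 1 = u 0 + deriv u 0" by simp
    moreover have "deriv u 0 = D i 0 v" using DERIV_imp_deriv[OF der[of 0]] by (simp add: p_def)
    ultimately show ?thesis by (simp add: u_def p_def)
  qed
  define A where "A = matrix (\<lambda>v. F v - F 0)"
  have "linear (\<lambda>v. F v - F 0)"
  proof -
    have lin: "linear (D i 0)" for i using D(1) by (rule has_derivative_linear)
    have comp: "F v $ i - F 0 $ i = Re (D i 0 v)" for i v
    proof -
      have "Re (l i (F v)) - Re (l i (F 0)) = Re (D i 0 v)" using affine[of i v] by simp
      then show ?thesis by (simp add: l_def)
    qed
    show ?thesis
      by (rule linearI)
        (simp_all only: vec_eq_iff vector_minus_component vector_add_component vector_scaleR_component comp
          linear_add[OF lin] linear_scale[OF lin], simp_all)
  qed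
  then have A: "A *v v = F v - F 0" for v unfolding A_def by (simp add: matrix_works)
  have "A *v (J *v v) = J *v (A *v v)" for v
  proof -
    have lA: "l i (A *v v) = D i 0 v" for i v using affine[of i v] by (simp add: A l_diff)
    have "l i (A *v (J *v v)) = l i (J *v (A *v v))" for i by (simp add: lA lJ D(2))
    then have "(A *v (J *v v)) $ i = (J *v (A *v v)) $ i" for i by (metis complex.sel(1) l_def)
    then show ?thesis by (simp add: vec_eq_iff)
  qed
  then have "A ** J = J ** A" by (simp add: matrix_eq matrix_vector_mul_assoc[symmetric])
  moreover have "F x = A *v x + F 0" for x by (simp add: A)
  ultimately show thesis using that by blast
qed

text \<open>The lift is holomorphic because local coordinates of the torus are holomorphic
  functions, which g pulls back to holomorphic functions. Its growth is linear because increments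
  over unit steps can be computed inside a compact set, up to lattice translations.\<close>

proposition torus_automorphism_affine:
  fixes \<Lambda> :: "(real^'n) set"
  assumes lat: "full_lattice \<Lambda>" and J: "J ** J = - mat 1"
    and g: "biholomorphism (complex_torus \<Lambda> J) (complex_torus \<Lambda> J) g"
  obtains A b where "\<And>x. g (lattice_coset \<Lambda> x) = lattice_coset \<Lambda> (A *v x + b)" "A ** J = J ** A"
proof -
  let ?q = "lattice_coset \<Lambda>" and ?X = "complex_torus \<Lambda> J"
  have hol: "\<And>V f. openin (cs_top ?X) V \<Longrightarrow> f \<in> holfuns ?X V \<Longrightarrow>
      f \<circ> g \<in> holfuns ?X {p \<in> topspace (cs_top ?X). g p \<in> V}"
    using g unfolding biholomorphism_def by blast
  have "continuous_map (cs_top ?X) (cs_top ?X) g"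
    using g unfolding biholomorphism_def by (simp add: homeomorphic_imp_continuous_map)
  then obtain F where F: "continuous_on UNIV F" "\<And>x. g (?q x) = ?q (F x)"
    by (rule torus_map_lift[OF lat]) (rule that)
  obtain \<delta> where \<delta>: "\<delta> > 0" "\<And>l. l \<in> \<Lambda> \<Longrightarrow> l \<noteq> 0 \<Longrightarrow> \<delta> \<le> norm l"
    by (rule full_lattice_discrete[OF lat]) (rule that)
  have holF: "\<exists>D. ((\<lambda>y. Complex (F y $ i) (- (J *v F y) $ i)) has_derivative D) (at x) \<and> (\<forall>v. D (J *v v) = \<i> * D v)" for i x
  proof -
    define l where "l v = Complex (v $ i) (- (J *v v) $ i)" for v :: "real^'n"
    have JJ: "J *v (J *v x) = - x" for x
      by (simp add: matrix_vector_mul_assoc J bounded_bilinear.minus_left[OF bounded_bilinear_matrix_vector_mult])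
    have lJ: "l (J *v v) = \<i> * l v" for v by (simp add: l_def JJ complex_eq_iff)
    have "linear l" unfolding l_def
      by (rule linearI) (simp_all add: complex_eq_iff matrix_vector_right_distrib algebra_simps
          linear_scale[OF matrix_vector_mul_linear])
    then have bl: "bounded_linear l" by (simp add: linear_conv_bounded_linear)
    \<comment> \<open>Two points of a ball of radius \<delta> / 2 are less than \<delta> apart and
      so not congruent modulo \<Lambda>; thus s is a local inverse of the coset map.\<close>
    define B where "B = ball (F x) (\<delta> / 2)"
    define s where "s p = (SOME y. y \<in> B \<and> ?q y = p)" for p
    have s: "s (?q z) = y" if "y \<in> B" "?q z = ?q y" for y z
    proof -
      have "s (?q z) \<in> B \<and> ?q (s (?q z)) = ?q z"
        unfolding s_def by (rule someI[of _ y]) (use that in auto)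
      then have sz: "s (?q z) \<in> B" "?q (s (?q z)) = ?q y" using that(2) by auto
      have "s (?q z) - y \<in> \<Lambda>" using sz(2) lattice_coset_eq_iff[OF lat] by blast
      moreover have "dist (s (?q z)) y < \<delta>"
        using sz(1) that(1) dist_triangle_half_r[of "F x" "s (?q z)" \<delta> y] by (simp add: B_def)
      ultimately show ?thesis using \<delta>(2)[of "s (?q z) - y"] by (auto simp: dist_norm)
    qed
    have translate: "{z. ?q z \<in> ?q ` B} = (\<Union>k\<in>\<Lambda>. {z. z - k \<in> B})"
    proof (intro equalityI subsetI)
      fix z assume "z \<in> {z. ?q z \<in> ?q ` B}"
      then obtain y where y: "y \<in> B" "?q z = ?q y" by auto
      then have "z - y \<in> \<Lambda>" using lattice_coset_eq_iff[OF lat] by blast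
      then show "z \<in> (\<Union>k\<in>\<Lambda>. {z. z - k \<in> B})" using y by (intro UN_I[of "z - y"]) auto
    next
      fix z assume "z \<in> (\<Union>k\<in>\<Lambda>. {z. z - k \<in> B})"
      then obtain k where "k \<in> \<Lambda>" "z - k \<in> B" by auto
      moreover from this have "?q z = ?q (z - k)" using lattice_coset_eq_iff[OF lat] by simp
      ultimately show "z \<in> {z. ?q z \<in> ?q ` B}" by auto
    qed
    have open_B: "open {z. z - k \<in> B}" for k
    proof -
      have "{z. z - k \<in> B} = (\<lambda>z. z - k) -` B" by auto
      then show ?thesis unfolding B_def by (auto intro!: open_vimage continuous_intros)
    qed
    have V: "openin (cs_top ?X) (?q ` B)"
      unfolding torus_topology(2) translate using open_B by (auto simp: torus_points_def)
    have "(\<lambda>p. l (s p)) \<in> holfuns ?X (?q ` B)"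
      unfolding holfuns_torus
    proof (intro allI impI)
      fix z assume "?q z \<in> ?q ` B"
      then obtain k where k: "k \<in> \<Lambda>" "z - k \<in> B" using translate by blast
      have "((\<lambda>y. l (y - k)) has_derivative l) (at z)"
        by (auto intro!: derivative_eq_intros bounded_linear.has_derivative[OF bl])
      then have "((\<lambda>y. l (s (?q y))) has_derivative l) (at z)"
      proof (rule has_derivative_transform_within_open[OF _ open_B[of k]])
        show "z \<in> {z. z - k \<in> B}" using k by simp
        fix y assume "y \<in> {z. z - k \<in> B}"
        moreover have "?q y = ?q (y - k)" using k lattice_coset_eq_iff[OF lat] by simp
        ultimately show "l (y - k) = l (s (?q y))" using s[of "y - k" y] by simp
      qed
      then show "\<exists>D. ((\<lambda>y. l (s (?q y))) has_derivative D) (at z) \<and> (\<forall>v. D (J *v v) = \<i> * D v)"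
        using lJ by blast
    qed
    then have "(\<lambda>p. l (s p)) \<circ> g \<in> holfuns ?X {p \<in> topspace (cs_top ?X). g p \<in> ?q ` B}"
      by (rule hol[OF V])
    moreover have "?q x \<in> {p \<in> topspace (cs_top ?X). g p \<in> ?q ` B}"
      using \<delta>(1) by (auto simp: torus_topology torus_points_def F(2) B_def)
    ultimately obtain D where D: "((\<lambda>y. l (s (g (?q y)))) has_derivative D) (at x)" "\<forall>v. D (J *v v) = \<i> * D v"
      unfolding holfuns_torus by auto
    have "((\<lambda>y. l (F y)) has_derivative D) (at x)"
    proof (rule has_derivative_transform_within_open[OF D(1)])
      show "open (F -` B)" unfolding B_def using F(1) by (intro open_vimage) auto
      show "x \<in> F -` B" using \<delta>(1) by (simp add: B_def)
      show "l (s (g (?q y))) = l (F y)" if "y \<in> F -` B" for y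
        using s[of "F y" "F y"] that by (simp add: F(2))
    qed
    then show ?thesis using D(2) unfolding l_def by blast
  qed
  have "\<exists>C. \<forall>x. norm (F x) \<le> C * (1 + norm x)"
  proof -
    \<comment> \<open>The difference F (x + k) - F x is continuous in x with values in \<Lambda>,
      hence constant.\<close>
    have per: "F (x + k) - F x = F (y + k) - F y" if k: "k \<in> \<Lambda>" for x y k
    proof (rule continuous_into_lattice_constant[OF lat, where f = "\<lambda>x. F (x + k) - F x"])
      show "continuous_on UNIV (\<lambda>x. F (x + k) - F x)"
        by (intro continuous_intros continuous_on_compose2[OF F(1)]) auto
      fix x
      have "?q (x + k) = ?q x" using k lattice_coset_eq_iff[OF lat] by simp
      then have "?q (F (x + k)) = ?q (F x)" using F(2) by metis
      then show "F (x + k) - F x \<in> \<Lambda>" using lattice_coset_eq_iff[OF lat] by blast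
    qed
    obtain R where R: "R > 0" "\<And>x. \<exists>k\<in>\<Lambda>. norm (x - k) \<le> R"
      by (rule full_lattice_covering[OF lat]) (rule that)
    have "compact (F ` cball 0 (R + 1))"
      by (intro compact_continuous_image continuous_on_subset[OF F(1)]) auto
    obtain C0 where C0: "\<And>x. norm x \<le> R + 1 \<Longrightarrow> norm (F x) \<le> C0"
    proof -
      obtain C0 where "\<forall>y\<in>F ` cball 0 (R + 1). norm y \<le> C0"
        using compact_imp_bounded[OF \<open>compact (F ` cball 0 (R + 1))\<close>] unfolding bounded_iff by blast
      then show thesis by (intro that[of C0]) simp
    qed
    have step: "norm (F (x + h) - F x) \<le> 2 * C0" if h: "norm h \<le> 1" for x h
    proof -
      obtain k where k: "k \<in> \<Lambda>" "norm (x - k) \<le> R" using R(2) by blast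
      have "F (x + h) - F x = F (x - k + h) - F (x - k)"
        using per[OF k(1), of "x - k + h" "x - k"] by (simp add: algebra_simps)
      moreover have "norm (x - k + h) \<le> R + 1" using k(2) h norm_triangle_ineq[of "x - k" h] by linarith
      moreover have "norm (x - k) \<le> R + 1" using k(2) by simp
      ultimately show ?thesis
        using C0[of "x - k + h"] C0[of "x - k"] norm_triangle_ineq4[of "F (x - k + h)" "F (x - k)"] by simp
    qed
    have steps: "norm (F (real n *\<^sub>R h) - F 0) \<le> real n * (2 * C0)" if h: "norm h \<le> 1" for n h
    proof (induction n)
      case (Suc n)
      have "norm (F (real (Suc n) *\<^sub>R h) - F 0) \<le>
          norm (F (real n *\<^sub>R h + h) - F (real n *\<^sub>R h)) + norm (F (real n *\<^sub>R h) - F 0)"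
        using norm_triangle_ineq[of "F (real n *\<^sub>R h + h) - F (real n *\<^sub>R h)" "F (real n *\<^sub>R h) - F 0"]
        by (simp add: algebra_simps)
      then show ?case using Suc.IH step[OF h, of "real n *\<^sub>R h"] by (simp add: algebra_simps)
    qed simp
    have C0_nonneg: "C0 \<ge> 0" using order_trans[OF norm_ge_zero C0[of 0]] R(1) by simp
    have "norm (F x) \<le> (norm (F 0) + 4 * C0) * (1 + norm x)" for x
    proof -
      \<comment> \<open>The vector x is cut into n steps of length at most 1; the summand 1 keeps n
        positive at x = 0.\<close>
      define n where "n = nat \<lceil>norm x\<rceil> + 1"
      have n: "norm x \<le> real n" "real n \<le> norm x + 2" "n > 0" unfolding n_def by (auto; linarith)+
      have "norm ((1 / real n) *\<^sub>R x) \<le> 1" using n(1,3) by (simp add: divide_le_eq)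
      from steps[OF this, of n] have "norm (F x - F 0) \<le> real n * (2 * C0)" using n(3) by simp
      also have "\<dots> \<le> (norm x + 2) * (2 * C0)" using n(2) C0_nonneg by (intro mult_right_mono) auto
      finally have "norm (F x) \<le> norm (F 0) + (norm x + 2) * (2 * C0)"
        using norm_triangle_ineq2[of "F x" "F 0"] by linarith
      moreover have "0 \<le> norm (F 0) * norm x" "0 \<le> C0 * norm x" using C0_nonneg by simp_all
      moreover have "(norm x + 2) * (2 * C0) = 2 * (C0 * norm x) + 4 * C0"
        "(norm (F 0) + 4 * C0) * (1 + norm x) = norm (F 0) + norm (F 0) * norm x + 4 * C0 + 4 * (C0 * norm x)"
        by (simp_all add: algebra_simps)
      ultimately show ?thesis by linarith
    qed
    then show ?thesis by blast
  qed
  then obtain C where C: "\<And>x. norm (F x) \<le> C * (1 + norm x)" by blast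
  obtain A b where Ab: "\<And>x. F x = A *v x + b" "A ** J = J ** A"
    by (rule holomorphic_lift_affine[OF J holF C]) (rule that)
  show thesis by (rule that[of A b]) (simp_all add: F(2) Ab)
qed

section \<open>Theta functions\<close>

lemma summable_on_dominated:
  fixes g :: "'i \<Rightarrow> 'b::banach"
  assumes M: "M summable_on A" and g: "\<And>i. i \<in> A \<Longrightarrow> norm (g i) \<le> M i"
  shows "g abs_summable_on A" "g summable_on A" "norm (infsum g A) \<le> infsum M A"
proof -
  show abs: "g abs_summable_on A"
    by (rule summable_on_comparison_test[OF M g]) auto
  then show "g summable_on A" by (rule abs_summable_summable)
  have "norm (infsum g A) \<le> (\<Sum>\<^sub>\<infinity>i\<in>A. norm (g i))" by (rule norm_infsum_bound[OF abs])
  also have "\<dots> \<le> infsum M A" by (rule infsum_mono[OF abs M g])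
  finally show "norm (infsum g A) \<le> infsum M A" .
qed

text \<open>A finite partial sum is differentiated directly. In the tail the mean value inequality
  bounds each increment minus derivative by 2 M i norm (y - x), so a tail of M below e / 4 costs at
  most e / 2.\<close>

lemma has_derivative_infsum:
  fixes f :: "'i \<Rightarrow> 'a::euclidean_space \<Rightarrow> 'b::banach"
  assumes r: "r > 0" and der: "\<And>i y. i \<in> A \<Longrightarrow> y \<in> ball x r \<Longrightarrow> (f i has_derivative f' i y) (at y)"
    and bound: "\<And>i y h. i \<in> A \<Longrightarrow> y \<in> ball x r \<Longrightarrow> norm (f' i y h) \<le> M i * norm h"
    and M: "M summable_on A" and fx: "(\<lambda>i. f i x) summable_on A"
  shows "((\<lambda>y. \<Sum>\<^sub>\<infinity>i\<in>A. f i y) has_derivative (\<lambda>h. \<Sum>\<^sub>\<infinity>i\<in>A. f' i x h)) (at x)"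
proof -
  have x: "x \<in> ball x r" using r by simp
  have Mc: "(\<lambda>i. M i * c) summable_on B" if "B \<subseteq> A" for c B
    using summable_on_subset_banach[OF M that] by (rule summable_on_cmult_left)
  have sf': "(\<lambda>i. f' i x h) summable_on A" for h
    by (rule summable_on_dominated(2)[OF Mc[OF order_refl] bound[OF _ x]])
  have lin: "linear (f' i x)" if "i \<in> A" for i using der[OF that x] by (rule has_derivative_linear)
  have "bounded_linear (\<lambda>h. \<Sum>\<^sub>\<infinity>i\<in>A. f' i x h)"
  proof (rule bounded_linear_intro)
    fix h k
    have "(\<Sum>\<^sub>\<infinity>i\<in>A. f' i x (h + k)) = (\<Sum>\<^sub>\<infinity>i\<in>A. f' i x h + f' i x k)"
      by (intro infsum_cong) (simp add: linear_add[OF lin])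
    then show "(\<Sum>\<^sub>\<infinity>i\<in>A. f' i x (h + k)) = (\<Sum>\<^sub>\<infinity>i\<in>A. f' i x h) + (\<Sum>\<^sub>\<infinity>i\<in>A. f' i x k)"
      by (simp add: infsum_add sf')
  next
    fix c h
    have "(\<Sum>\<^sub>\<infinity>i\<in>A. f' i x (c *\<^sub>R h)) = (\<Sum>\<^sub>\<infinity>i\<in>A. c *\<^sub>R f' i x h)"
      by (intro infsum_cong) (simp add: linear_scale[OF lin])
    then show "(\<Sum>\<^sub>\<infinity>i\<in>A. f' i x (c *\<^sub>R h)) = c *\<^sub>R (\<Sum>\<^sub>\<infinity>i\<in>A. f' i x h)"
      by (simp add: infsum_scaleR_right)
  next
    fix h
    have "norm (\<Sum>\<^sub>\<infinity>i\<in>A. f' i x h) \<le> (\<Sum>\<^sub>\<infinity>i\<in>A. M i * norm h)"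
      by (rule summable_on_dominated(3)[OF Mc[OF order_refl] bound[OF _ x]])
    also have "\<dots> = norm h * infsum M A" by (simp add: infsum_cmult_left' mult.commute)
    finally show "norm (\<Sum>\<^sub>\<infinity>i\<in>A. f' i x h) \<le> norm h * infsum M A" .
  qed
  moreover have "\<exists>d>0. \<forall>y. norm (y - x) < d \<longrightarrow>
      norm ((\<Sum>\<^sub>\<infinity>i\<in>A. f i y) - (\<Sum>\<^sub>\<infinity>i\<in>A. f i x) - (\<Sum>\<^sub>\<infinity>i\<in>A. f' i x (y - x))) \<le> e * norm (y - x)"
    if e: "e > 0" for e
  proof -
    have "(sum M \<longlongrightarrow> infsum M A) (finite_subsets_at_top A)"
      using has_sum_infsum[OF M] by (simp add: has_sum_def)
    then have "\<forall>\<^sub>F F in finite_subsets_at_top A. dist (sum M F) (infsum M A) < e / 4"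
      by (rule tendstoD) (use e in simp)
    then obtain F where F: "finite F" "F \<subseteq> A" "dist (sum M F) (infsum M A) < e / 4"
      unfolding eventually_finite_subsets_at_top by blast
    have tail: "infsum M (A - F) < e / 4"
      using F(1,3) infsum_Diff[OF M summable_on_finite[OF F(1)] F(2)] unfolding dist_real_def
      by (simp only: infsum_finite)
    have "((\<lambda>y. \<Sum>i\<in>F. f i y) has_derivative (\<lambda>h. \<Sum>i\<in>F. f' i x h)) (at x)"
      using F(2) x by (intro has_derivative_sum der) auto
    then obtain d where d: "d > 0" "\<forall>y. norm (y - x) < d \<longrightarrow>
        norm ((\<Sum>i\<in>F. f i y) - (\<Sum>i\<in>F. f i x) - (\<Sum>i\<in>F. f' i x (y - x))) \<le> e / 2 * norm (y - x)"
      using e unfolding has_derivative_at_alt by (metis half_gt_zero)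
    show ?thesis
    proof (intro exI[of _ "min d r"] conjI allI impI)
      show "min d r > 0" using d r by simp
      fix y assume y: "norm (y - x) < min d r"
      then have yb: "y \<in> ball x r" by (simp add: dist_norm norm_minus_commute)
      have lip: "norm (f i y - f i x) \<le> M i * norm (y - x)" if i: "i \<in> A" for i
      proof (rule differentiable_bound[OF convex_ball _ _ yb x])
        fix z assume z: "z \<in> ball x r"
        show "(f i has_derivative f' i z) (at z within ball x r)" using der[OF i z] by (rule has_derivative_at_withinI)
        show "onorm (f' i z) \<le> M i" by (rule onorm_le) (rule bound[OF i z])
      qed
      define g where "g i = f i y - f i x - f' i x (y - x)" for i
      have g: "norm (g i) \<le> M i * (2 * norm (y - x))" if i: "i \<in> A" for i
        using norm_triangle_ineq4[of "f i y - f i x" "f' i x (y - x)"] lip[OF i] bound[OF i x, of "y - x"]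
        by (simp add: g_def)
      have sd: "(\<lambda>i. f i y - f i x) summable_on A"
        by (rule summable_on_dominated(2)[OF Mc[OF order_refl] lip])
      have sg: "g summable_on A" by (rule summable_on_dominated(2)[OF Mc[OF order_refl] g])
      have "(\<Sum>\<^sub>\<infinity>i\<in>A. f i y) = (\<Sum>\<^sub>\<infinity>i\<in>A. (g i + f' i x (y - x)) + f i x)"
        by (simp add: g_def)
      also have "\<dots> = infsum g A + (\<Sum>\<^sub>\<infinity>i\<in>A. f' i x (y - x)) + (\<Sum>\<^sub>\<infinity>i\<in>A. f i x)"
        using sg sf' fx by (simp add: infsum_add summable_on_add)
      finally have "(\<Sum>\<^sub>\<infinity>i\<in>A. f i y) - (\<Sum>\<^sub>\<infinity>i\<in>A. f i x) - (\<Sum>\<^sub>\<infinity>i\<in>A. f' i x (y - x)) = infsum g A"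
        by simp
      also have "\<dots> = infsum g (A - F) + sum g F"
        using infsum_Diff[OF sg summable_on_finite[OF F(1)] F(2)] F(1) by simp
      finally have eq: "(\<Sum>\<^sub>\<infinity>i\<in>A. f i y) - (\<Sum>\<^sub>\<infinity>i\<in>A. f i x) - (\<Sum>\<^sub>\<infinity>i\<in>A. f' i x (y - x)) = infsum g (A - F) + sum g F" .
      have "norm (infsum g (A - F)) \<le> (\<Sum>\<^sub>\<infinity>i\<in>A - F. M i * (2 * norm (y - x)))"
        by (rule summable_on_dominated(3)[OF Mc]) (use g in auto)
      also have "\<dots> = infsum M (A - F) * (2 * norm (y - x))" by (rule infsum_cmult_left')
      also have "\<dots> \<le> e / 4 * (2 * norm (y - x))" using tail by (intro mult_right_mono) auto
      finally have 1: "norm (infsum g (A - F)) \<le> e / 2 * norm (y - x)" by simp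
      have "sum g F = (\<Sum>i\<in>F. f i y) - (\<Sum>i\<in>F. f i x) - (\<Sum>i\<in>F. f' i x (y - x))"
        by (simp add: g_def sum_subtractf)
      then have 2: "norm (sum g F) \<le> e / 2 * norm (y - x)" using d(2) y by simp
      have "norm (infsum g (A - F) + sum g F) \<le> e / 2 * norm (y - x) + e / 2 * norm (y - x)"
        using norm_triangle_mono[OF 1 2] .
      then show "norm ((\<Sum>\<^sub>\<infinity>i\<in>A. f i y) - (\<Sum>\<^sub>\<infinity>i\<in>A. f i x) - (\<Sum>\<^sub>\<infinity>i\<in>A. f' i x (y - x))) \<le> e * norm (y - x)"
        unfolding eq by (simp add: field_simps)
    qed
  qed
  ultimately show ?thesis unfolding has_derivative_at_alt by blast
qed

lemma sum_power_abs_int_le: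
  fixes r :: real
  assumes "0 \<le> r" "r < 1"
  shows "(\<Sum>j\<in>{- int k..int k}. r ^ nat \<bar>j\<bar>) \<le> 2 / (1 - r)"
proof -
  have geo: "(\<Sum>j\<le>k. r ^ j) \<le> 1 / (1 - r)"
  proof -
    have "(\<Sum>j\<le>k. r ^ j) = (1 - r ^ Suc k) / (1 - r)"
      using sum_gp0[of r k] assms by simp
    then show ?thesis using assms by (simp add: divide_right_mono)
  qed
  have sub: "{- int k..int k} \<subseteq> int ` {..k} \<union> (\<lambda>j. - int j) ` {..k}"
  proof
    fix j assume "j \<in> {- int k..int k}"
    then show "j \<in> int ` {..k} \<union> (\<lambda>j. - int j) ` {..k}"
      by (cases "j \<ge> 0") (auto intro!: image_eqI[of _ _ "nat \<bar>j\<bar>"])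
  qed
  have "(\<Sum>j\<in>{- int k..int k}. r ^ nat \<bar>j\<bar>) \<le> (\<Sum>j\<in>int ` {..k} \<union> (\<lambda>j. - int j) ` {..k}. r ^ nat \<bar>j\<bar>)"
    using assms by (intro sum_mono2[OF _ sub]) auto
  also have "\<dots> \<le> (\<Sum>j\<in>int ` {..k}. r ^ nat \<bar>j\<bar>) + (\<Sum>j\<in>(\<lambda>j. - int j) ` {..k}. r ^ nat \<bar>j\<bar>)"
    using assms by (subst sum_Un) (auto intro!: sum_nonneg)
  also have "\<dots> = (\<Sum>j\<le>k. r ^ j) + (\<Sum>j\<le>k. r ^ j)"
    by (subst (1 2) sum.reindex) (auto simp: inj_on_def)
  finally show ?thesis using geo by simp
qed

text \<open>A finite set of integer vectors lies in a box, over which the sum factors into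
  one-dimensional geometric sums.\<close>

lemma summable_on_prod_power_abs:
  fixes r :: real
  assumes r: "0 \<le> r" "r < 1"
  shows "(\<lambda>n :: 'n::finite \<Rightarrow> int. \<Prod>i\<in>UNIV. r ^ nat \<bar>n i\<bar>) summable_on UNIV"
proof (rule nonneg_bdd_above_summable_on)
  show "0 \<le> (\<Prod>i\<in>UNIV. r ^ nat \<bar>n i\<bar>)" for n :: "'n \<Rightarrow> int" using r by (intro prod_nonneg) auto
  show "bdd_above (sum (\<lambda>n :: 'n \<Rightarrow> int. \<Prod>i\<in>UNIV. r ^ nat \<bar>n i\<bar>) ` {F. F \<subseteq> UNIV \<and> finite F})"
  proof (rule bdd_aboveI2[where M = "\<Prod>i\<in>(UNIV :: 'n set). 2 / (1 - r)"])
    fix F :: "('n \<Rightarrow> int) set" assume "F \<in> {F. F \<subseteq> UNIV \<and> finite F}"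
    then have F: "finite F" by simp
    define k where "k = nat (Max (insert 0 ((\<lambda>(n, i). \<bar>n i\<bar>) ` (F \<times> UNIV))))"
    have k: "\<bar>n i\<bar> \<le> int k" if "n \<in> F" for n i
    proof -
      have "\<bar>n i\<bar> \<le> Max (insert 0 ((\<lambda>(n, i). \<bar>n i\<bar>) ` (F \<times> UNIV)))"
        using F that by (intro Max_ge) (auto intro!: image_eqI[of _ _ "(n, i)"])
      then show ?thesis unfolding k_def by linarith
    qed
    have "F \<subseteq> Pi\<^sub>E (UNIV :: 'n set) (\<lambda>_. {- int k..int k})"
    proof
      fix n assume n: "n \<in> F"
      have "n i \<in> {- int k..int k}" for i using k[OF n, of i] by auto
      then show "n \<in> Pi\<^sub>E UNIV (\<lambda>_. {- int k..int k})" by auto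
    qed
    then have "(\<Sum>n\<in>F. \<Prod>i\<in>UNIV. r ^ nat \<bar>n i\<bar>) \<le> (\<Sum>n\<in>Pi\<^sub>E (UNIV :: 'n set) (\<lambda>_. {- int k..int k}). \<Prod>i\<in>UNIV. r ^ nat \<bar>n i\<bar>)"
      using r by (intro sum_mono2 finite_PiE prod_nonneg) auto
    also have "\<dots> = (\<Prod>i\<in>(UNIV :: 'n set). \<Sum>j\<in>{- int k..int k}. r ^ nat \<bar>j\<bar>)"
      by (rule prod_sum_PiE[symmetric]) auto
    also have "\<dots> \<le> (\<Prod>i\<in>(UNIV :: 'n set). 2 / (1 - r))"
      using r by (intro prod_mono conjI sum_nonneg sum_power_abs_int_le) auto
    finally show "(\<Sum>n\<in>F. \<Prod>i\<in>UNIV. r ^ nat \<bar>n i\<bar>) \<le> (\<Prod>i\<in>(UNIV :: 'n set). 2 / (1 - r))" .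
  qed
qed

text \<open>In integer coordinates n the squared norm dominates a multiple of the sum of the squares
  of the n i, hence of their absolute values since they are integers. This reduces the Gaussian to a
  product of geometric series.\<close>

lemma lattice_gauss_summable:
  fixes \<Lambda> :: "(real^'n) set"
  assumes lat: "full_lattice \<Lambda>" and c: "c > 0"
  shows "(\<lambda>l. exp (- c * (norm l)\<^sup>2)) summable_on \<Lambda>"
proof -
  obtain M N :: "real^'n^'n" where MN: "N ** M = mat 1" "M ** N = mat 1"
    and L: "\<Lambda> = {M *v x |x. \<forall>i. x $ i \<in> \<int>}"
    by (rule full_lattice_matrix[OF lat]) (rule that)
  obtain K where K: "K > 0" "\<And>x. norm (N *v x) \<le> norm x * K"
    using bounded_linear.pos_bounded[OF matrix_vector_mul_bounded_linear[of N]] by metis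
  define \<phi> where "\<phi> n = M *v (\<chi> i. of_int (n i))" for n :: "'n \<Rightarrow> int"
  have bij: "bij_betw \<phi> UNIV \<Lambda>"
  proof (rule bij_betwI')
    fix n m :: "'n \<Rightarrow> int"
    have "n = m" if "\<phi> n = \<phi> m"
    proof -
      have "N *v \<phi> n = N *v \<phi> m" using that by simp
      then have "(\<chi> i. real_of_int (n i)) = (\<chi> i. real_of_int (m i))"
        by (simp add: \<phi>_def matrix_vector_mul_assoc MN)
      then show ?thesis by (auto simp: vec_eq_iff)
    qed
    then show "\<phi> n = \<phi> m \<longleftrightarrow> n = m" by blast
    show "\<phi> n \<in> \<Lambda>" unfolding L \<phi>_def by (intro CollectI exI[of _ "\<chi> i. of_int (n i)"]) simp
  next
    fix l assume "l \<in> \<Lambda>"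
    then obtain x where x: "l = M *v x" "\<forall>i. x $ i \<in> \<int>" unfolding L by blast
    have "x = (\<chi> i. of_int \<lfloor>x $ i\<rfloor>)" using x(2) by (simp add: vec_eq_iff)
    then have "l = \<phi> (\<lambda>i. \<lfloor>x $ i\<rfloor>)" unfolding \<phi>_def x(1) by metis
    then show "\<exists>n\<in>UNIV. l = \<phi> n" by blast
  qed
  define r where "r = exp (- (c / K\<^sup>2))"
  have r: "0 \<le> r" "r < 1" using c K(1) by (auto simp: r_def)
  have "exp (- c * (norm (\<phi> n))\<^sup>2) \<le> (\<Prod>i\<in>UNIV. r ^ nat \<bar>n i\<bar>)" for n
  proof -
    let ?x = "\<chi> i. real_of_int (n i)"
    have "norm ?x \<le> norm (\<phi> n) * K" using K(2)[of "\<phi> n"] by (simp add: \<phi>_def matrix_vector_mul_assoc MN)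
    then have "(norm ?x)\<^sup>2 \<le> (norm (\<phi> n) * K)\<^sup>2" by (intro power_mono) auto
    then have 1: "(norm ?x)\<^sup>2 / K\<^sup>2 \<le> (norm (\<phi> n))\<^sup>2"
      using K(1) by (simp only: power_mult_distrib divide_le_eq) simp
    have 2: "(norm ?x)\<^sup>2 = (\<Sum>i\<in>UNIV. (of_int (n i))\<^sup>2)"
      by (simp add: norm_vec_def L2_set_def sum_nonneg)
    have "(\<Sum>i\<in>UNIV. real (nat \<bar>n i\<bar>)) \<le> (\<Sum>i\<in>UNIV. (of_int (n i))\<^sup>2)"
    proof (rule sum_mono)
      fix i
      have "\<bar>n i\<bar> \<le> (n i)\<^sup>2" using self_le_power[of "\<bar>n i\<bar>" 2] by (cases "n i = 0") auto
      then have "real_of_int \<bar>n i\<bar> \<le> real_of_int ((n i)\<^sup>2)" by (simp only: of_int_le_iff)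
      then show "real (nat \<bar>n i\<bar>) \<le> (of_int (n i))\<^sup>2" by simp
    qed
    then have "(\<Sum>i\<in>UNIV. real (nat \<bar>n i\<bar>)) / K\<^sup>2 \<le> (\<Sum>i\<in>UNIV. (of_int (n i))\<^sup>2) / K\<^sup>2"
      by (rule divide_right_mono) simp
    then have "(\<Sum>i\<in>UNIV. real (nat \<bar>n i\<bar>)) / K\<^sup>2 \<le> (norm (\<phi> n))\<^sup>2"
      using 1 unfolding 2 by (rule order_trans)
    then have "c * ((\<Sum>i\<in>UNIV. real (nat \<bar>n i\<bar>)) / K\<^sup>2) \<le> c * (norm (\<phi> n))\<^sup>2"
      using c by (intro mult_left_mono) auto
    then have "- c * (norm (\<phi> n))\<^sup>2 \<le> (\<Sum>i\<in>UNIV. real (nat \<bar>n i\<bar>)) * - (c / K\<^sup>2)"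
      by (simp add: mult.commute)
    then have "exp (- c * (norm (\<phi> n))\<^sup>2) \<le> exp (\<Sum>i\<in>UNIV. real (nat \<bar>n i\<bar>) * - (c / K\<^sup>2))"
      unfolding sum_distrib_right[symmetric] by (simp only: exp_le_cancel_iff)
    also have "\<dots> = (\<Prod>i\<in>UNIV. r ^ nat \<bar>n i\<bar>)"
      unfolding r_def by (simp only: exp_sum[OF finite] exp_of_nat_mult)
    finally show ?thesis .
  qed
  then have "(\<lambda>n. exp (- c * (norm (\<phi> n))\<^sup>2)) summable_on UNIV"
    by (intro summable_on_comparison_test[OF summable_on_prod_power_abs[OF r]]) auto
  then show ?thesis using summable_on_reindex_bij_betw[OF bij, of "\<lambda>l. exp (- c * (norm l)\<^sup>2)"] by simp
qed

text \<open>Bounds a Gaussian with shifted centre by a constant times one centred at 0 with half the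
  rate.\<close>

lemma norm_add_square_ge: "(norm (x + y))\<^sup>2 \<ge> (norm y)\<^sup>2 / 2 - (norm x)\<^sup>2"
  for x :: "'a::real_normed_vector"
proof -
  have "norm y \<le> norm (x + y) + norm x" using norm_triangle_ineq4[of "x + y" x] by simp
  then have "(norm y)\<^sup>2 \<le> (norm (x + y) + norm x)\<^sup>2" by (intro power_mono) auto
  moreover have "(norm (x + y) + norm x)\<^sup>2 \<le> 2 * (norm (x + y))\<^sup>2 + 2 * (norm x)\<^sup>2"
    using sum_squares_bound[of "norm (x + y)" "norm x"] by (simp add: power2_sum)
  ultimately show ?thesis by linarith
qed

text \<open>The sum is \<Lambda>-periodic in x, so x may be assumed to lie within R of 0; hence the
  uniform bound.\<close>

lemma lattice_gauss_translate_bound: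
  fixes \<Lambda> :: "(real^'n) set"
  assumes lat: "full_lattice \<Lambda>" and c: "c > 0"
  obtains C where "C > 0" "\<And>x. (\<lambda>l. exp (- c * (norm (x + l))\<^sup>2)) summable_on \<Lambda>"
    "\<And>x. (\<Sum>\<^sub>\<infinity>l\<in>\<Lambda>. exp (- c * (norm (x + l))\<^sup>2)) \<le> C"
proof -
  obtain R where R: "R > 0" "\<And>x. \<exists>k\<in>\<Lambda>. norm (x - k) \<le> R"
    by (rule full_lattice_covering[OF lat]) (rule that)
  let ?g = "\<lambda>l :: real^'n. exp (c * R\<^sup>2) * exp (- (c / 2) * (norm l)\<^sup>2)"
  have sg: "?g summable_on \<Lambda>"
    by (intro summable_on_cmult_right lattice_gauss_summable[OF lat]) (use c in auto)
  have main: "(\<lambda>l. exp (- c * (norm (x + l))\<^sup>2)) summable_on \<Lambda> \<and> (\<Sum>\<^sub>\<infinity>l\<in>\<Lambda>. exp (- c * (norm (x + l))\<^sup>2)) \<le> infsum ?g \<Lambda>" for x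
  proof -
    obtain k where k: "k \<in> \<Lambda>" "norm (x - k) \<le> R" using R(2) by blast
    have le: "exp (- c * (norm (x - k + l))\<^sup>2) \<le> ?g l" for l
    proof -
      have "(norm (x - k))\<^sup>2 \<le> R\<^sup>2" using k(2) by (intro power_mono) auto
      then have "(norm l)\<^sup>2 / 2 - R\<^sup>2 \<le> (norm (x - k + l))\<^sup>2" using norm_add_square_ge[of l "x - k"] by linarith
      then have "c * ((norm l)\<^sup>2 / 2 - R\<^sup>2) \<le> c * (norm (x - k + l))\<^sup>2" using c by (intro mult_left_mono) auto
      then show ?thesis by (simp add: exp_add[symmetric] algebra_simps)
    qed
    have bij: "bij_betw (\<lambda>l. l - k) \<Lambda> \<Lambda>"
      by (rule bij_betw_byWitness[where f' = "\<lambda>l. l + k"])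
        (use full_lattice_subgroup[OF lat] k(1) in auto)
    have s1: "(\<lambda>l. exp (- c * (norm (x - k + l))\<^sup>2)) summable_on \<Lambda>"
      by (rule summable_on_comparison_test[OF sg le]) auto
    moreover have "(\<Sum>\<^sub>\<infinity>l\<in>\<Lambda>. exp (- c * (norm (x - k + l))\<^sup>2)) \<le> infsum ?g \<Lambda>"
      by (rule infsum_mono[OF s1 sg le])
    ultimately show ?thesis
      using summable_on_reindex_bij_betw[OF bij, of "\<lambda>l. exp (- c * (norm (x + l))\<^sup>2)"]
        infsum_reindex_bij_betw[OF bij, of "\<lambda>l. exp (- c * (norm (x + l))\<^sup>2)"]
      by (simp add: algebra_simps)
  qed
  show thesis
  proof (rule that[of "infsum ?g \<Lambda> + 1"])
    have "infsum ?g \<Lambda> \<ge> 0" by (intro infsum_nonneg) auto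
    then show "infsum ?g \<Lambda> + 1 > 0" by simp
    show "(\<lambda>l. exp (- c * (norm (x + l))\<^sup>2)) summable_on \<Lambda>"
      "(\<Sum>\<^sub>\<infinity>l\<in>\<Lambda>. exp (- c * (norm (x + l))\<^sup>2)) \<le> infsum ?g \<Lambda> + 1" for x
      using main[of x] by auto
  qed
qed

text \<open>Riemann's conditions, with even values of E instead of integral ones: this makes
  \<open>automorphy\<close> a cocycle without a semicharacter.\<close>

locale polarized_torus =
  fixes \<Lambda> :: "(real^'n) set" and J E :: "real^'n^'n"
  assumes lat: "full_lattice \<Lambda>" and J: "J ** J = - mat 1"
    and skew: "transpose E = - E" and compatible: "transpose J ** E ** J = E"
    and positive: "x \<noteq> 0 \<Longrightarrow> (J *v x) \<bullet> (E *v x) > 0"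
    and even_integral: "l \<in> \<Lambda> \<Longrightarrow> l' \<in> \<Lambda> \<Longrightarrow> \<exists>k::int. l \<bullet> (E *v l') = 2 * of_int k"
begin

text \<open>The hermitian form with imaginary part E, complex linear in its first argument.\<close>

definition H :: "real^'n \<Rightarrow> real^'n \<Rightarrow> complex" where
  "H x y = Complex ((J *v x) \<bullet> (E *v y)) (x \<bullet> (E *v y))"

definition q :: "real^'n \<Rightarrow> real" where "q x = (J *v x) \<bullet> (E *v x)"

lemma JJ: "J *v (J *v x) = - x"
  by (simp add: matrix_vector_mul_assoc J bounded_bilinear.minus_left[OF bounded_bilinear_matrix_vector_mult])

lemma E_skew: "y \<bullet> (E *v x) = - (x \<bullet> (E *v y))"
proof -
  have "y \<bullet> (E *v x) = (transpose E *v y) \<bullet> x"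
    by (simp add: dot_lmul_matrix)
  then show ?thesis
    unfolding skew by (simp add: bounded_bilinear.minus_left[OF bounded_bilinear_matrix_vector_mult] inner_commute)
qed

lemma E_J: "(J *v x) \<bullet> (E *v (J *v y)) = x \<bullet> (E *v y)"
proof -
  have "(J *v x) \<bullet> (E *v (J *v y)) = x \<bullet> ((transpose J ** E ** J) *v y)"
    by (simp add: matrix_vector_mul_assoc[symmetric] inner_vector_matrix_mult)
  then show ?thesis by (simp add: compatible)
qed

lemma H_add_left: "H (x + y) z = H x z + H y z"
  and H_add_right: "H z (x + y) = H z x + H z y"
  and H_diff_left: "H (x - y) z = H x z - H y z"
  and H_diff_right: "H z (x - y) = H z x - H z y"
  and H_scale_left: "H (c *\<^sub>R x) z = of_real c * H x z"
  and H_scale_right: "H z (c *\<^sub>R x) = of_real c * H z x"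
  and H_zero_right: "H z 0 = 0"
  by (simp_all add: H_def complex_eq_iff matrix_vector_right_distrib matrix_vector_mult_diff_distrib inner_add inner_diff
      linear_scale[OF matrix_vector_mul_linear] linear_neg[OF matrix_vector_mul_linear])

lemma H_J: "H (J *v x) y = \<i> * H x y"
  by (simp add: H_def complex_eq_iff JJ)

lemma H_cnj: "H y x = cnj (H x y)"
proof -
  have "(J *v y) \<bullet> (E *v x) = - (x \<bullet> (E *v (J *v y)))" by (rule E_skew)
  also have "\<dots> = - ((J *v x) \<bullet> (E *v (J *v (J *v y))))" by (simp add: E_J)
  also have "\<dots> = (J *v x) \<bullet> (E *v y)" by (simp add: JJ linear_neg[OF matrix_vector_mul_linear])
  finally show ?thesis by (simp add: H_def complex_eq_iff E_skew[of y x])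
qed

lemma H_self: "H x x = of_real (q x)"
  using E_skew[of x x] by (simp add: H_def q_def complex_eq_iff)

lemma q_nonneg: "q x \<ge> 0"
  using positive[of x] by (cases "x = 0") (auto simp: q_def)

lemma q_scale: "q (c *\<^sub>R x) = c\<^sup>2 * q x"
  by (simp add: q_def linear_scale[OF matrix_vector_mul_linear] power2_eq_square)

lemma q_add: "q (x + y) = q x + q y + 2 * Re (H x y)"
  and q_diff: "q (x - y) = q x + q y - 2 * Re (H x y)"
proof -
  have "of_real (q (x + y)) = H x x + H y y + (H x y + cnj (H x y))"
    unfolding H_self[symmetric] by (simp add: H_add_left H_add_right H_cnj[of x y])
  also have "\<dots> = of_real (q x + q y + 2 * Re (H x y))" by (simp add: H_self complex_add_cnj)
  finally show "q (x + y) = q x + q y + 2 * Re (H x y)" by (simp only: of_real_eq_iff)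
  have "of_real (q (x - y)) = H x x + H y y - (H x y + cnj (H x y))"
    unfolding H_self[symmetric] by (simp add: H_diff_left H_diff_right H_cnj[of x y])
  also have "\<dots> = of_real (q x + q y - 2 * Re (H x y))" by (simp add: H_self complex_add_cnj)
  finally show "q (x - y) = q x + q y - 2 * Re (H x y)" by (simp only: of_real_eq_iff)
qed

lemma continuous_q: "continuous_on S q"
  unfolding q_def by (intro continuous_intros)

lemma q_lower: obtains c where "c > 0" "\<And>x. c * (norm x)\<^sup>2 \<le> q x"
proof -
  have "compact (sphere (0::real^'n) 1)" "sphere (0::real^'n) 1 \<noteq> {}" by simp_all
  then obtain x0 where x0: "x0 \<in> sphere 0 1" "\<And>y. y \<in> sphere 0 1 \<Longrightarrow> q x0 \<le> q y"
    using continuous_attains_inf[OF _ _ continuous_q] by metis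
  have "q x0 * (norm x)\<^sup>2 \<le> q x" for x
  proof (cases "x = 0")
    case False
    have "q x0 \<le> q ((1 / norm x) *\<^sub>R x)" using False by (intro x0(2)) simp
    also have "\<dots> = (1 / norm x)\<^sup>2 * q x" by (rule q_scale)
    finally show ?thesis using False by (simp add: power_divide field_simps)
  qed (simp add: q_def)
  moreover have "x0 \<noteq> 0" using x0(1) by auto
  then have "q x0 > 0" using positive by (simp add: q_def)
  ultimately show thesis using that by blast
qed

lemma bounded_bilinear_H: "bounded_bilinear H"
  unfolding bilinear_conv_bounded_bilinear[symmetric] bilinear_def
  by (auto intro!: linearI simp: H_add_left H_add_right H_scale_left H_scale_right scaleR_conv_of_real[of _ "_ :: complex"])

lemma H_bound: obtains h where "h > 0" "\<And>x y. cmod (H x y) \<le> h * norm x * norm y"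
  using bounded_bilinear.pos_bounded[OF bounded_bilinear_H] by (metis mult.assoc mult.commute)

text \<open>The summands of the Poincare series of the coherent state centred at \<open>a\<close>, for the factor of
  automorphy \<open>automorphy m\<close>.\<close>

definition kern :: "nat \<Rightarrow> real^'n \<Rightarrow> real^'n \<Rightarrow> real^'n \<Rightarrow> complex" where
  "kern m a l z = exp (of_real (real m * pi) * (- H z l - H l l / 2 + H (z + l) a - H a a / 2))"

definition automorphy :: "nat \<Rightarrow> real^'n \<Rightarrow> real^'n \<Rightarrow> complex" where
  "automorphy m l z = exp (of_real (real m * pi) * (H z l + H l l / 2))"

text \<open>The modulus of \<open>automorphy m l z\<close> is
  \<open>weight m (z + l) / weight m z\<close>, so the modulus of a theta function divided by
  \<open>weight\<close> is \<Lambda>-periodic. All estimates are relative to it.\<close>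

definition weight :: "nat \<Rightarrow> real^'n \<Rightarrow> real" where
  "weight m z = exp (real m * pi / 2 * q z)"

definition state :: "nat \<Rightarrow> real^'n \<Rightarrow> real^'n \<Rightarrow> complex" where
  "state m a z = (\<Sum>\<^sub>\<infinity>l\<in>\<Lambda>. kern m a l z)"

text \<open>Completing the square: relative to \<open>weight\<close>, the summand for l is a
  Gaussian bump around a - l.\<close>

lemma norm_kern: "cmod (kern m a l z) = weight m z * exp (- (real m * pi / 2) * q (z + l - a))"
proof -
  have "q (z + l - a) = q z + q l + 2 * Re (H z l) + q a - 2 * Re (H (z + l) a)"
    by (simp add: q_diff q_add)
  then have "Re (- H z l - H l l / 2 + H (z + l) a - H a a / 2) = (q z - q (z + l - a)) / 2"
    by (simp add: H_self field_simps)
  then have "cmod (kern m a l z) = exp (real m * pi * ((q z - q (z + l - a)) / 2))"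
    unfolding kern_def norm_exp_eq_Re by simp
  also have "\<dots> = weight m z * exp (- (real m * pi / 2) * q (z + l - a))"
    by (simp add: weight_def exp_add[symmetric] field_simps)
  finally show ?thesis .
qed

text \<open>Besides the expected terms the exponents differ by m pi (H l k - H k l) / 2, a multiple
  of 2 pi \<i> because E is even on \<Lambda>.\<close>

lemma kern_translate:
  assumes "l \<in> \<Lambda>" "k \<in> \<Lambda>"
  shows "kern m a l (z + k) = automorphy m k z * kern m a (l + k) z"
proof -
  obtain j :: int where j: "k \<bullet> (E *v l) = 2 * of_int j" using even_integral[OF assms(2,1)] by blast
  have d: "H l k - H k l = - (of_int (4 * j) * \<i>)"
    using j by (simp add: H_cnj[of l k] complex_eq_iff) (simp add: H_def E_skew[of l k])
  have eq: "of_real (real m * pi) * (- H (z + k) l - H l l / 2 + H (z + k + l) a - H a a / 2) =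
     of_real (real m * pi) * (H z k + H k k / 2) +
     of_real (real m * pi) * (- H z (l + k) - H (l + k) (l + k) / 2 + H (z + (l + k)) a - H a a / 2)
     + of_real (real m * pi) * ((H l k - H k l) / 2)"
    by (simp add: H_add_left H_add_right field_simps)
  have "exp (of_real (real m * pi) * ((H l k - H k l) / 2)) = exp (2 * of_int (- j * int m) * of_real pi * \<i>)"
    unfolding d by (simp add: mult_ac)
  also have "\<dots> = 1" using exp_integer_2pi[of "of_int (- j * int m)"] by simp
  finally show ?thesis unfolding kern_def automorphy_def eq exp_add by simp
qed

lemma kern_derivative:
  "((\<lambda>z. kern m a l z) has_derivative (\<lambda>v. of_real (real m * pi) * H v (a - l) * kern m a l z)) (at z)"
proof -
  have bl: "bounded_linear (\<lambda>v. H v y)" for y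
    by (rule bounded_bilinear.bounded_linear_left[OF bounded_bilinear_H])
  have "((\<lambda>z. of_real (real m * pi) * (- H z l - H l l / 2 + H (z + l) a - H a a / 2)) has_derivative
     (\<lambda>v. of_real (real m * pi) * H v (a - l))) (at z)"
    by (auto intro!: derivative_eq_intros bounded_linear.has_derivative[OF bl] simp: H_diff_right algebra_simps)
  then have "((\<lambda>z. kern m a l z) has_derivative (\<lambda>v. exp (of_real (real m * pi) * (- H z l - H l l / 2 + H (z + l) a - H a a / 2)) *
      (of_real (real m * pi) * H v (a - l)))) (at z)"
    unfolding kern_def by (rule has_derivative_compose) (rule DERIV_exp[unfolded has_field_derivative_def])
  then show ?thesis by (simp add: kern_def mult.commute)
qed


text \<open>Of the m equal parts of the Gaussian exponent, m - 2 give the decay in \<tau>, one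
  absorbs the factor 1 + norm, and one makes the lattice sum converge. Hence C does not depend on m,
  a or p. The factor 1 + norm is there for the derivatives.\<close>

lemma kern_sum_bound:
  obtains C where "C > 0"
    "\<And>m a p L \<tau>. 2 \<le> m \<Longrightarrow> L \<subseteq> \<Lambda> \<Longrightarrow> \<forall>l\<in>L. \<tau> \<le> q (p + l - a) \<Longrightarrow>
      (\<lambda>l. (1 + norm (p + l - a)) * cmod (kern m a l p)) summable_on L \<and>
      (\<Sum>\<^sub>\<infinity>l\<in>L. (1 + norm (p + l - a)) * cmod (kern m a l p))
        \<le> weight m p * (C * exp (- ((real m - 2) * pi / 2) * \<tau>))"
proof -
  obtain c where c: "c > 0" "\<And>x. c * (norm x)\<^sup>2 \<le> q x" by (rule q_lower) (rule that)
  define \<kappa> where "\<kappa> = pi / 2 * c"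
  have \<kappa>: "\<kappa> > 0" using c by (simp add: \<kappa>_def)
  obtain C0 where C0: "C0 > 0" "\<And>x. (\<lambda>l. exp (- \<kappa> * (norm (x + l))\<^sup>2)) summable_on \<Lambda>"
    "\<And>x. (\<Sum>\<^sub>\<infinity>l\<in>\<Lambda>. exp (- \<kappa> * (norm (x + l))\<^sup>2)) \<le> C0"
    by (rule lattice_gauss_translate_bound[OF lat \<kappa>]) (rule that)
  define K where "K = 2 + 1 / \<kappa>"
  have K: "K > 0" using \<kappa> by (simp add: K_def add_pos_pos)
  have poly: "1 + norm y \<le> K * exp (pi / 2 * q y)" for y :: "real^'n"
  proof -
    have "2 * norm y \<le> (norm y)\<^sup>2 + 1" using sum_squares_bound[of "norm y" 1] by simp
    then have "norm y \<le> 1 + (norm y)\<^sup>2" using zero_le_power2[of "norm y"] by linarith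
    moreover have u: "\<kappa> * (norm y)\<^sup>2 \<le> pi / 2 * q y" using c(2)[of y] by (simp add: \<kappa>_def mult.assoc)
    moreover have "(norm y)\<^sup>2 = (1 / \<kappa>) * (\<kappa> * (norm y)\<^sup>2)" using \<kappa> by simp
    moreover have "(1 / \<kappa>) * (\<kappa> * (norm y)\<^sup>2) \<le> (1 / \<kappa>) * exp (pi / 2 * q y)"
    proof (rule mult_left_mono)
      show "\<kappa> * (norm y)\<^sup>2 \<le> exp (pi / 2 * q y)"
        using u exp_ge_add_one_self[of "pi / 2 * q y"] by linarith
    qed (use \<kappa> in simp)
    moreover have "1 \<le> exp (pi / 2 * q y)" using q_nonneg[of y] by simp
    ultimately show ?thesis unfolding K_def distrib_right by linarith
  qed
  show thesis
  proof (rule that[of "K * C0"])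
    show "K * C0 > 0" using K C0 by simp
    fix m a p L \<tau> assume m: "2 \<le> (m::nat)" and L: "L \<subseteq> \<Lambda>" and far: "\<forall>l\<in>L. \<tau> \<le> q (p + l - a)"
    let ?e = "exp (- ((real m - 2) * pi / 2) * \<tau>)"
    have le: "(1 + norm (p + l - a)) * cmod (kern m a l p) \<le> weight m p * K * ?e * exp (- \<kappa> * (norm ((p - a) + l))\<^sup>2)"
      if l: "l \<in> L" for l
    proof -
      let ?y = "p + l - a"
      have "cmod (kern m a l p) = weight m p * (exp (- ((real m - 2) * pi / 2) * q ?y) * exp (- (pi * q ?y)))"
        unfolding norm_kern mult_exp_exp by (simp add: field_simps)
      also have "exp (- ((real m - 2) * pi / 2) * q ?y) \<le> ?e"
      proof -
        have "(real m - 2) * pi / 2 * \<tau> \<le> (real m - 2) * pi / 2 * q ?y"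
          using m far l by (intro mult_left_mono) auto
        then show ?thesis by simp
      qed
      finally have k: "cmod (kern m a l p) \<le> weight m p * (?e * exp (- (pi * q ?y)))"
        by (simp add: weight_def)
      have "(1 + norm ?y) * cmod (kern m a l p) \<le> (K * exp (pi / 2 * q ?y)) * (weight m p * (?e * exp (- (pi * q ?y))))"
        using K by (intro mult_mono poly k) auto
      also have "\<dots> = weight m p * K * ?e * (exp (pi / 2 * q ?y) * exp (- (pi * q ?y)))"
        by (simp add: mult_ac)
      also have "exp (pi / 2 * q ?y) * exp (- (pi * q ?y)) = exp (- (pi / 2 * q ?y))"
        unfolding mult_exp_exp by simp
      also have "\<dots> \<le> exp (- \<kappa> * (norm ((p - a) + l))\<^sup>2)"
        using c(2)[of ?y] by (simp add: \<kappa>_def mult.assoc algebra_simps)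
      finally show ?thesis using K by (simp add: weight_def mult_left_mono)
    qed
    have s: "(\<lambda>l. weight m p * K * ?e * exp (- \<kappa> * (norm ((p - a) + l))\<^sup>2)) summable_on L"
      by (intro summable_on_cmult_right summable_on_subset_banach[OF C0(2) L])
    have s': "(\<lambda>l. (1 + norm (p + l - a)) * cmod (kern m a l p)) summable_on L"
      by (rule summable_on_comparison_test[OF s le]) auto
    have "(\<Sum>\<^sub>\<infinity>l\<in>L. exp (- \<kappa> * (norm ((p - a) + l))\<^sup>2)) \<le> (\<Sum>\<^sub>\<infinity>l\<in>\<Lambda>. exp (- \<kappa> * (norm ((p - a) + l))\<^sup>2))"
      by (rule infsum_mono_neutral[OF summable_on_subset_banach[OF C0(2) L] C0(2)]) (use L in auto)
    also have "\<dots> \<le> C0" by (rule C0(3))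
    finally have C: "(\<Sum>\<^sub>\<infinity>l\<in>L. exp (- \<kappa> * (norm ((p - a) + l))\<^sup>2)) \<le> C0" .
    have "(\<Sum>\<^sub>\<infinity>l\<in>L. (1 + norm (p + l - a)) * cmod (kern m a l p))
        \<le> (\<Sum>\<^sub>\<infinity>l\<in>L. weight m p * K * ?e * exp (- \<kappa> * (norm ((p - a) + l))\<^sup>2))"
      by (rule infsum_mono[OF s' s le])
    also have "\<dots> = weight m p * K * ?e * (\<Sum>\<^sub>\<infinity>l\<in>L. exp (- \<kappa> * (norm ((p - a) + l))\<^sup>2))"
      by (rule infsum_cmult_right')
    also have "\<dots> \<le> weight m p * K * ?e * C0" using K C by (intro mult_left_mono) (auto simp: weight_def)
    finally show "(\<lambda>l. (1 + norm (p + l - a)) * cmod (kern m a l p)) summable_on L \<and>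
      (\<Sum>\<^sub>\<infinity>l\<in>L. (1 + norm (p + l - a)) * cmod (kern m a l p)) \<le> weight m p * (K * C0 * ?e)"
      using s' by (simp add: mult_ac)
  qed
qed

text \<open>Termwise differentiation needs a majorant valid on a whole ball around z. One factor 1 +
  norm l pays for coefficients of linear growth, the other for the derivative of
  \<open>kern\<close>.\<close>

lemma kern_local_majorant:
  assumes m: "m \<ge> 1"
  obtains D \<kappa> where "D > 0" "\<kappa> > 0"
    "\<And>l y. norm (y - z) \<le> 1 \<Longrightarrow> (1 + norm l)\<^sup>2 * cmod (kern m a l y) \<le> D * exp (- \<kappa> * (norm l)\<^sup>2)"
proof -
  obtain c where c: "c > 0" "\<And>x. c * (norm x)\<^sup>2 \<le> q x" by (rule q_lower) (rule that)
  define \<mu> where "\<mu> = real m * pi / 2"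
  have \<mu>: "\<mu> > 0" using m by (simp add: \<mu>_def)
  have "compact (weight m ` cball z 1)" unfolding weight_def
    by (intro compact_continuous_image continuous_intros continuous_q) auto
  then have "bounded (weight m ` cball z 1)" by (rule compact_imp_bounded)
  then obtain W where W: "\<forall>y\<in>weight m ` cball z 1. norm y \<le> W"
    unfolding bounded_iff by (elim exE) (rule that)
  have W': "weight m y \<le> W" if "norm (y - z) \<le> 1" for y
  proof -
    have "y \<in> cball z 1" using that by (simp add: dist_norm norm_minus_commute)
    then have "norm (weight m y) \<le> W" by (rule bspec[OF W imageI])
    then show ?thesis by simp
  qed
  have Wpos: "W > 0" using less_le_trans[OF _ W'[of z], of 0] by (simp add: weight_def)
  define R where "R = 1 + norm (z - a)"
  define \<kappa> where "\<kappa> = \<mu> * c / 4"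
  have \<kappa>: "\<kappa> > 0" using \<mu> c by (simp add: \<kappa>_def)
  define D where "D = (2 + 2 / \<kappa>) * (W * exp (\<mu> * c * R\<^sup>2))"
  have "(1 + norm l)\<^sup>2 * cmod (kern m a l y) \<le> D * exp (- \<kappa> * (norm l)\<^sup>2)" if y: "norm (y - z) \<le> 1" for l y
  proof -
    let ?t = "(norm l)\<^sup>2"
    have "norm (y - a) \<le> R" using y norm_triangle_ineq[of "y - z" "z - a"] by (simp add: R_def)
    then have "(norm (y - a))\<^sup>2 \<le> R\<^sup>2" by (intro power_mono) auto
    then have "?t / 2 - R\<^sup>2 \<le> (norm ((y - a) + l))\<^sup>2" using norm_add_square_ge[of l "y - a"] by linarith
    then have "c * (?t / 2 - R\<^sup>2) \<le> c * (norm ((y - a) + l))\<^sup>2" using c(1) by (intro mult_left_mono) auto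
    also have "\<dots> \<le> q (y + l - a)" using c(2)[of "(y - a) + l"] by (simp add: algebra_simps)
    finally have "\<mu> * (c * (?t / 2 - R\<^sup>2)) \<le> \<mu> * q (y + l - a)" using \<mu> by (intro mult_left_mono) auto
    then have "exp (- \<mu> * q (y + l - a)) \<le> exp (\<mu> * c * R\<^sup>2 + - (2 * \<kappa>) * ?t)"
      by (simp add: \<kappa>_def algebra_simps)
    then have k: "cmod (kern m a l y) \<le> W * (exp (\<mu> * c * R\<^sup>2) * exp (- (2 * \<kappa>) * ?t))"
      unfolding norm_kern \<mu>_def[symmetric] mult_exp_exp using W'[OF y] Wpos by (intro mult_mono) auto
    have "(1 + norm l)\<^sup>2 \<le> 2 + 2 * ?t"
      using sum_squares_bound[of 1 "norm l"] by (simp add: power2_sum)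
    also have "\<dots> \<le> (2 + 2 / \<kappa>) * exp (\<kappa> * ?t)"
    proof -
      have "0 \<le> \<kappa> * ?t" using \<kappa> by simp
      then have "1 \<le> exp (\<kappa> * ?t)" "\<kappa> * ?t \<le> exp (\<kappa> * ?t)"
        using exp_ge_add_one_self[of "\<kappa> * ?t"] by linarith+
      moreover from this(2) have "2 / \<kappa> * (\<kappa> * ?t) \<le> 2 / \<kappa> * exp (\<kappa> * ?t)"
        using \<kappa> by (intro mult_left_mono) auto
      moreover have "2 / \<kappa> * (\<kappa> * ?t) = 2 * ?t" using \<kappa> by simp
      ultimately show ?thesis unfolding distrib_right by linarith
    qed
    finally have "(1 + norm l)\<^sup>2 * cmod (kern m a l y) \<le>
        ((2 + 2 / \<kappa>) * exp (\<kappa> * ?t)) * (W * (exp (\<mu> * c * R\<^sup>2) * exp (- (2 * \<kappa>) * ?t)))"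
      using \<kappa> by (intro mult_mono k) (auto intro!: mult_nonneg_nonneg add_nonneg_nonneg)
    also have "\<dots> = D * (exp (\<kappa> * ?t) * exp (- (2 * \<kappa>) * ?t))" by (simp add: D_def mult_ac)
    also have "exp (\<kappa> * ?t) * exp (- (2 * \<kappa>) * ?t) = exp (- \<kappa> * ?t)" unfolding mult_exp_exp by simp
    finally show ?thesis .
  qed
  moreover have "D > 0" using Wpos \<kappa> by (simp add: D_def add_pos_pos)
  ultimately show thesis using that \<kappa> by blast
qed

lemma kern_series:
  assumes m: "m \<ge> 1" and w: "\<And>l. cmod (w l) \<le> B * (1 + norm l)"
  shows "(\<lambda>l. w l * kern m a l z) summable_on \<Lambda>"
    and "((\<lambda>z. \<Sum>\<^sub>\<infinity>l\<in>\<Lambda>. w l * kern m a l z) has_derivative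
      (\<lambda>v. \<Sum>\<^sub>\<infinity>l\<in>\<Lambda>. w l * (of_real (real m * pi) * H v (a - l) * kern m a l z))) (at z)"
proof -
  obtain D \<kappa> where D: "D > 0" "\<kappa> > 0"
    "\<And>l y. norm (y - z) \<le> 1 \<Longrightarrow> (1 + norm l)\<^sup>2 * cmod (kern m a l y) \<le> D * exp (- \<kappa> * (norm l)\<^sup>2)"
    by (rule kern_local_majorant[OF m]) (rule that)
  obtain h where h: "h > 0" "\<And>x y. cmod (H x y) \<le> h * norm x * norm y" by (rule H_bound) (rule that)
  have B: "B \<ge> 0" using order_trans[OF norm_ge_zero w[of 0]] by simp
  have gs: "(\<lambda>l. x * exp (- \<kappa> * (norm l)\<^sup>2)) summable_on \<Lambda>" for x
    by (intro summable_on_cmult_right lattice_gauss_summable[OF lat D(2)])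
  show 1: "(\<lambda>l. w l * kern m a l z) summable_on \<Lambda>"
  proof (rule summable_on_dominated(2)[OF gs[of "B * D"]])
    fix l :: "real^'n"
    have "1 * (1 + norm l) \<le> (1 + norm l) * (1 + norm l)" by (intro mult_right_mono) auto
    then have "1 + norm l \<le> (1 + norm l)\<^sup>2" by (simp add: power2_eq_square)
    then have "cmod (w l * kern m a l z) \<le> (B * (1 + norm l)\<^sup>2) * cmod (kern m a l z)"
      unfolding norm_mult using w[of l] B by (intro mult_right_mono) (auto intro: order_trans mult_left_mono)
    also have "\<dots> \<le> B * (D * exp (- \<kappa> * (norm l)\<^sup>2))"
      unfolding mult.assoc using D(3)[of z l] B by (intro mult_left_mono) auto
    finally show "cmod (w l * kern m a l z) \<le> B * D * exp (- \<kappa> * (norm l)\<^sup>2)" by (simp add: mult.assoc)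
  qed
  let ?M = "B * (real m * pi) * h * (1 + norm a) * D"
  show "((\<lambda>z. \<Sum>\<^sub>\<infinity>l\<in>\<Lambda>. w l * kern m a l z) has_derivative
      (\<lambda>v. \<Sum>\<^sub>\<infinity>l\<in>\<Lambda>. w l * (of_real (real m * pi) * H v (a - l) * kern m a l z))) (at z)"
  proof (rule has_derivative_infsum[where r = 1 and f = "\<lambda>l z. w l * kern m a l z"
        and M = "\<lambda>l. ?M * exp (- \<kappa> * (norm l)\<^sup>2)"
        and f' = "\<lambda>l z v. w l * (of_real (real m * pi) * H v (a - l) * kern m a l z)"])
    show "(\<lambda>l. ?M * exp (- \<kappa> * (norm l)\<^sup>2)) summable_on \<Lambda>" by (rule gs)
    show "(\<lambda>l. w l * kern m a l z) summable_on \<Lambda>" by (rule 1)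
    show "((\<lambda>z. w l * kern m a l z) has_derivative
        (\<lambda>v. w l * (of_real (real m * pi) * H v (a - l) * kern m a l y))) (at y)" for l y
      by (intro has_derivative_mult_right kern_derivative)
    fix l y v :: "real^'n" assume "y \<in> ball z 1"
    then have y: "norm (y - z) \<le> 1" by (simp add: dist_norm norm_minus_commute)
    have "norm (a - l) \<le> norm a + norm l" by (rule norm_triangle_ineq4)
    also have "\<dots> \<le> (1 + norm a) * (1 + norm l)" by (simp add: algebra_simps)
    finally have al: "norm (a - l) \<le> (1 + norm a) * (1 + norm l)" .
    have "cmod (H v (a - l)) \<le> h * norm v * ((1 + norm a) * (1 + norm l))"
      by (rule order_trans[OF h(2)]) (intro mult_left_mono al mult_nonneg_nonneg; use h(1) in simp)
    then have "cmod (w l) * (real m * pi * cmod (H v (a - l)) * cmod (kern m a l y))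
      \<le> (B * (1 + norm l)) * (real m * pi * (h * norm v * ((1 + norm a) * (1 + norm l))) * cmod (kern m a l y))"
      using w[of l] by (intro mult_mono mult_right_mono mult_left_mono mult_nonneg_nonneg) (use h(1) B in auto)
    also have "\<dots> = (B * (real m * pi) * h * (1 + norm a)) * norm v * ((1 + norm l)\<^sup>2 * cmod (kern m a l y))"
      by (simp add: power2_eq_square mult_ac)
    also have "\<dots> \<le> (B * (real m * pi) * h * (1 + norm a)) * norm v * (D * exp (- \<kappa> * (norm l)\<^sup>2))"
      using D(3)[OF y, of l] B h(1) by (intro mult_left_mono mult_nonneg_nonneg) auto
    finally show "norm (w l * (of_real (real m * pi) * H v (a - l) * kern m a l y)) \<le> ?M * exp (- \<kappa> * (norm l)\<^sup>2) * norm v"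
      by (simp add: norm_mult mult_ac)
  qed simp
qed

lemma state_derivative:
  assumes "m \<ge> 1"
  shows "(state m a has_derivative (\<lambda>v. \<Sum>\<^sub>\<infinity>l\<in>\<Lambda>. of_real (real m * pi) * H v (a - l) * kern m a l z)) (at z)"
  using kern_series(2)[OF assms, of "\<lambda>_. 1" 1 a z] by (simp add: state_def[abs_def])

lemma H_affine_bound:
  obtains B where "\<And>l. cmod (of_real c * H v (a - l)) \<le> B * (1 + norm l)"
proof -
  obtain h where h: "h > 0" "\<And>x y. cmod (H x y) \<le> h * norm x * norm y" by (rule H_bound) (rule that)
  have "cmod (of_real c * H v (a - l)) \<le> (\<bar>c\<bar> * h * norm v * (1 + norm a)) * (1 + norm l)" for l
  proof -
    have "norm (a - l) \<le> norm a + norm l" by (rule norm_triangle_ineq4)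
    also have "\<dots> \<le> (1 + norm a) * (1 + norm l)" by (simp add: algebra_simps)
    finally have "h * norm v * norm (a - l) \<le> h * norm v * ((1 + norm a) * (1 + norm l))"
      using h(1) by (intro mult_left_mono) auto
    with h(2)[of v "a - l"] have "cmod (H v (a - l)) \<le> h * norm v * ((1 + norm a) * (1 + norm l))"
      by (rule order_trans)
    then have "\<bar>c\<bar> * cmod (H v (a - l)) \<le> \<bar>c\<bar> * (h * norm v * ((1 + norm a) * (1 + norm l)))"
      by (rule mult_left_mono) simp
    then show ?thesis by (simp add: norm_mult mult_ac)
  qed
  then show thesis by (rule that)
qed

lemma state_c1_holomorphic:
  assumes m: "m \<ge> 1"
  shows "c1_holomorphic J (state m a)"
proof (rule c1_holomorphicI[OF state_derivative[OF m]])
  show "(\<Sum>\<^sub>\<infinity>l\<in>\<Lambda>. of_real (real m * pi) * H (J *v v) (a - l) * kern m a l x) =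
      \<i> * (\<Sum>\<^sub>\<infinity>l\<in>\<Lambda>. of_real (real m * pi) * H v (a - l) * kern m a l x)" for x v
    by (simp add: H_J infsum_cmult_right'[symmetric] mult_ac)
  fix v
  obtain B where B: "\<And>l. cmod (of_real (real m * pi) * H v (a - l)) \<le> B * (1 + norm l)"
    by (rule H_affine_bound) (rule that)
  show "continuous_on UNIV (\<lambda>x. \<Sum>\<^sub>\<infinity>l\<in>\<Lambda>. of_real (real m * pi) * H v (a - l) * kern m a l x)"
    using kern_series(2)[OF m B, THEN has_derivative_continuous]
    by (intro continuous_at_imp_continuous_on) blast
qed

definition theta :: "nat \<Rightarrow> (real^'n \<Rightarrow> complex) \<Rightarrow> bool" where
  "theta m f \<longleftrightarrow> c1_holomorphic J f \<and> (\<forall>l\<in>\<Lambda>. \<forall>z. f (z + l) = automorphy m l z * f z)"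

lemma theta_state:
  assumes m: "m \<ge> 1"
  shows "theta m (state m a)"
  unfolding theta_def
proof (intro conjI ballI allI state_c1_holomorphic m)
  fix k z assume k: "k \<in> \<Lambda>"
  have bij: "bij_betw (\<lambda>l. l + k) \<Lambda> \<Lambda>"
    by (rule bij_betw_byWitness[where f' = "\<lambda>l. l - k"])
      (use full_lattice_subgroup[OF lat] k in auto)
  have "state m a (z + k) = (\<Sum>\<^sub>\<infinity>l\<in>\<Lambda>. automorphy m k z * kern m a (l + k) z)"
    unfolding state_def by (intro infsum_cong kern_translate k)
  also have "\<dots> = automorphy m k z * (\<Sum>\<^sub>\<infinity>l\<in>\<Lambda>. kern m a (l + k) z)" by (rule infsum_cmult_right')
  also have "(\<Sum>\<^sub>\<infinity>l\<in>\<Lambda>. kern m a (l + k) z) = state m a z"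
    unfolding state_def by (rule infsum_reindex_bij_betw[OF bij])
  finally show "state m a (z + k) = automorphy m k z * state m a z" .
qed

text \<open>The Chern connection of the metric defined by \<open>weight\<close>. At a zero of f it
  is the ordinary derivative.\<close>

definition cov :: "nat \<Rightarrow> (real^'n \<Rightarrow> complex) \<Rightarrow> real^'n \<Rightarrow> real^'n \<Rightarrow> complex" where
  "cov m f p v = frechet_derivative f (at p) v - of_real (real m * pi) * H v p * f p"

text \<open>The correction term turns a - l into the displacement a - p - l, whose length the
  Gaussian controls.\<close>

lemma cov_state:
  assumes m: "m \<ge> 1"
  shows "cov m (state m a) p v = (\<Sum>\<^sub>\<infinity>l\<in>\<Lambda>. of_real (real m * pi) * H v (a - p - l) * kern m a l p)"
    and "(\<lambda>l. of_real (real m * pi) * H v (a - p - l) * kern m a l p) summable_on \<Lambda>"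
proof -
  let ?c = "of_real (real m * pi) :: complex"
  obtain B where B: "\<And>l. cmod (?c * H v (a - p - l)) \<le> B * (1 + norm l)" by (rule H_affine_bound) (rule that)
  show s: "(\<lambda>l. ?c * H v (a - p - l) * kern m a l p) summable_on \<Lambda>" by (rule kern_series(1)[OF m B])
  have s1: "(\<lambda>l. kern m a l p) summable_on \<Lambda>" using kern_series(1)[OF m, of "\<lambda>_. 1" 1] by simp
  have e: "H v (a - l) = H v (a - p - l) + H v p" for l
    using H_add_right[of v "a - p - l" p] by simp
  have "(\<Sum>\<^sub>\<infinity>l\<in>\<Lambda>. ?c * H v (a - l) * kern m a l p)
      = (\<Sum>\<^sub>\<infinity>l\<in>\<Lambda>. ?c * H v (a - p - l) * kern m a l p + ?c * H v p * kern m a l p)"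
    by (intro infsum_cong) (simp only: e distrib_left distrib_right)
  also have "\<dots> = (\<Sum>\<^sub>\<infinity>l\<in>\<Lambda>. ?c * H v (a - p - l) * kern m a l p) + ?c * H v p * state m a p"
    unfolding state_def infsum_cmult_right'[symmetric]
    by (intro infsum_add s summable_on_cmult_right s1)
  finally show "cov m (state m a) p v = (\<Sum>\<^sub>\<infinity>l\<in>\<Lambda>. ?c * H v (a - p - l) * kern m a l p)"
    unfolding cov_def frechet_derivative_at[OF state_derivative[OF m], symmetric] by simp
qed

text \<open>The point p is far from all translates of the centre, or from all except the one for l =
  0, whose contribution is then subtracted. C and h are uniform in m and in all points, as required
  for choosing m large afterwards.\<close>

lemma state_estimates:
  obtains C h where "C > 0" "h > 0"
    "\<forall>m a p \<tau>. 2 \<le> m \<longrightarrow> (\<forall>l\<in>\<Lambda>. \<tau> \<le> q (p + l - a)) \<longrightarrow>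
       cmod (state m a p) \<le> weight m p * (C * exp (- ((real m - 2) * pi / 2) * \<tau>))"
    "\<forall>m a p \<tau>. 2 \<le> m \<longrightarrow> (\<forall>l\<in>\<Lambda> - {0}. \<tau> \<le> q (p + l - a)) \<longrightarrow>
       cmod (state m a p - kern m a 0 p) \<le> weight m p * (C * exp (- ((real m - 2) * pi / 2) * \<tau>))"
    "\<forall>m a p v \<tau>. 2 \<le> m \<longrightarrow> (\<forall>l\<in>\<Lambda>. \<tau> \<le> q (p + l - a)) \<longrightarrow>
       cmod (cov m (state m a) p v) \<le> real m * pi * h * norm v * (weight m p * (C * exp (- ((real m - 2) * pi / 2) * \<tau>)))"
    "\<forall>m a p v \<tau>. 2 \<le> m \<longrightarrow> (\<forall>l\<in>\<Lambda> - {0}. \<tau> \<le> q (p + l - a)) \<longrightarrow>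
       cmod (cov m (state m a) p v - of_real (real m * pi) * H v (a - p) * kern m a 0 p)
         \<le> real m * pi * h * norm v * (weight m p * (C * exp (- ((real m - 2) * pi / 2) * \<tau>)))"
proof -
  obtain h where h: "h > 0" "\<And>x y. cmod (H x y) \<le> h * norm x * norm y" by (rule H_bound) (rule that)
  obtain C where C: "C > 0" and bound: "\<And>m a p L \<tau>. 2 \<le> m \<Longrightarrow> L \<subseteq> \<Lambda> \<Longrightarrow> \<forall>l\<in>L. \<tau> \<le> q (p + l - a) \<Longrightarrow>
      (\<lambda>l. (1 + norm (p + l - a)) * cmod (kern m a l p)) summable_on L \<and>
      (\<Sum>\<^sub>\<infinity>l\<in>L. (1 + norm (p + l - a)) * cmod (kern m a l p))
        \<le> weight m p * (C * exp (- ((real m - 2) * pi / 2) * \<tau>))"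
    by (rule kern_sum_bound) (rule that)
  have A: "cmod (\<Sum>\<^sub>\<infinity>l\<in>L. kern m a l p) \<le> weight m p * (C * exp (- ((real m - 2) * pi / 2) * \<tau>))"
    if "2 \<le> m" "L \<subseteq> \<Lambda>" "\<forall>l\<in>L. \<tau> \<le> q (p + l - a)" for m a p L \<tau>
  proof -
    note b = bound[OF that]
    have "cmod (kern m a l p) \<le> (1 + norm (p + l - a)) * cmod (kern m a l p)" for l
      using mult_right_mono[of 1 "1 + norm (p + l - a)" "cmod (kern m a l p)"] by simp
    then have "cmod (\<Sum>\<^sub>\<infinity>l\<in>L. kern m a l p) \<le> (\<Sum>\<^sub>\<infinity>l\<in>L. (1 + norm (p + l - a)) * cmod (kern m a l p))"
      by (intro summable_on_dominated(3) conjunct1[OF b])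
    then show ?thesis using conjunct2[OF b] by (rule order_trans)
  qed
  have A': "cmod (\<Sum>\<^sub>\<infinity>l\<in>L. of_real (real m * pi) * H v (a - p - l) * kern m a l p)
      \<le> real m * pi * h * norm v * (weight m p * (C * exp (- ((real m - 2) * pi / 2) * \<tau>)))"
    if "2 \<le> m" "L \<subseteq> \<Lambda>" "\<forall>l\<in>L. \<tau> \<le> q (p + l - a)" for m a p v L \<tau>
  proof -
    note b = bound[OF that]
    let ?k = "real m * pi * h * norm v"
    have k0: "?k \<ge> 0" using h(1) by simp
    have le: "cmod (of_real (real m * pi) * H v (a - p - l) * kern m a l p)
        \<le> ?k * ((1 + norm (p + l - a)) * cmod (kern m a l p))" for l
    proof -
      have "norm (a - p - l) = norm (p + l - a)" using norm_minus_commute[of a "p + l"] by (simp add: algebra_simps)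
      then have "h * norm v * norm (a - p - l) \<le> h * norm v * (1 + norm (p + l - a))"
        using h(1) by (intro mult_left_mono) auto
      with h(2)[of v "a - p - l"] have "cmod (H v (a - p - l)) \<le> h * norm v * (1 + norm (p + l - a))"
        by (rule order_trans)
      then have "real m * pi * cmod (H v (a - p - l)) * cmod (kern m a l p) \<le>
         real m * pi * (h * norm v * (1 + norm (p + l - a))) * cmod (kern m a l p)"
        by (intro mult_right_mono mult_left_mono) auto
      then show ?thesis by (simp add: norm_mult mult_ac)
    qed
    have s: "(\<lambda>l. ?k * ((1 + norm (p + l - a)) * cmod (kern m a l p))) summable_on L"
      by (intro summable_on_cmult_right conjunct1[OF b])
    have "cmod (\<Sum>\<^sub>\<infinity>l\<in>L. of_real (real m * pi) * H v (a - p - l) * kern m a l p)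
      \<le> (\<Sum>\<^sub>\<infinity>l\<in>L. ?k * ((1 + norm (p + l - a)) * cmod (kern m a l p)))"
      by (rule summable_on_dominated(3)[OF s le])
    also have "\<dots> = ?k * (\<Sum>\<^sub>\<infinity>l\<in>L. (1 + norm (p + l - a)) * cmod (kern m a l p))"
      by (rule infsum_cmult_right')
    also have "\<dots> \<le> ?k * (weight m p * (C * exp (- ((real m - 2) * pi / 2) * \<tau>)))"
      by (rule mult_left_mono[OF conjunct2[OF b] k0])
    finally show ?thesis .
  qed
  have zero: "{0} \<subseteq> \<Lambda>" using full_lattice_subgroup(1)[OF lat] by simp
  have split: "infsum f (\<Lambda> - {0}) = infsum f \<Lambda> - f 0" if "f summable_on \<Lambda>" for f :: "real^'n \<Rightarrow> complex"
    using infsum_Diff[OF that _ zero] by simp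
  have s1: "(\<lambda>l. kern m a l p) summable_on \<Lambda>" if "1 \<le> m" for m a p
    using kern_series(1)[OF that, of "\<lambda>_. 1" 1] by simp
  have e1: "cmod (state m a p) \<le> weight m p * (C * exp (- ((real m - 2) * pi / 2) * \<tau>))"
    if m: "2 \<le> m" and far: "\<forall>l\<in>\<Lambda>. \<tau> \<le> q (p + l - a)" for m a p \<tau>
    unfolding state_def by (rule A[OF m order_refl far])
  have e2: "cmod (state m a p - kern m a 0 p) \<le> weight m p * (C * exp (- ((real m - 2) * pi / 2) * \<tau>))"
    if m: "2 \<le> m" and far: "\<forall>l\<in>\<Lambda> - {0}. \<tau> \<le> q (p + l - a)" for m a p \<tau>
  proof -
    have m1: "1 \<le> m" using m by simp
    have "infsum (\<lambda>l. kern m a l p) (\<Lambda> - {0}) = state m a p - kern m a 0 p"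
      unfolding state_def by (rule split[OF s1[OF m1]])
    moreover have "cmod (\<Sum>\<^sub>\<infinity>l\<in>\<Lambda> - {0}. kern m a l p) \<le> weight m p * (C * exp (- ((real m - 2) * pi / 2) * \<tau>))"
      using m Diff_subset far by (rule A)
    ultimately show ?thesis by (simp only:)
  qed
  have e3: "cmod (cov m (state m a) p v) \<le> real m * pi * h * norm v * (weight m p * (C * exp (- ((real m - 2) * pi / 2) * \<tau>)))"
    if m: "2 \<le> m" and far: "\<forall>l\<in>\<Lambda>. \<tau> \<le> q (p + l - a)" for m a p v \<tau>
  proof -
    have m1: "1 \<le> m" using m by simp
    show ?thesis unfolding cov_state(1)[OF m1] by (rule A'[OF m order_refl far])
  qed
  have e4: "cmod (cov m (state m a) p v - of_real (real m * pi) * H v (a - p) * kern m a 0 p)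
         \<le> real m * pi * h * norm v * (weight m p * (C * exp (- ((real m - 2) * pi / 2) * \<tau>)))"
    if m: "2 \<le> m" and far: "\<forall>l\<in>\<Lambda> - {0}. \<tau> \<le> q (p + l - a)" for m a p v \<tau>
  proof -
    have m1: "1 \<le> m" using m by simp
    have "infsum (\<lambda>l. of_real (real m * pi) * H v (a - p - l) * kern m a l p) (\<Lambda> - {0}) =
        cov m (state m a) p v - of_real (real m * pi) * H v (a - p - 0) * kern m a 0 p"
      unfolding cov_state(1)[OF m1] by (rule split[OF cov_state(2)[OF m1]])
    moreover have "cmod (\<Sum>\<^sub>\<infinity>l\<in>\<Lambda> - {0}. of_real (real m * pi) * H v (a - p - l) * kern m a l p)
      \<le> real m * pi * h * norm v * (weight m p * (C * exp (- ((real m - 2) * pi / 2) * \<tau>)))"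
      using m Diff_subset far by (rule A')
    ultimately show ?thesis by (simp only: diff_zero)
  qed
  show thesis
  proof (rule that[OF C h(1)], goal_cases)
    case 1 show ?case using e1 by (intro allI impI)
  next
    case 2 show ?case using e2 by (intro allI impI)
  next
    case 3 show ?case using e3 by (intro allI impI)
  next
    case 4 show ?case using e4 by (intro allI impI)
  qed
qed

end

section \<open>Sums, products and affine pullbacks of holomorphic functions\<close>

lemma c1_holomorphic_const: "c1_holomorphic J (\<lambda>_. c)" "frechet_derivative (\<lambda>_. c) (at x) v = 0"
proof -
  have d: "((\<lambda>_. c) has_derivative (\<lambda>_. 0)) (at x)" for x by (rule has_derivative_const)
  show "c1_holomorphic J (\<lambda>_. c)" by (rule c1_holomorphicI[OF d]) auto
  show "frechet_derivative (\<lambda>_. c) (at x) v = 0" unfolding frechet_derivative_at[OF d, symmetric] ..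
qed

lemma c1_holomorphic_add:
  assumes f: "c1_holomorphic J f" and g: "c1_holomorphic J g"
  shows "c1_holomorphic J (\<lambda>x. f x + g x)"
    and "frechet_derivative (\<lambda>x. f x + g x) (at x) v = frechet_derivative f (at x) v + frechet_derivative g (at x) v"
proof -
  have d: "((\<lambda>x. f x + g x) has_derivative
      (\<lambda>v. frechet_derivative f (at x) v + frechet_derivative g (at x) v)) (at x)" for x
    by (intro has_derivative_add c1_holomorphicD(1)[OF f] c1_holomorphicD(1)[OF g])
  show "c1_holomorphic J (\<lambda>x. f x + g x)"
    by (rule c1_holomorphicI[OF d])
      (simp_all add: c1_holomorphicD(2)[OF f] c1_holomorphicD(2)[OF g] distrib_left
        continuous_on_add c1_holomorphicD(3)[OF f] c1_holomorphicD(3)[OF g])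
  show "frechet_derivative (\<lambda>x. f x + g x) (at x) v = frechet_derivative f (at x) v + frechet_derivative g (at x) v"
    unfolding frechet_derivative_at[OF d, symmetric] ..
qed

lemma c1_holomorphic_mult:
  assumes f: "c1_holomorphic J f" and g: "c1_holomorphic J g"
  shows "c1_holomorphic J (\<lambda>x. f x * g x)"
    and "frechet_derivative (\<lambda>x. f x * g x) (at x) v = f x * frechet_derivative g (at x) v + frechet_derivative f (at x) v * g x"
proof -
  have d: "((\<lambda>x. f x * g x) has_derivative
      (\<lambda>v. f x * frechet_derivative g (at x) v + frechet_derivative f (at x) v * g x)) (at x)" for x
    by (intro has_derivative_mult c1_holomorphicD(1)[OF f] c1_holomorphicD(1)[OF g])
  show "c1_holomorphic J (\<lambda>x. f x * g x)"
  proof (rule c1_holomorphicI[OF d])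
    show "continuous_on UNIV (\<lambda>x. f x * frechet_derivative g (at x) v + frechet_derivative f (at x) v * g x)" for v
      by (intro continuous_intros c1_holomorphic_continuous[OF f] c1_holomorphic_continuous[OF g]
          c1_holomorphicD(3)[OF f] c1_holomorphicD(3)[OF g])
  qed (simp add: c1_holomorphicD(2)[OF f] c1_holomorphicD(2)[OF g] algebra_simps)
  show "frechet_derivative (\<lambda>x. f x * g x) (at x) v = f x * frechet_derivative g (at x) v + frechet_derivative f (at x) v * g x"
    unfolding frechet_derivative_at[OF d, symmetric] ..
qed

lemma c1_holomorphic_prod:
  assumes "finite I" "\<And>i. i \<in> I \<Longrightarrow> c1_holomorphic J (f i)"
  shows "c1_holomorphic J (\<lambda>x. \<Prod>i\<in>I. f i x)"
  using assms by (induction I rule: finite_induct) (auto intro: c1_holomorphic_const c1_holomorphic_mult)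

lemma c1_holomorphic_affine:
  assumes f: "c1_holomorphic J f" and A: "A ** J = J ** A"
  shows "c1_holomorphic J (\<lambda>x. f (A *v x + b))"
    and "frechet_derivative (\<lambda>x. f (A *v x + b)) (at x) v = frechet_derivative f (at (A *v x + b)) (A *v v)"
proof -
  have a: "((\<lambda>x. A *v x + b) has_derivative (\<lambda>v. A *v v)) (at x)" for x
    by (auto intro!: derivative_eq_intros bounded_linear_imp_has_derivative)
  have d: "((\<lambda>x. f (A *v x + b)) has_derivative (\<lambda>v. frechet_derivative f (at (A *v x + b)) (A *v v))) (at x)" for x
    by (rule has_derivative_compose[OF a c1_holomorphicD(1)[OF f]])
  have AJ: "A *v (J *v v) = J *v (A *v v)" for v by (simp add: matrix_vector_mul_assoc A)
  show "c1_holomorphic J (\<lambda>x. f (A *v x + b))"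
  proof (rule c1_holomorphicI[OF d])
    show "continuous_on UNIV (\<lambda>x. frechet_derivative f (at (A *v x + b)) (A *v v))" for v
      by (rule continuous_on_compose2[OF c1_holomorphicD(3)[OF f]]) (auto intro!: continuous_intros)
  qed (simp add: AJ c1_holomorphicD(2)[OF f])
  show "frechet_derivative (\<lambda>x. f (A *v x + b)) (at x) v = frechet_derivative f (at (A *v x + b)) (A *v v)"
    unfolding frechet_derivative_at[OF d, symmetric] ..
qed

text \<open>The errors decay in m at the full rate \<tau>, whereas a state displaced by u with q u
  at most \<tau> / 4 loses only at rate \<tau> / 4 and so dominates for large m.\<close>

lemma exp_decay_comparison:
  fixes A B \<tau> :: real
  assumes "A > 0" "B > 0" "\<tau> > 0"
  obtains m0 where "m0 \<ge> 2"
    "\<And>m. m \<ge> m0 \<Longrightarrow> A * exp (- ((real m - 2) * pi / 2) * \<tau>) < B * exp (- (real m * pi / 2) * (\<tau> / 4))"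
proof -
  \<comment> \<open>The right side is B times the m-th power of s, the left side A' times its (4
    m)-th power; A' absorbs the shift from m to m - 2.\<close>
  define s where "s = exp (- (pi * \<tau> / 8))"
  have s: "0 < s" "s < 1" using assms by (auto simp: s_def)
  define A' where "A' = A * exp (pi * \<tau>)"
  have A': "A' > 0" using assms by (simp add: A'_def)
  obtain m0 where m0: "s ^ m0 < B / A'"
    using real_arch_pow_inv[of "B / A'" s] s assms A' by auto
  show thesis
  proof (rule that[of "max 2 m0"])
    fix m assume m: "max 2 m0 \<le> m"
    then have "s ^ m \<le> s ^ m0" using s by (intro power_decreasing) auto
    then have "A' * s ^ m \<le> A' * s ^ m0" using A' by (intro mult_left_mono) auto
    moreover have "A' * s ^ m0 < B" using m0 A' by (simp add: less_divide_eq mult.commute)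
    ultimately have sB: "A' * s ^ m < B" by linarith
    have "s ^ (4 * m) \<le> s ^ m * s ^ m"
      unfolding power_add[symmetric] using s by (intro power_decreasing) auto
    then have "A' * s ^ (4 * m) \<le> A' * (s ^ m * s ^ m)" using A' by (intro mult_left_mono) auto
    also have "\<dots> = (A' * s ^ m) * s ^ m" by (rule mult.assoc[symmetric])
    also have "\<dots> < B * s ^ m" using sB s by (intro mult_strict_right_mono) auto
    finally have "A' * s ^ (4 * m) < B * s ^ m" .
    moreover have "A * exp (- ((real m - 2) * pi / 2) * \<tau>) = A' * s ^ (4 * m)"
      unfolding A'_def s_def exp_of_nat_mult[symmetric] mult.assoc mult_exp_exp by (simp add: field_simps)
    moreover have "B * exp (- (real m * pi / 2) * (\<tau> / 4)) = B * s ^ m"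
      unfolding s_def exp_of_nat_mult[symmetric] by (simp add: field_simps)
    ultimately show "A * exp (- ((real m - 2) * pi / 2) * \<tau>) < B * exp (- (real m * pi / 2) * (\<tau> / 4))"
      by (simp only:)
  qed simp
qed

lemma full_lattice_closed:
  assumes "full_lattice \<Lambda>" shows "closed \<Lambda>"
proof -
  obtain \<delta> where \<delta>: "\<delta> > 0" "\<And>l. l \<in> \<Lambda> \<Longrightarrow> l \<noteq> 0 \<Longrightarrow> \<delta> \<le> norm l"
    by (rule full_lattice_discrete[OF assms]) (rule that)
  have "y = x" if "x \<in> \<Lambda>" "y \<in> \<Lambda>" "dist y x < \<delta>" for x y
    using \<delta>(2)[OF full_lattice_subgroup(4)[OF assms that(2,1)]] that(3) by (auto simp: dist_norm)
  then show ?thesis using discrete_imp_closed[OF \<delta>(1)] by blast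
qed

lemma infdist_lattice:
  assumes "full_lattice \<Lambda>"
  shows "y \<notin> \<Lambda> \<Longrightarrow> infdist y \<Lambda> > 0" "l \<in> \<Lambda> \<Longrightarrow> infdist y \<Lambda> \<le> norm (y + l)"
proof -
  show "infdist y \<Lambda> > 0" if "y \<notin> \<Lambda>"
    using infdist_pos_not_in_closed[OF full_lattice_closed[OF assms] _ that] full_lattice_subgroup(1)[OF assms] by blast
  show "infdist y \<Lambda> \<le> norm (y + l)" if "l \<in> \<Lambda>"
    using infdist_le[OF full_lattice_subgroup(3)[OF assms that], of y] by (simp add: dist_norm)
qed

context polarized_torus
begin

lemma theta_zero: "theta m (\<lambda>_. 0)"
  by (simp add: theta_def c1_holomorphic_const)

lemma theta_add:
  assumes f: "theta m f" and g: "theta m g"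
  shows "theta m (\<lambda>z. f z + g z)" "cov m (\<lambda>z. f z + g z) p v = cov m f p v + cov m g p v"
  using assms unfolding theta_def cov_def
  by (auto simp: c1_holomorphic_add distrib_left algebra_simps)

lemma theta_cmult:
  assumes f: "theta m f"
  shows "theta m (\<lambda>z. c * f z)" "cov m (\<lambda>z. c * f z) p v = c * cov m f p v"
  using assms c1_holomorphic_mult[OF c1_holomorphic_const(1)[of J c]] unfolding theta_def cov_def
  by (auto simp: c1_holomorphic_const(2) algebra_simps)

lemma theta_sum:
  assumes "finite I" "\<And>i. i \<in> I \<Longrightarrow> theta m (f i)"
  shows "theta m (\<lambda>z. \<Sum>i\<in>I. f i z) \<and> cov m (\<lambda>z. \<Sum>i\<in>I. f i z) p v = (\<Sum>i\<in>I. cov m (f i) p v)"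
  using assms
proof (induction I rule: finite_induct)
  case empty
  then show ?case by (simp add: theta_zero cov_def c1_holomorphic_const(2))
next
  case (insert x F)
  then show ?case using theta_add[of m "f x" "\<lambda>z. \<Sum>i\<in>F. f i z"] by simp
qed

lemma weight_pos: "weight m z > 0"
  by (simp add: weight_def)

lemma kern_self: "kern m a 0 a = of_real (weight m a)"
proof -
  have "of_real (real m * pi) * (H a a - H a a / 2) = (of_real (real m * pi / 2 * q a) :: complex)"
    by (simp add: H_self field_simps)
  moreover have "- H a 0 - H 0 0 / 2 + H (a + 0) a - H a a / 2 = H a a - H a a / 2"
    by (simp add: H_zero_right)
  ultimately show ?thesis unfolding kern_def weight_def by (simp only: exp_of_real)
qed

text \<open>Separation in the torus; the case a = b compares a point with its own lattice
  translates.\<close>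

definition lattice_separated :: "real \<Rightarrow> (real^'n) set \<Rightarrow> bool" where
  "lattice_separated D P \<longleftrightarrow> (\<forall>a\<in>P. \<forall>b\<in>P. \<forall>l\<in>\<Lambda>. a \<noteq> b \<or> l \<noteq> 0 \<longrightarrow> D \<le> norm (a - b + l))"

lemma lattice_separatedD:
  assumes "lattice_separated D P" "a \<in> P" "b \<in> P" "l \<in> \<Lambda>" "a \<noteq> b \<or> l \<noteq> 0"
  shows "D \<le> norm (a - b + l)"
  using assms by (simp add: lattice_separated_def)

lemma lattice_separated_exists:
  assumes fin: "finite P" and sep: "\<And>a b. a \<in> P \<Longrightarrow> b \<in> P \<Longrightarrow> a \<noteq> b \<Longrightarrow> a - b \<notin> \<Lambda>"
  obtains D where "D > 0" "lattice_separated D P"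
proof -
  obtain \<delta> where \<delta>: "\<delta> > 0" "\<And>l. l \<in> \<Lambda> \<Longrightarrow> l \<noteq> 0 \<Longrightarrow> \<delta> \<le> norm l"
    by (rule full_lattice_discrete[OF lat]) (rule that)
  let ?S = "(\<lambda>(a, b). infdist (a - b) \<Lambda>) ` {(a, b) \<in> P \<times> P. a \<noteq> b}"
  define D where "D = Min (insert \<delta> ?S)"
  have "{(a, b) \<in> P \<times> P. a \<noteq> b} \<subseteq> P \<times> P" by blast
  then have "finite {(a, b) \<in> P \<times> P. a \<noteq> b}"
    using finite_cartesian_product[OF fin fin] by (rule finite_subset)
  then have fS: "finite ?S" by (rule finite_imageI)
  have "\<forall>x\<in>insert \<delta> ?S. 0 < x"
  proof
    fix x assume "x \<in> insert \<delta> ?S"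
    then consider "x = \<delta>" | a b where "x = infdist (a - b) \<Lambda>" "a \<in> P" "b \<in> P" "a \<noteq> b" by auto
    then show "0 < x"
    proof cases
      case 1
      then show ?thesis using \<delta>(1) by simp
    next
      case 2
      then show ?thesis using infdist_lattice(1)[OF lat sep[OF 2(2,3,4)]] by simp
    qed
  qed
  then have "D > 0" unfolding D_def using fS by (subst Min_gr_iff) simp_all
  moreover have "D \<le> norm (a - b + l)" if "a \<in> P" "b \<in> P" "l \<in> \<Lambda>" "a \<noteq> b \<or> l \<noteq> 0" for a b l
  proof (cases "a = b")
    case True
    have "D \<le> \<delta>" unfolding D_def using fS by (intro Min_le) auto
    then show ?thesis using True that \<delta>(2)[of l] by simp
  next
    case False
    have "D \<le> infdist (a - b) \<Lambda>" unfolding D_def using fS that False by (intro Min_le) auto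
    then show ?thesis using infdist_lattice(2)[OF lat that(3), of "a - b"] by simp
  qed
  then have "lattice_separated D P" unfolding lattice_separated_def by (intro ballI impI)
  ultimately show thesis by (rule that)
qed

text \<open>The sum of the states centred at P works. That m0 depends only on k and D, and not on P,
  lets one weight serve all orbits.\<close>

lemma theta_nonvanishing:
  assumes D: "D > 0"
  obtains m0 where "m0 \<ge> 1" "\<And>m P. m \<ge> m0 \<Longrightarrow> finite P \<Longrightarrow> card P \<le> k \<Longrightarrow> lattice_separated D P \<Longrightarrow>
    \<exists>f. theta m f \<and> (\<forall>a\<in>P. f a \<noteq> 0)"
proof -
  obtain c where c: "c > 0" "\<And>x. c * (norm x)\<^sup>2 \<le> q x" by (rule q_lower) (rule that)
  obtain C where
    est1': "\<forall>m a p \<tau>. 2 \<le> m \<longrightarrow> (\<forall>l\<in>\<Lambda>. \<tau> \<le> q (p + l - a)) \<longrightarrow>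
       cmod (state m a p) \<le> weight m p * (C * exp (- ((real m - 2) * pi / 2) * \<tau>))" and
    est2': "\<forall>m a p \<tau>. 2 \<le> m \<longrightarrow> (\<forall>l\<in>\<Lambda> - {0}. \<tau> \<le> q (p + l - a)) \<longrightarrow>
       cmod (state m a p - kern m a 0 p) \<le> weight m p * (C * exp (- ((real m - 2) * pi / 2) * \<tau>))" and
    C: "C > 0"
    by (rule state_estimates) (rule that, assumption, assumption, assumption)
  note est1 = est1'[THEN spec, THEN spec, THEN spec, THEN spec, THEN mp, THEN mp] and est2 = est2'[THEN spec, THEN spec, THEN spec, THEN spec, THEN mp, THEN mp]
  define \<tau> where "\<tau> = c * D\<^sup>2"
  have \<tau>: "\<tau> > 0" using c D by (simp add: \<tau>_def)
  have q_far: "\<tau> \<le> q y" if "D \<le> norm y" for y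
  proof -
    have "D\<^sup>2 \<le> (norm y)\<^sup>2" using that D by (intro power_mono) auto
    then have "c * D\<^sup>2 \<le> c * (norm y)\<^sup>2" using c(1) by (intro mult_left_mono) auto
    then show ?thesis using c(2)[of y] by (simp add: \<tau>_def)
  qed
  \<comment> \<open>At a point of P one error comes from the translates of its own state, and at
    most k come from the other points.\<close>
  have "real (k + 1) * C > 0" using C by simp
  then obtain m0 where m0: "m0 \<ge> 2" "\<And>m. m \<ge> m0 \<Longrightarrow>
      real (k + 1) * C * exp (- ((real m - 2) * pi / 2) * \<tau>) < 1 * exp (- (real m * pi / 2) * (\<tau> / 4))"
    by (rule exp_decay_comparison[OF _ zero_less_one \<tau>]) (rule that)
  show thesis
  proof (rule that[of m0])
    fix m P assume m: "m \<ge> m0" and P: "finite P" "card P \<le> k" "lattice_separated D P"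
    have m2: "2 \<le> m" using m m0(1) by simp
    define sg where "sg = C * exp (- ((real m - 2) * pi / 2) * \<tau>)"
    have "exp (- (real m * pi / 2) * (\<tau> / 4)) \<le> 1" using \<tau> by simp
    then have "real (k + 1) * C * exp (- ((real m - 2) * pi / 2) * \<tau>) < 1" using m0(2)[OF m] by linarith
    then have sg: "real (k + 1) * sg < 1" unfolding sg_def by (simp only: mult.assoc)
    have sg0: "sg \<ge> 0" using C by (simp add: sg_def)
    define f where "f z = (\<Sum>a\<in>P. state m a z)" for z
    have "theta m f" unfolding f_def[abs_def]
      using theta_sum[OF P(1), of m "state m"] theta_state m2 by simp
    moreover have "f b \<noteq> 0" if b: "b \<in> P" for b
    proof -
      have far: "cmod (state m a b) \<le> weight m b * sg" if a: "a \<in> P - {b}" for a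
        unfolding sg_def
      proof (rule est1[OF m2], rule ballI)
        fix l assume "l \<in> \<Lambda>"
        then have "D \<le> norm (b - a + l)" using a b by (intro lattice_separatedD[OF P(3)]) auto
        then show "\<tau> \<le> q (b + l - a)" using q_far[of "b - a + l"] by (simp add: algebra_simps)
      qed
      have near: "cmod (state m b b - kern m b 0 b) \<le> weight m b * sg"
        unfolding sg_def
      proof (rule est2[OF m2], rule ballI)
        fix l assume "l \<in> \<Lambda> - {0}"
        then have "D \<le> norm (b - b + l)" using b by (intro lattice_separatedD[OF P(3)]) auto
        then show "\<tau> \<le> q (b + l - b)" using q_far[of l] by simp
      qed
      have eq: "f b - of_real (weight m b) = (state m b b - kern m b 0 b) + (\<Sum>a\<in>P - {b}. state m a b)"
        unfolding f_def kern_self using sum.remove[OF P(1) b, of "\<lambda>a. state m a b"] by simp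
      have "cmod (f b - of_real (weight m b)) \<le> weight m b * sg + (\<Sum>a\<in>P - {b}. weight m b * sg)"
        unfolding eq by (intro norm_triangle_mono near sum_norm_le far)
      also have "\<dots> = weight m b * (sg + real (card (P - {b})) * sg)" by (simp add: algebra_simps)
      also have "\<dots> \<le> weight m b * (real (k + 1) * sg)"
      proof (intro mult_left_mono less_imp_le[OF weight_pos])
        have "card (P - {b}) \<le> k" using P(2) card_Diff1_le[of P b] by linarith
        then have "real (card (P - {b})) * sg \<le> real k * sg" using sg0 by (intro mult_right_mono) auto
        then show "sg + real (card (P - {b})) * sg \<le> real (k + 1) * sg" by (simp add: algebra_simps)
      qed
      also have "\<dots> < weight m b * 1" by (rule mult_strict_left_mono[OF sg weight_pos])
      finally have "cmod (f b - of_real (weight m b)) < weight m b" by simp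
      then show ?thesis using weight_pos[of m b] by auto
    qed
    ultimately show "\<exists>f. theta m f \<and> (\<forall>a\<in>P. f a \<noteq> 0)" by blast
  qed (use m0 in simp)
qed

text \<open>The function is a combination of the states at \<open>P\<close>, at \<open>p\<close> and at a nearby point \<open>p + u\<close>
  with \<open>u\<close> a small multiple of \<open>w\<close>; the latter dominates the derivative at \<open>p\<close>.\<close>

lemma theta_interpolation:
  assumes fin: "finite P" and pP: "p \<notin> P" and w: "w \<noteq> 0"
    and sep: "\<And>a b. a \<in> insert p P \<Longrightarrow> b \<in> insert p P \<Longrightarrow> a \<noteq> b \<Longrightarrow> a - b \<notin> \<Lambda>"
  obtains m0 where "\<And>m. m \<ge> m0 \<Longrightarrow>
    \<exists>f. theta m f \<and> f p = 0 \<and> frechet_derivative f (at p) w \<noteq> 0 \<and> (\<forall>a\<in>P. f a \<noteq> 0)"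
proof -
  obtain c where c: "c > 0" "\<And>x. c * (norm x)\<^sup>2 \<le> q x" by (rule q_lower) (rule that)
  obtain C h where
    est1': "\<forall>m a p \<tau>. 2 \<le> m \<longrightarrow> (\<forall>l\<in>\<Lambda>. \<tau> \<le> q (p + l - a)) \<longrightarrow>
       cmod (state m a p) \<le> weight m p * (C * exp (- ((real m - 2) * pi / 2) * \<tau>))" and
    est2': "\<forall>m a p \<tau>. 2 \<le> m \<longrightarrow> (\<forall>l\<in>\<Lambda> - {0}. \<tau> \<le> q (p + l - a)) \<longrightarrow>
       cmod (state m a p - kern m a 0 p) \<le> weight m p * (C * exp (- ((real m - 2) * pi / 2) * \<tau>))" and
    est3': "\<forall>m a p v \<tau>. 2 \<le> m \<longrightarrow> (\<forall>l\<in>\<Lambda>. \<tau> \<le> q (p + l - a)) \<longrightarrow>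
       cmod (cov m (state m a) p v) \<le> real m * pi * h * norm v * (weight m p * (C * exp (- ((real m - 2) * pi / 2) * \<tau>)))" and
    est4': "\<forall>m a p v \<tau>. 2 \<le> m \<longrightarrow> (\<forall>l\<in>\<Lambda> - {0}. \<tau> \<le> q (p + l - a)) \<longrightarrow>
       cmod (cov m (state m a) p v - of_real (real m * pi) * H v (a - p) * kern m a 0 p)
         \<le> real m * pi * h * norm v * (weight m p * (C * exp (- ((real m - 2) * pi / 2) * \<tau>)))" and
    C: "C > 0" and h: "h > 0"
    by (rule state_estimates) (rule that, assumption, assumption, assumption, assumption, assumption, assumption)
  note est1 = est1'[THEN spec, THEN spec, THEN spec, THEN spec, THEN mp, THEN mp] and est2 = est2'[THEN spec, THEN spec, THEN spec, THEN spec, THEN mp, THEN mp]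
    and est3 = est3'[THEN spec, THEN spec, THEN spec, THEN spec, THEN spec, THEN mp, THEN mp] and est4 = est4'[THEN spec, THEN spec, THEN spec, THEN spec, THEN spec, THEN mp, THEN mp]
  obtain D where D: "D > 0" "lattice_separated D (insert p P)"
    by (rule lattice_separated_exists[of "insert p P"]) (use fin sep that in \<open>simp_all only: finite.insertI\<close>)
  have Dsep: "D \<le> norm (a - b + l)" if "a \<in> insert p P" "b \<in> insert p P" "l \<in> \<Lambda>" "a \<noteq> b \<or> l \<noteq> 0" for a b l
    using that by (rule lattice_separatedD[OF D(2)])
  \<comment> \<open>Half of D, because the auxiliary centre p + u may be displaced by D / 2.\<close>
  define \<tau> where "\<tau> = c * (D / 2)\<^sup>2"
  have \<tau>: "\<tau> > 0" using c D by (simp add: \<tau>_def)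
  have q_far: "\<tau> \<le> q y" if "D / 2 \<le> norm y" for y
  proof -
    have "(D / 2)\<^sup>2 \<le> (norm y)\<^sup>2" using that D(1) by (intro power_mono) auto
    then have "c * (D / 2)\<^sup>2 \<le> c * (norm y)\<^sup>2" using c(1) by (intro mult_left_mono) auto
    then show ?thesis using c(2)[of y] by (simp add: \<tau>_def)
  qed
  have qw: "q w > 0" using positive[OF w] by (simp add: q_def)
  \<comment> \<open>The three bounds make, in turn, the square of \<rho> at most \<rho>, norm u at
    most D / 2, and (with the first) q u at most \<tau> / 4.\<close>
  define \<rho> where "\<rho> = min 1 (min (D / (2 * norm w)) (\<tau> / (4 * q w)))"
  have \<rho>: "\<rho> > 0" "\<rho> \<le> 1" "\<rho> \<le> D / (2 * norm w)" "\<rho> \<le> \<tau> / (4 * q w)"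
    using D(1) w \<tau> qw by (auto simp: \<rho>_def)
  define u where "u = \<rho> *\<^sub>R w"
  have nu: "norm u \<le> D / 2" using \<rho>(1,3) w by (simp add: u_def field_simps)
  have qu: "q u \<le> \<tau> / 4"
  proof -
    have "\<rho> * \<rho> \<le> 1 * \<rho>" using \<rho>(1,2) by (intro mult_right_mono) auto
    then have "\<rho>\<^sup>2 * q w \<le> \<rho> * q w" using qw unfolding power2_eq_square by (intro mult_right_mono) auto
    also have "\<dots> \<le> \<tau> / (4 * q w) * q w" using \<rho>(4) qw by (intro mult_right_mono) auto
    finally show ?thesis using qw by (simp add: u_def q_scale)
  qed
  define k where "k = card P"
  \<comment> \<open>The number k + 3 counts errors in the covariant derivative at p: k from P, one
    from p + u, and two from the state at p, whose coefficient has modulus at most 2.\<close>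
  define B1 where "B1 = h * norm w * real (k + 3) * C"
  have B1: "B1 > 0" using h w C by (simp add: B1_def)
  have B2: "\<rho> * q w > 0" using \<rho>(1) qw by simp
  \<comment> \<open>The number k + 4 counts errors at a point of P: one from its own state, at most
    k from the others, one from p + u and two from p. The factor 4 keeps their total below a quarter
    of the weight.\<close>
  have B3: "4 * real (k + 4) * C > 0" using C by simp
  obtain m1 where m1: "m1 \<ge> 2" "\<And>m. m \<ge> m1 \<Longrightarrow>
      B1 * exp (- ((real m - 2) * pi / 2) * \<tau>) < \<rho> * q w * exp (- (real m * pi / 2) * (\<tau> / 4))"
    by (rule exp_decay_comparison[OF B1 B2 \<tau>]) (rule that)
  obtain m2 where m2: "m2 \<ge> 2" "\<And>m. m \<ge> m2 \<Longrightarrow>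
      4 * real (k + 4) * C * exp (- ((real m - 2) * pi / 2) * \<tau>) < 1 * exp (- (real m * pi / 2) * (\<tau> / 4))"
    by (rule exp_decay_comparison[OF B3 zero_less_one \<tau>]) (rule that)
  show thesis
  proof (rule that[of "max m1 m2"])
    fix m assume m: "max m1 m2 \<le> m"
    then have m2': "2 \<le> m" and m1': "1 \<le> m" using m1(1) by auto
    define sg where "sg = C * exp (- ((real m - 2) * pi / 2) * \<tau>)"
    have sg0: "sg \<ge> 0" using C by (simp add: sg_def)
    have "exp (- (real m * pi / 2) * (\<tau> / 4)) \<le> 1" using \<tau> by simp
    moreover have "4 * real (k + 4) * C * exp (- ((real m - 2) * pi / 2) * \<tau>) < 1 * exp (- (real m * pi / 2) * (\<tau> / 4))"
      using m by (intro m2(2)) simp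
    ultimately have "4 * real (k + 4) * C * exp (- ((real m - 2) * pi / 2) * \<tau>) < 1" by linarith
    then have "4 * real (k + 4) * sg < 1" unfolding sg_def by (simp only: mult.assoc)
    then have sg: "real k * sg + 4 * sg \<le> 1 / 4" by (simp add: algebra_simps)
    have ksg: "real k * sg \<ge> 0" using sg0 by simp
    have far: "cmod (state m a b) \<le> weight m b * sg" "cmod (cov m (state m a) b v) \<le> real m * pi * h * norm v * (weight m b * sg)"
      if "a \<in> insert p P" "b \<in> insert p P" "a \<noteq> b" for a b v
    proof -
      have "\<forall>l\<in>\<Lambda>. \<tau> \<le> q (b + l - a)"
      proof
        fix l assume "l \<in> \<Lambda>"
        then have "D \<le> norm (b - a + l)" using that by (intro Dsep) auto
        then show "\<tau> \<le> q (b + l - a)" using q_far[of "b - a + l"] D(1) by (simp add: algebra_simps)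
      qed
      from est1[OF m2' this] est3[OF m2' this, of v]
      show "cmod (state m a b) \<le> weight m b * sg"
        "cmod (cov m (state m a) b v) \<le> real m * pi * h * norm v * (weight m b * sg)"
        unfolding sg_def .
    qed
    have self: "cmod (state m a a - of_real (weight m a)) \<le> weight m a * sg"
      "cmod (cov m (state m a) a v) \<le> real m * pi * h * norm v * (weight m a * sg)"
      if "a \<in> insert p P" for a v
    proof -
      have f: "\<forall>l\<in>\<Lambda> - {0}. \<tau> \<le> q (a + l - a)"
      proof
        fix l assume "l \<in> \<Lambda> - {0}"
        then have "D \<le> norm (a - a + l)" using that by (intro Dsep) auto
        then show "\<tau> \<le> q (a + l - a)" using q_far[of l] D(1) by simp
      qed
      show "cmod (state m a a - of_real (weight m a)) \<le> weight m a * sg"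
        using est2[OF m2' f] by (simp add: kern_self sg_def)
      show "cmod (cov m (state m a) a v) \<le> real m * pi * h * norm v * (weight m a * sg)"
        using est4[OF m2' f, of v] by (simp add: sg_def H_zero_right)
    qed
    have shift: "D / 2 \<le> norm (b + l - (p + u))" if "b \<in> insert p P" "l \<in> \<Lambda>" "b \<noteq> p \<or> l \<noteq> 0" for b l
    proof -
      have "D \<le> norm (b - p + l)" using that by (intro Dsep) auto
      also have "\<dots> \<le> norm (b + l - (p + u)) + norm u"
        using norm_triangle_ineq[of "b + l - (p + u)" u] by (simp add: algebra_simps)
      finally show ?thesis using nu by simp
    qed
    have shift_far: "cmod (state m (p + u) b) \<le> weight m b * sg" if "b \<in> P" for b
      unfolding sg_def by (intro est1[OF m2'] ballI q_far shift) (use that pP in auto)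
    have near: "\<forall>l\<in>\<Lambda> - {0}. \<tau> \<le> q (p + l - (p + u))"
      by (intro ballI q_far shift) auto
    have shift_near: "cmod (state m (p + u) p - kern m (p + u) 0 p) \<le> weight m p * sg"
      using est2[OF m2' near] by (simp add: sg_def)
    have shift_cov: "cmod (cov m (state m (p + u)) p w - of_real (real m * pi) * H w u * kern m (p + u) 0 p)
        \<le> real m * pi * h * norm w * (weight m p * sg)"
      using est4[OF m2' near, of w] by (simp add: sg_def)
    have "q (p + 0 - (p + u)) = q u" using q_scale[of "-1" u] by simp
    then have nk: "cmod (kern m (p + u) 0 p) = weight m p * exp (- (real m * pi / 2) * q u)"
      by (simp only: norm_kern)
    have nk1: "cmod (kern m (p + u) 0 p) \<le> weight m p"
      unfolding nk using weight_pos[of m p] q_nonneg[of u] by (simp add: mult_le_cancel_left1)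
    define s1 where "s1 z = (\<Sum>a\<in>P. state m a z) + state m (p + u) z" for z
    \<comment> \<open>This coefficient cancels the value at p. Relative to the weight its numerator
      is at most 5/4 and its denominator at least 3/4, so its modulus is at most 2.\<close>
    define cc where "cc = - (s1 p / state m p p)"
    define f where "f z = s1 z + cc * state m p z" for z
    have th: "theta m (state m a)" for a by (rule theta_state[OF m1'])
    have th_sum: "theta m (\<lambda>z. \<Sum>a\<in>P. state m a z)"
      and cov_sum: "cov m (\<lambda>z. \<Sum>a\<in>P. state m a z) x v = (\<Sum>a\<in>P. cov m (state m a) x v)" for x v
      using theta_sum[OF fin, of m "state m"] th by auto
    have th_s1: "theta m s1" and cov_s1: "cov m s1 x v = (\<Sum>a\<in>P. cov m (state m a) x v) + cov m (state m (p + u)) x v" for x v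
      unfolding s1_def[abs_def] using theta_add[OF th_sum th] cov_sum by auto
    have th_f: "theta m f" and cov_f: "cov m f x v = (\<Sum>a\<in>P. cov m (state m a) x v) + cov m (state m (p + u)) x v + cc * cov m (state m p) x v" for x v
      unfolding f_def[abs_def] using theta_add[OF th_s1 theta_cmult(1)[OF th]] cov_s1 theta_cmult(2)[OF th] by auto
    let ?W = "weight m p"
    have Wp: "?W > 0" by (rule weight_pos)
    have pp: "cmod (state m p p) \<ge> ?W * (1 - sg)"
    proof -
      have "?W = cmod (of_real ?W)" using Wp by simp
      also have "\<dots> \<le> cmod (state m p p) + cmod (state m p p - of_real ?W)"
        using norm_triangle_ineq4[of "state m p p" "state m p p - of_real ?W"] by simp
      finally show ?thesis using self(1)[of p] by (simp add: algebra_simps)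
    qed
    have "3 / 4 \<le> 1 - sg" using sg ksg sg0 by linarith
    then have "?W * (3 / 4) \<le> ?W * (1 - sg)" using Wp by (intro mult_left_mono) auto
    with pp have pp': "cmod (state m p p) \<ge> ?W * (3 / 4)" by linarith
    then have pp0: "state m p p \<noteq> 0" using Wp by auto
    have "cmod (\<Sum>a\<in>P. state m a p) \<le> (\<Sum>a\<in>P. ?W * sg)"
      by (intro sum_norm_le far(1)) (use pP in auto)
    then have 1: "cmod (\<Sum>a\<in>P. state m a p) \<le> ?W * (real k * sg)" by (simp add: k_def mult_ac)
    have "cmod (state m (p + u) p) \<le> cmod (state m (p + u) p - kern m (p + u) 0 p) + cmod (kern m (p + u) 0 p)"
      using norm_triangle_ineq[of "state m (p + u) p - kern m (p + u) 0 p" "kern m (p + u) 0 p"] by simp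
    then have 2: "cmod (state m (p + u) p) \<le> ?W * sg + ?W" using shift_near nk1 by linarith
    have "cmod (s1 p) \<le> ?W * (real k * sg) + (?W * sg + ?W)"
      unfolding s1_def by (rule norm_triangle_mono[OF 1 2])
    also have "\<dots> = ?W * (real k * sg + sg + 1)" by (simp add: algebra_simps)
    also have "\<dots> \<le> ?W * (5 / 4)" using sg sg0 Wp by (intro mult_left_mono) auto
    finally have s1p: "cmod (s1 p) \<le> ?W * (5 / 4)" .
    have "cmod (s1 p) \<le> 2 * cmod (state m p p)" using s1p pp' Wp by linarith
    then have cc: "cmod cc \<le> 2" using pp0 by (simp add: cc_def norm_divide divide_le_eq)
    have fp: "f p = 0" using pp0 by (simp add: f_def cc_def)
    have fb: "f b \<noteq> 0" if b: "b \<in> P" for b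
    proof -
      let ?V = "weight m b"
      have Vp: "?V > 0" by (rule weight_pos)
      have eq: "f b - of_real ?V = (state m b b - of_real ?V) + (\<Sum>a\<in>P - {b}. state m a b) + state m (p + u) b + cc * state m p b"
        unfolding f_def s1_def using sum.remove[OF fin b, of "\<lambda>a. state m a b"] by simp
      have "cmod (\<Sum>a\<in>P - {b}. state m a b) \<le> (\<Sum>a\<in>P - {b}. ?V * sg)"
        by (intro sum_norm_le far(1)) (use b in auto)
      also have "\<dots> = real (card (P - {b})) * (?V * sg)" by simp
      also have "\<dots> \<le> real k * (?V * sg)"
        using sg0 Vp card_Diff1_le[of P b] by (intro mult_right_mono) (auto simp: k_def)
      finally have a1: "cmod (\<Sum>a\<in>P - {b}. state m a b) \<le> real k * (?V * sg)" .
      have a2: "cmod (cc * state m p b) \<le> 2 * (?V * sg)"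
        unfolding norm_mult using cc far(1)[of p b] b pP by (intro mult_mono) auto
      have "cmod (f b - of_real ?V) \<le> ?V * sg + real k * (?V * sg) + ?V * sg + 2 * (?V * sg)"
        unfolding eq using self(1)[of b] b by (intro norm_triangle_mono a1 a2 shift_far) auto
      also have "\<dots> = ?V * (real k * sg + 4 * sg)" by (simp add: algebra_simps)
      also have "\<dots> \<le> ?V * (1 / 4)" using sg Vp by (intro mult_left_mono) auto
      finally have "cmod (f b - of_real ?V) < ?V" using Vp by linarith
      then show ?thesis using Vp by auto
    qed
    have "cov m f p w \<noteq> 0"
    proof
      assume z: "cov m f p w = 0"
      let ?R = "real m * pi * h * norm w * (?W * sg)" and ?main = "of_real (real m * pi) * H w u * kern m (p + u) 0 p"
      have "- ?main = (\<Sum>a\<in>P. cov m (state m a) p w) + (cov m (state m (p + u)) p w - ?main) + cc * cov m (state m p) p w"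
        using z unfolding cov_f by (simp add: algebra_simps)
      then have "cmod (- ?main) = cmod ((\<Sum>a\<in>P. cov m (state m a) p w) + (cov m (state m (p + u)) p w - ?main) + cc * cov m (state m p) p w)"
        by (rule arg_cong)
      also have "\<dots> \<le> real k * ?R + ?R + 2 * ?R"
      proof (intro norm_triangle_mono shift_cov)
        have "cmod (\<Sum>a\<in>P. cov m (state m a) p w) \<le> (\<Sum>a\<in>P. ?R)"
          by (intro sum_norm_le far(2)) (use pP in auto)
        then show "cmod (\<Sum>a\<in>P. cov m (state m a) p w) \<le> real k * ?R" by (simp add: k_def)
        show "cmod (cc * cov m (state m p) p w) \<le> 2 * ?R"
          unfolding norm_mult using cc self(2)[of p w] by (intro mult_mono) auto
      qed
      also have "\<dots> = real m * pi * ?W * (B1 * exp (- ((real m - 2) * pi / 2) * \<tau>))"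
        by (simp add: B1_def sg_def algebra_simps)
      also have "\<dots> < real m * pi * ?W * (\<rho> * q w * exp (- (real m * pi / 2) * (\<tau> / 4)))"
        using m m1' Wp by (intro mult_strict_left_mono m1(2)) auto
      also have "\<dots> \<le> real m * pi * ?W * (\<rho> * q w * exp (- (real m * pi / 2) * q u))"
      proof (intro mult_left_mono)
        have "real m * pi / 2 * q u \<le> real m * pi / 2 * (\<tau> / 4)" by (intro mult_left_mono qu) auto
        then show "exp (- (real m * pi / 2) * (\<tau> / 4)) \<le> exp (- (real m * pi / 2) * q u)" by simp
      qed (use \<rho>(1) qw Wp in auto)
      also have "\<dots> = cmod (- ?main)"
      proof -
        \<comment> \<open>As u is a positive multiple of w, this value is real and positive, so the
          displaced state has a main term in direction w.\<close>
        have "H w u = of_real (\<rho> * q w)" by (simp add: u_def H_scale_right H_self)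
        then have "cmod (H w u) = \<rho> * q w" using \<rho>(1) qw by (simp only: norm_of_real) simp
        then show ?thesis by (simp add: norm_mult nk mult_ac)
      qed
      finally show False by simp
    qed
    \<comment> \<open>At the zero p of f the covariant derivative is the ordinary one.\<close>
    then have "frechet_derivative f (at p) w \<noteq> 0" by (simp add: cov_def fp)
    then show "\<exists>f. theta m f \<and> f p = 0 \<and> frechet_derivative f (at p) w \<noteq> 0 \<and> (\<forall>a\<in>P. f a \<noteq> 0)"
      using th_f fp fb by blast
  qed
qed

end

section \<open>Free quotients of polarized tori\<close>

text \<open>A finite base-point-free family of sections of some line bundle on the quotient; the
  bundle may change from list to list.\<close>

definition linear_system :: "real^'n^'n \<Rightarrow> (real^'n \<Rightarrow> 'b) \<Rightarrow> (real^'n \<Rightarrow> complex) list \<Rightarrow> bool" where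
  "linear_system J Q fs \<longleftrightarrow> (\<forall>f\<in>set fs. c1_holomorphic J f) \<and>
     (\<forall>x y. Q x = Q y \<longrightarrow> (\<exists>e. e \<noteq> 0 \<and> (\<forall>f\<in>set fs. f y = e * f x))) \<and> (\<forall>x. \<exists>f\<in>set fs. f x \<noteq> 0)"

definition proportional :: "(real^'n \<Rightarrow> complex) list \<Rightarrow> real^'n \<Rightarrow> real^'n \<Rightarrow> bool" where
  "proportional fs x y \<longleftrightarrow> (\<exists>e. \<forall>f\<in>set fs. f y = e * f x)"

text \<open>For a list without common zeros: w lies in the kernel of the differential, at x, of the
  map into projective space.\<close>

definition critical :: "(real^'n \<Rightarrow> complex) list \<Rightarrow> real^'n \<Rightarrow> real^'n \<Rightarrow> bool" where
  "critical fs x w \<longleftrightarrow> (\<exists>\<kappa>. \<forall>f\<in>set fs. frechet_derivative f (at x) w = \<kappa> * f x)"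

definition segre :: "(real^'n \<Rightarrow> complex) list \<Rightarrow> (real^'n \<Rightarrow> complex) list \<Rightarrow> (real^'n \<Rightarrow> complex) list" where
  "segre fs gs = concat (map (\<lambda>f. map (\<lambda>g x. f x * g x) gs) fs)"

lemma ball_segre: "(\<forall>k\<in>set (segre fs gs). R k) \<longleftrightarrow> (\<forall>f\<in>set fs. \<forall>g\<in>set gs. R (\<lambda>x. f x * g x))"
  by (auto simp: segre_def)

lemma bex_segre: "(\<exists>k\<in>set (segre fs gs). R k) \<longleftrightarrow> (\<exists>f\<in>set fs. \<exists>g\<in>set gs. R (\<lambda>x. f x * g x))"
  by (auto simp: segre_def)

lemma linear_systemD:
  assumes "linear_system J Q fs"
  shows "f \<in> set fs \<Longrightarrow> c1_holomorphic J f"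
    and "Q x = Q y \<Longrightarrow> \<exists>e. e \<noteq> 0 \<and> (\<forall>f\<in>set fs. f y = e * f x)"
    and "\<exists>f\<in>set fs. f x \<noteq> 0"
  using assms unfolding linear_system_def by simp_all

lemma linear_system_one: "linear_system J Q [\<lambda>_. 1]"
  by (auto simp: linear_system_def c1_holomorphic_const intro!: exI[of _ 1])

lemma linear_system_segre:
  assumes fs: "linear_system J Q fs" and gs: "linear_system J Q gs"
  shows "linear_system J Q (segre fs gs)"
  unfolding linear_system_def ball_segre bex_segre
proof (intro conjI allI impI ballI)
  fix f g assume "f \<in> set fs" "g \<in> set gs"
  then show "c1_holomorphic J (\<lambda>x. f x * g x)"
    by (intro c1_holomorphic_mult linear_systemD(1)[OF fs] linear_systemD(1)[OF gs])
next
  fix x y assume "Q x = Q y"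
  obtain d where d: "d \<noteq> 0" "\<forall>f\<in>set fs. f y = d * f x"
    using linear_systemD(2)[OF fs \<open>Q x = Q y\<close>] by (elim exE conjE) (rule that)
  obtain e where e: "e \<noteq> 0" "\<forall>f\<in>set gs. f y = e * f x"
    using linear_systemD(2)[OF gs \<open>Q x = Q y\<close>] by (elim exE conjE) (rule that)
  show "\<exists>e. e \<noteq> 0 \<and> (\<forall>f\<in>set fs. \<forall>g\<in>set gs. f y * g y = e * (f x * g x))"
  proof (intro exI[of _ "d * e"] conjI ballI)
    fix f g assume "f \<in> set fs" "g \<in> set gs"
    then have "f y = d * f x" "g y = e * g x" using d e by auto
    then show "f y * g y = d * e * (f x * g x)" by (simp add: mult_ac)
  qed (use d e in simp)
next
  fix x
  obtain f where f: "f \<in> set fs" "f x \<noteq> 0" using linear_systemD(3)[OF fs, of x] by (elim bexE) (rule that)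
  obtain g where g: "g \<in> set gs" "g x \<noteq> 0" using linear_systemD(3)[OF gs, of x] by (elim bexE) (rule that)
  show "\<exists>f\<in>set fs. \<exists>g\<in>set gs. f x * g x \<noteq> 0" using f g by (intro bexI[of _ f] bexI[of _ g]) auto
qed

text \<open>The factor e cannot be 0, so a member of \<open>gs\<close> that is nonzero at x is
  nonzero at y; dividing by it removes the second factor.\<close>

lemma proportional_factor:
  assumes fs: "linear_system J Q fs" and gs: "linear_system J Q gs"
    and pr: "\<And>f g. f \<in> set fs \<Longrightarrow> g \<in> set gs \<Longrightarrow> f y * g y = e * (f x * g x)"
  shows "proportional fs x y"
proof -
  obtain f0 where f0: "f0 \<in> set fs" "f0 x \<noteq> 0" using linear_systemD(3)[OF fs, of x] by (elim bexE) (rule that)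
  obtain g0 where g0: "g0 \<in> set gs" "g0 x \<noteq> 0" using linear_systemD(3)[OF gs, of x] by (elim bexE) (rule that)
  obtain f1 where f1: "f1 \<in> set fs" "f1 y \<noteq> 0" using linear_systemD(3)[OF fs, of y] by (elim bexE) (rule that)
  obtain g1 where g1: "g1 \<in> set gs" "g1 y \<noteq> 0" using linear_systemD(3)[OF gs, of y] by (elim bexE) (rule that)
  have "e \<noteq> 0" using pr[OF f1(1) g1(1)] f1 g1 by auto
  then have "g0 y \<noteq> 0" using pr[OF f0(1) g0(1)] f0 g0 by auto
  have "f y = (e * g0 x / g0 y) * f x" if "f \<in> set fs" for f
    using pr[OF that g0(1)] \<open>g0 y \<noteq> 0\<close> by (simp add: field_simps)
  then show ?thesis unfolding proportional_def by (intro exI ballI)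
qed

lemma proportional_segre:
  assumes fs: "linear_system J Q fs" and gs: "linear_system J Q gs" and p: "proportional (segre fs gs) x y"
  shows "proportional fs x y" "proportional gs x y"
proof -
  obtain e where e: "\<forall>f\<in>set fs. \<forall>g\<in>set gs. f y * g y = e * (f x * g x)"
    using p unfolding proportional_def ball_segre by (elim exE) (rule that)
  show "proportional fs x y" by (rule proportional_factor[OF fs gs, of y e x]) (use e in simp)
  show "proportional gs x y"
    by (rule proportional_factor[OF gs fs, of y e x]) (use e in \<open>metis mult.commute\<close>)
qed

text \<open>Dividing by a member g0 of \<open>gs\<close> that is nonzero at x removes the second
  factor; \<kappa> changes by the logarithmic derivative of g0.\<close>

lemma critical_factor:
  assumes fs: "linear_system J Q fs" and gs: "linear_system J Q gs"
    and pr: "\<And>f g. f \<in> set fs \<Longrightarrow> g \<in> set gs \<Longrightarrow>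
      f x * frechet_derivative g (at x) w + frechet_derivative f (at x) w * g x = \<kappa> * (f x * g x)"
  shows "critical fs x w"
proof -
  obtain g0 where g0: "g0 \<in> set gs" "g0 x \<noteq> 0" using linear_systemD(3)[OF gs, of x] by (elim bexE) (rule that)
  have "frechet_derivative f (at x) w = (\<kappa> - frechet_derivative g0 (at x) w / g0 x) * f x" if "f \<in> set fs" for f
    using pr[OF that g0(1)] g0(2) by (simp add: field_simps)
  then show ?thesis unfolding critical_def by (intro exI ballI)
qed

lemma critical_segre:
  assumes fs: "linear_system J Q fs" and gs: "linear_system J Q gs" and p: "critical (segre fs gs) x w"
  shows "critical fs x w" "critical gs x w"
proof -
  obtain \<kappa> where \<kappa>: "\<forall>f\<in>set fs. \<forall>g\<in>set gs. frechet_derivative (\<lambda>x. f x * g x) (at x) w = \<kappa> * (f x * g x)"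
    using p unfolding critical_def ball_segre by (elim exE) (rule that)
  have e: "f x * frechet_derivative g (at x) w + frechet_derivative f (at x) w * g x = \<kappa> * (f x * g x)"
    if "f \<in> set fs" "g \<in> set gs" for f g
    using \<kappa> that c1_holomorphic_mult(2)[OF linear_systemD(1)[OF fs that(1)] linear_systemD(1)[OF gs that(2)], of x w]
    by simp
  show "critical fs x w" by (rule critical_factor[OF fs gs e])
  show "critical gs x w"
  proof (rule critical_factor[OF gs fs, of x w \<kappa>])
    fix g f assume "g \<in> set gs" "f \<in> set fs"
    then show "g x * frechet_derivative f (at x) w + frechet_derivative g (at x) w * f x = \<kappa> * (g x * f x)"
      using e[of f g] by (simp only: mult.commute add.commute)
  qed
qed

text \<open>Without common zeros, proportionality means that all 2 x 2 minors of the values at x and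
  y vanish, which is a closed condition.\<close>

lemma open_not_proportional:
  assumes fs: "linear_system J Q fs"
  shows "open {z. \<not> proportional fs (fst z) (snd z)}"
proof -
  have iff: "proportional fs x y \<longleftrightarrow> (\<forall>f\<in>set fs. \<forall>g\<in>set fs. f x * g y = g x * f y)" for x y
  proof
    assume "proportional fs x y"
    then obtain e where e: "\<forall>f\<in>set fs. f y = e * f x" unfolding proportional_def by (elim exE) (rule that)
    have "f x * g y = g x * f y" if "f \<in> set fs" "g \<in> set fs" for f g
      by (simp add: bspec[OF e that(1)] bspec[OF e that(2)])
    then show "\<forall>f\<in>set fs. \<forall>g\<in>set fs. f x * g y = g x * f y" by (intro ballI)
  next
    assume H: "\<forall>f\<in>set fs. \<forall>g\<in>set fs. f x * g y = g x * f y"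
    obtain g where g: "g \<in> set fs" "g x \<noteq> 0" using linear_systemD(3)[OF fs, of x] by (elim bexE) (rule that)
    have "f y = (g y / g x) * f x" if "f \<in> set fs" for f
    proof -
      have "f x * g y = g x * f y" using H that g(1) by simp
      then show ?thesis using g(2) by (simp add: field_simps)
    qed
    then show "proportional fs x y" unfolding proportional_def by (intro exI ballI)
  qed
  have c: "continuous_on UNIV (\<lambda>z. f (h z))" if "f \<in> set fs" "continuous_on UNIV h"
    for f and h :: "(real^'a) \<times> (real^'a) \<Rightarrow> real^'a"
    by (rule continuous_on_compose2[OF c1_holomorphic_continuous[OF linear_systemD(1)[OF fs that(1)]] that(2) subset_UNIV])
  have "closed (\<Inter>f\<in>set fs. \<Inter>g\<in>set fs. {z. f (fst z) * g (snd z) = g (fst z) * f (snd z)})"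
    by (intro closed_INT ballI closed_Collect_eq continuous_on_mult c continuous_on_fst continuous_on_snd continuous_on_id)
  moreover have "{z. \<not> proportional fs (fst z) (snd z)} = - (\<Inter>f\<in>set fs. \<Inter>g\<in>set fs. {z. f (fst z) * g (snd z) = g (fst z) * f (snd z)})"
    by (auto simp: iff)
  ultimately show ?thesis by (simp only: open_Compl)
qed

lemma continuous_frechet_derivative:
  assumes f: "c1_holomorphic J f"
  shows "continuous_on UNIV (\<lambda>z. frechet_derivative f (at (fst z)) (snd z))"
proof -
  have e: "frechet_derivative f (at x) w = (\<Sum>i\<in>Basis. (w \<bullet> i) *\<^sub>R frechet_derivative f (at x) i)" for x w
  proof -
    have lin: "linear (frechet_derivative f (at x))" using c1_holomorphicD(1)[OF f] by (rule has_derivative_linear)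
    have "frechet_derivative f (at x) w = frechet_derivative f (at x) (\<Sum>i\<in>Basis. (w \<bullet> i) *\<^sub>R i)"
      by (simp add: euclidean_representation)
    then show ?thesis by (simp add: linear_sum[OF lin] linear_scale[OF lin])
  qed
  have "continuous_on UNIV (\<lambda>z. \<Sum>i\<in>Basis. (snd z \<bullet> i) *\<^sub>R frechet_derivative f (at (fst z)) i)"
    by (intro continuous_intros continuous_on_compose2[OF c1_holomorphicD(3)[OF f]]) auto
  then show ?thesis by (subst e)
qed

lemma open_not_critical:
  assumes fs: "linear_system J Q fs"
  shows "open {z. \<not> critical fs (fst z) (snd z)}"
proof -
  let ?d = "\<lambda>f x. frechet_derivative f (at x)"
  have iff: "critical fs x w \<longleftrightarrow> (\<forall>f\<in>set fs. \<forall>g\<in>set fs. f x * ?d g x w = g x * ?d f x w)" for x w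
  proof
    assume "critical fs x w"
    then obtain e where e: "\<forall>f\<in>set fs. ?d f x w = e * f x" unfolding critical_def by (elim exE) (rule that)
    then show "\<forall>f\<in>set fs. \<forall>g\<in>set fs. f x * ?d g x w = g x * ?d f x w"
      by (intro ballI) simp
  next
    assume H: "\<forall>f\<in>set fs. \<forall>g\<in>set fs. f x * ?d g x w = g x * ?d f x w"
    obtain g where g: "g \<in> set fs" "g x \<noteq> 0" using linear_systemD(3)[OF fs, of x] by (elim bexE) (rule that)
    have "?d f x w = (?d g x w / g x) * f x" if "f \<in> set fs" for f
    proof -
      have "f x * ?d g x w = g x * ?d f x w" using H that g(1) by simp
      then show ?thesis using g(2) by (simp add: field_simps)
    qed
    then show "critical fs x w" unfolding critical_def by (intro exI ballI)
  qed
  have c: "continuous_on UNIV (\<lambda>z::(real^'a) \<times> (real^'a). f (fst z))" if "f \<in> set fs" for f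
    by (rule continuous_on_compose2[OF c1_holomorphic_continuous[OF linear_systemD(1)[OF fs that]]]) (auto intro!: continuous_intros)
  have "closed (\<Inter>f\<in>set fs. \<Inter>g\<in>set fs. {z. f (fst z) * ?d g (fst z) (snd z) = g (fst z) * ?d f (fst z) (snd z)})"
    by (intro closed_INT ballI closed_Collect_eq continuous_on_mult c
        continuous_frechet_derivative[OF linear_systemD(1)[OF fs]])
  moreover have "{z. \<not> critical fs (fst z) (snd z)} = - (\<Inter>f\<in>set fs. \<Inter>g\<in>set fs. {z. f (fst z) * ?d g (fst z) (snd z) = g (fst z) * ?d f (fst z) (snd z)})"
    by (auto simp: iff)
  ultimately show ?thesis by (simp only: open_Compl)
qed

text \<open>A Segre product inherits whatever one of its factors achieves, so local solutions over a
  finite subcover combine into one. This is applied to unit tangent vectors and to pairs of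
  points.\<close>

lemma linear_system_compactness:
  fixes R :: "(real^'n \<Rightarrow> complex) list \<Rightarrow> 'c::topological_space \<Rightarrow> bool"
  assumes C: "compact C"
    and loc: "\<And>z. z \<in> C \<Longrightarrow> \<exists>fs U. linear_system J Q fs \<and> open U \<and> z \<in> U \<and> (\<forall>z'\<in>U. R fs z')"
    and mono: "\<And>fs gs z. linear_system J Q fs \<Longrightarrow> linear_system J Q gs \<Longrightarrow> R fs z \<or> R gs z \<Longrightarrow> R (segre fs gs) z"
  obtains fs where "linear_system J Q fs" "\<forall>z\<in>C. R fs z"
proof -
  have "\<forall>z. \<exists>fs U. z \<in> C \<longrightarrow> linear_system J Q fs \<and> open U \<and> z \<in> U \<and> (\<forall>z'\<in>U. R fs z')"
    using loc by simp
  then obtain F U where FU: "\<forall>z. z \<in> C \<longrightarrow> linear_system J Q (F z) \<and> open (U z) \<and> z \<in> U z \<and> (\<forall>z'\<in>U z. R (F z) z')"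
    unfolding choice_iff by (elim exE) (rule that)
  obtain T where T: "T \<subseteq> C" "finite T" "C \<subseteq> (\<Union>z\<in>T. U z)"
  proof (rule compactE_image[OF C, of C U])
    show "open (U z)" if "z \<in> C" for z using FU that by simp
    show "C \<subseteq> (\<Union>z\<in>C. U z)" using FU by auto
  qed (rule that)
  have "\<exists>fs. linear_system J Q fs \<and> (\<forall>z\<in>T. \<forall>z'\<in>U z. R fs z')"
    using T(2,1)
  proof (induction T rule: finite_induct)
    case empty
    then show ?case using linear_system_one by blast
  next
    case (insert z T)
    then obtain fs where fs: "linear_system J Q fs" "\<forall>z\<in>T. \<forall>z'\<in>U z. R fs z'" by auto
    have Fz: "linear_system J Q (F z)" "\<forall>z'\<in>U z. R (F z) z'" using FU insert.prems by auto
    show ?case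
      by (rule exI[of _ "segre (F z) fs"]) (use fs Fz mono linear_system_segre in auto)
  qed
  then obtain fs where fs: "linear_system J Q fs" "\<forall>z\<in>T. \<forall>z'\<in>U z. R fs z'" by (elim exE conjE) (rule that)
  show thesis
  proof (rule that[OF fs(1)], rule ballI)
    fix z assume "z \<in> C"
    then obtain t where "t \<in> T" "z \<in> U t" using T(3) by blast
    then show "R fs z" using fs(2) by simp
  qed
qed

text \<open>The local inverse recovers x from the ratios of the functions. This treats pairs near
  the diagonal, where separating a single pair gives nothing.\<close>

lemma immersive_imp_locally_separating:
  fixes J :: "real^'n^'n"
  assumes J: "J ** J = - mat 1" and fs: "linear_system J Q fs"
    and imm: "\<And>w. w \<noteq> 0 \<Longrightarrow> \<not> critical fs x0 w"
  obtains A where "open A" "x0 \<in> A" "\<And>x y. x \<in> A \<Longrightarrow> y \<in> A \<Longrightarrow> proportional fs x y \<Longrightarrow> x = y"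
proof -
  define N where "N = length fs - 1"
  have "fs \<noteq> []" using linear_systemD(3)[OF fs] by auto
  then have le: "i \<le> N \<longleftrightarrow> i < length fs" for i unfolding N_def by (cases fs) auto
  have hol: "c1_holomorphic J (fs ! i)" if "i \<le> N" for i
    using linear_systemD(1)[OF fs] that by (simp add: le)
  obtain f where "f \<in> set fs" "f x0 \<noteq> 0" using linear_systemD(3)[OF fs, of x0] by (elim bexE) (rule that)
  then obtain j where j: "j \<le> N" "(fs ! j) x0 \<noteq> 0" by (auto simp: in_set_conv_nth le)
  have imm': "v = 0" if "\<And>i. i \<le> N \<Longrightarrow> frechet_derivative (fs ! i) (at x0) v = \<kappa> * (fs ! i) x0" for v \<kappa>
  proof (rule ccontr)
    assume "v \<noteq> 0"
    moreover have "critical fs x0 v" unfolding critical_def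
      using that by (intro exI[of _ \<kappa>]) (auto simp: in_set_conv_nth le)
    ultimately show False using imm by blast
  qed
  obtain A and g :: "real^'n \<Rightarrow> real^'n" and L where A: "open A" "x0 \<in> A" "\<And>x. x \<in> A \<Longrightarrow> (fs ! j) x \<noteq> 0"
    and g: "\<And>x. x \<in> A \<Longrightarrow> g (\<Sum>i\<le>N. L i ((fs ! i) x / (fs ! j) x)) = x"
  proof (rule immersion_local_inverse[where F = "\<lambda>i. fs ! i", OF J _ j])
    fix L :: "nat \<Rightarrow> complex \<Rightarrow> real^'n" and A B and g :: "real^'n \<Rightarrow> real^'n"
    assume *: "open A" "x0 \<in> A" "\<And>x. x \<in> A \<Longrightarrow> (fs ! j) x \<noteq> 0"
      "\<And>x. x \<in> A \<Longrightarrow> g (\<Sum>i\<le>N. L i ((fs ! i) x / (fs ! j) x)) = x"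
    show thesis by (rule that[of A g L, OF *])
  next
    show "c1_holomorphic J (fs ! i)" if "i \<le> N" for i by (rule hol[OF that])
    show "v = 0" if "\<And>i. i \<le> N \<Longrightarrow> frechet_derivative (fs ! i) (at x0) v = \<kappa> * (fs ! i) x0" for v \<kappa>
      by (rule imm'[OF that])
  qed
  show thesis
  proof (rule that[OF A(1,2)])
    fix x y assume x: "x \<in> A" and y: "y \<in> A" and "proportional fs x y"
    then obtain e where e: "\<forall>f\<in>set fs. f y = e * f x" unfolding proportional_def by (elim exE) (rule that)
    then have ei: "(fs ! i) y = e * (fs ! i) x" if "i \<le> N" for i using that by (simp add: le)
    then have "e \<noteq> 0" using A(3)[OF y] j(1) by auto
    then have "(fs ! i) y / (fs ! j) y = (fs ! i) x / (fs ! j) x" if "i \<le> N" for i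
      using ei[OF that] ei[OF j(1)] by simp
    then have "(\<Sum>i\<le>N. L i ((fs ! i) y / (fs ! j) y)) = (\<Sum>i\<le>N. L i ((fs ! i) x / (fs ! j) x))"
      by (intro sum.cong) simp_all
    then show "x = y" using g[OF x] g[OF y] by simp
  qed
qed

text \<open>I indexes affine lifts of the group elements. Lifts multiply only modulo \<Lambda>: the
  lift of the identity may be a translation by a lattice vector, and the group law enters through
  right translations, as permutations \<sigma> of I.\<close>

locale free_torus_quotient = polarized_torus \<Lambda> J E
  for \<Lambda> :: "(real^'n) set" and J E :: "real^'n^'n" +
  fixes I :: "'i set" and A :: "'i \<Rightarrow> real^'n^'n" and b :: "'i \<Rightarrow> real^'n" and one :: 'i and Q :: "real^'n \<Rightarrow> 'b"
  assumes finite_I: "finite I" and A_J: "i \<in> I \<Longrightarrow> A i ** J = J ** A i"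
    and A_lattice: "i \<in> I \<Longrightarrow> l \<in> \<Lambda> \<Longrightarrow> A i *v l \<in> \<Lambda>"
    and Q_eq_iff: "Q x = Q y \<longleftrightarrow> (\<exists>i\<in>I. A i *v x + b i - y \<in> \<Lambda>)"
    and free: "i \<in> I \<Longrightarrow> j \<in> I \<Longrightarrow> i \<noteq> j \<Longrightarrow> (A i *v x + b i) - (A j *v x + b j) \<notin> \<Lambda>"
    and one: "one \<in> I" "A one = mat 1" "b one \<in> \<Lambda>"
    and mult: "i \<in> I \<Longrightarrow> \<exists>\<sigma>. bij_betw \<sigma> I I \<and>
      (\<forall>h\<in>I. \<forall>x. (A h *v (A i *v x + b i) + b h) - (A (\<sigma> h) *v x + b (\<sigma> h)) \<in> \<Lambda>)"
begin

abbreviation \<gamma> :: "'i \<Rightarrow> real^'n \<Rightarrow> real^'n" where "\<gamma> i x \<equiv> A i *v x + b i"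

definition Norm :: "(real^'n \<Rightarrow> complex) \<Rightarrow> real^'n \<Rightarrow> complex" where
  "Norm s x = (\<Prod>i\<in>I. s (\<gamma> i x))"

lemma lattice_add: "x \<in> \<Lambda> \<Longrightarrow> y \<in> \<Lambda> \<Longrightarrow> x + y \<in> \<Lambda>" and lattice_diff: "x \<in> \<Lambda> \<Longrightarrow> y \<in> \<Lambda> \<Longrightarrow> x - y \<in> \<Lambda>"
  and lattice_minus: "x \<in> \<Lambda> \<Longrightarrow> - x \<in> \<Lambda>" and lattice_zero: "0 \<in> \<Lambda>"
  using full_lattice_subgroup[OF lat] by auto

lemma Q_translate: "l \<in> \<Lambda> \<Longrightarrow> Q (x + l) = Q x"
  unfolding Q_eq_iff using one by (intro bexI[of _ one]) (auto intro: lattice_add)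

lemma Norm_c1:
  assumes "theta m s"
  shows "c1_holomorphic J (Norm s)"
  unfolding Norm_def[abs_def]
  using assms by (intro c1_holomorphic_prod finite_I c1_holomorphic_affine A_J) (auto simp: theta_def)

text \<open>Replacing x by another point y over the same orbit permutes the factors up to lattice
  translations, each of which contributes an automorphy factor. Their product depends on m, x and y
  but not on s.\<close>

lemma Norm_coherent:
  assumes "Q x = Q y"
  obtains e where "e \<noteq> 0" "\<And>s. theta m s \<Longrightarrow> Norm s y = e * Norm s x"
proof -
  obtain i where i: "i \<in> I" "\<gamma> i x - y \<in> \<Lambda>" using assms unfolding Q_eq_iff by (elim bexE) (rule that)
  define l where "l = y - \<gamma> i x"
  have l: "l \<in> \<Lambda>" "y = \<gamma> i x + l" using lattice_minus[OF i(2)] by (simp_all add: l_def)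
  obtain \<sigma> where \<sigma>: "bij_betw \<sigma> I I" "\<forall>h\<in>I. \<forall>x. \<gamma> h (\<gamma> i x) - \<gamma> (\<sigma> h) x \<in> \<Lambda>"
    using mult[OF i(1)] by (elim exE conjE) (rule that)
  define k where "k h = \<gamma> h y - \<gamma> (\<sigma> h) x" for h
  have k: "k h \<in> \<Lambda>" if h: "h \<in> I" for h
  proof -
    have "k h = (\<gamma> h (\<gamma> i x) - \<gamma> (\<sigma> h) x) + A h *v l"
      by (simp add: k_def l(2) matrix_vector_right_distrib)
    then show ?thesis using lattice_add[OF bspec[OF \<sigma>(2) h, THEN spec] A_lattice[OF h l(1)]] by simp
  qed
  show thesis
  proof (rule that[of "\<Prod>h\<in>I. automorphy m (k h) (\<gamma> (\<sigma> h) x)"])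
    show "(\<Prod>h\<in>I. automorphy m (k h) (\<gamma> (\<sigma> h) x)) \<noteq> 0"
      using finite_I by (simp add: automorphy_def)
    fix s assume s: "theta m s"
    have "s (\<gamma> h y) = automorphy m (k h) (\<gamma> (\<sigma> h) x) * s (\<gamma> (\<sigma> h) x)" if h: "h \<in> I" for h
    proof -
      have "s (\<gamma> (\<sigma> h) x + k h) = automorphy m (k h) (\<gamma> (\<sigma> h) x) * s (\<gamma> (\<sigma> h) x)"
        using s k[OF h] by (simp add: theta_def)
      then show ?thesis by (simp add: k_def)
    qed
    then have "Norm s y = (\<Prod>h\<in>I. automorphy m (k h) (\<gamma> (\<sigma> h) x) * s (\<gamma> (\<sigma> h) x))"
      unfolding Norm_def by (intro prod.cong refl)
    also have "\<dots> = (\<Prod>h\<in>I. automorphy m (k h) (\<gamma> (\<sigma> h) x)) * (\<Prod>h\<in>I. s (\<gamma> (\<sigma> h) x))"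
      by (rule prod.distrib)
    also have "(\<Prod>h\<in>I. s (\<gamma> (\<sigma> h) x)) = Norm s x"
      unfolding Norm_def by (rule prod.reindex_bij_betw[OF \<sigma>(1)])
    finally show "Norm s y = (\<Prod>h\<in>I. automorphy m (k h) (\<gamma> (\<sigma> h) x)) * Norm s x" .
  qed
qed

text \<open>By freeness the torus distance between two translates of x is positive. It is
  \<Lambda>-periodic in x because A i and A j preserve \<Lambda>, so compactness gives one lower
  bound for all x.\<close>

lemma orbits_separated:
  obtains D where "D > 0" "\<And>x. lattice_separated D ((\<lambda>i. \<gamma> i x) ` I)"
proof -
  obtain \<delta> where \<delta>: "\<delta> > 0" "\<And>l. l \<in> \<Lambda> \<Longrightarrow> l \<noteq> 0 \<Longrightarrow> \<delta> \<le> norm l"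
    by (rule full_lattice_discrete[OF lat]) (rule that)
  obtain R where R: "R > 0" "\<And>x. \<exists>l\<in>\<Lambda>. norm (x - l) \<le> R"
    by (rule full_lattice_covering[OF lat]) (rule that)
  have pos: "\<exists>d>0. \<forall>x\<in>cball 0 R. d \<le> infdist (\<gamma> i x - \<gamma> j x) \<Lambda>" if ij: "i \<in> I" "j \<in> I" "i \<noteq> j" for i j
  proof -
    have "continuous_on (cball 0 R) (\<lambda>x. infdist (\<gamma> i x - \<gamma> j x) \<Lambda>)"
      by (intro continuous_on_infdist continuous_intros)
    moreover have "cball (0::real^'n) R \<noteq> {}" using R(1) by simp
    ultimately have "\<exists>x0\<in>cball 0 R. \<forall>x\<in>cball 0 R. infdist (\<gamma> i x0 - \<gamma> j x0) \<Lambda> \<le> infdist (\<gamma> i x - \<gamma> j x) \<Lambda>"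
      by (intro continuous_attains_inf compact_cball)
    then obtain x0 where x0: "x0 \<in> cball 0 R" "\<forall>x\<in>cball 0 R. infdist (\<gamma> i x0 - \<gamma> j x0) \<Lambda> \<le> infdist (\<gamma> i x - \<gamma> j x) \<Lambda>"
      by (elim bexE) (rule that)
    show ?thesis
      by (rule exI[of _ "infdist (\<gamma> i x0 - \<gamma> j x0) \<Lambda>"]) (intro conjI infdist_lattice(1)[OF lat free[OF ij]] x0(2))
  qed
  have "\<forall>p\<in>{(i, j) \<in> I \<times> I. i \<noteq> j}. \<exists>d. d > 0 \<and> (\<forall>x\<in>cball 0 R. d \<le> infdist (\<gamma> (fst p) x - \<gamma> (snd p) x) \<Lambda>)"
  proof
    fix p assume "p \<in> {(i, j) \<in> I \<times> I. i \<noteq> j}"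
    then have "fst p \<in> I" "snd p \<in> I" "fst p \<noteq> snd p" by auto
    then show "\<exists>d. d > 0 \<and> (\<forall>x\<in>cball 0 R. d \<le> infdist (\<gamma> (fst p) x - \<gamma> (snd p) x) \<Lambda>)" by (rule pos)
  qed
  from bchoice[OF this] obtain d where
    d: "\<forall>p\<in>{(i, j) \<in> I \<times> I. i \<noteq> j}. d p > 0 \<and> (\<forall>x\<in>cball 0 R. d p \<le> infdist (\<gamma> (fst p) x - \<gamma> (snd p) x) \<Lambda>)"
    by (elim exE) (rule that)
  define D where "D = Min (insert \<delta> (d ` {(i, j) \<in> I \<times> I. i \<noteq> j}))"
  have "{(i, j) \<in> I \<times> I. i \<noteq> j} \<subseteq> I \<times> I" by blast
  then have "finite {(i, j) \<in> I \<times> I. i \<noteq> j}"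
    using finite_cartesian_product[OF finite_I finite_I] by (rule finite_subset)
  then have fS: "finite (d ` {(i, j) \<in> I \<times> I. i \<noteq> j})" by (rule finite_imageI)
  have "D > 0" unfolding D_def using \<delta>(1) d fS by (subst Min_gr_iff) auto
  moreover have "lattice_separated D ((\<lambda>i. \<gamma> i x) ` I)" for x
    unfolding lattice_separated_def
  proof (intro ballI impI)
    fix a a' l assume "a \<in> (\<lambda>i. \<gamma> i x) ` I" "a' \<in> (\<lambda>i. \<gamma> i x) ` I" and l: "l \<in> \<Lambda>" "a \<noteq> a' \<or> l \<noteq> 0"
    then obtain i j where ij: "i \<in> I" "j \<in> I" "a = \<gamma> i x" "a' = \<gamma> j x" by auto
    show "D \<le> norm (a - a' + l)"
    proof (cases "i = j")
      case True
      have "D \<le> \<delta>" unfolding D_def using fS by (intro Min_le) auto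
      then show ?thesis using True ij l \<delta>(2)[of l] by simp
    next
      case False
      obtain k where k: "k \<in> \<Lambda>" "norm (x - k) \<le> R" using R(2) by blast
      have "D \<le> d (i, j)" unfolding D_def using fS ij False by (intro Min_le) auto
      also have "\<dots> \<le> infdist (\<gamma> i (x - k) - \<gamma> j (x - k)) \<Lambda>"
        using bspec[OF d, of "(i, j)"] ij False k(2) by simp
      also have "\<dots> \<le> norm ((\<gamma> i (x - k) - \<gamma> j (x - k)) + (A i *v k - A j *v k + l))"
        by (intro infdist_lattice(2)[OF lat] lattice_add lattice_diff A_lattice ij k l)
      also have "(\<gamma> i (x - k) - \<gamma> j (x - k)) + (A i *v k - A j *v k + l) = a - a' + l"
        by (simp add: ij matrix_vector_mult_diff_distrib)
      finally show ?thesis .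
    qed
  qed
  ultimately show thesis by (rule that)
qed

lemma fundamental_domain:
  obtains R where "R > 0" "\<And>x. \<exists>x'\<in>cball 0 R. Q x' = Q x"
proof -
  obtain R where R: "R > 0" "\<And>x. \<exists>l\<in>\<Lambda>. norm (x - l) \<le> R"
    by (rule full_lattice_covering[OF lat]) (rule that)
  have "\<exists>x'\<in>cball 0 R. Q x' = Q x" for x
  proof -
    obtain l where l: "l \<in> \<Lambda>" "norm (x - l) \<le> R" using R(2) by blast
    then show ?thesis using Q_translate[OF l(1), of "x - l"] by (intro bexI[of _ "x - l"]) auto
  qed
  then show thesis using that R(1) by blast
qed

text \<open>Finitely many norms of the same weight remove the common zeros on a compact ball, and
  coherence carries this to all points. Uniform separation of orbits makes m0 independent of the
  point and of s.\<close>

lemma linear_system_with: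
  obtains m0 where "\<And>m s. m \<ge> m0 \<Longrightarrow> theta m s \<Longrightarrow> \<exists>fs. linear_system J Q fs \<and> Norm s \<in> set fs"
proof -
  obtain D where D: "D > 0" "\<And>x. lattice_separated D ((\<lambda>i. \<gamma> i x) ` I)"
    by (rule orbits_separated) (rule that)
  obtain m0 where m0: "m0 \<ge> 1" "\<And>m P. m \<ge> m0 \<Longrightarrow> finite P \<Longrightarrow> card P \<le> card I \<Longrightarrow> lattice_separated D P \<Longrightarrow>
    \<exists>f. theta m f \<and> (\<forall>a\<in>P. f a \<noteq> 0)"
    by (rule theta_nonvanishing[OF D(1)]) (rule that)
  obtain R where R: "R > 0" "\<And>x. \<exists>x'\<in>cball 0 R. Q x' = Q x"
    by (rule fundamental_domain) (rule that)
  show thesis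
  proof (rule that[of m0])
    fix m s assume m: "m \<ge> m0" and s: "theta m s"
    have "\<exists>f. theta m f \<and> Norm f x \<noteq> 0" for x
    proof -
      obtain f where "theta m f" "\<forall>a\<in>(\<lambda>i. \<gamma> i x) ` I. f a \<noteq> 0"
        using m0(2)[OF m finite_imageI[OF finite_I] card_image_le[OF finite_I] D(2)[of x]] by (elim exE conjE) (rule that)
      then show ?thesis using finite_I by (intro exI[of _ f]) (simp add: Norm_def)
    qed
    then have "\<forall>x. \<exists>f. theta m f \<and> Norm f x \<noteq> 0" ..
    then obtain F where F: "\<forall>x. theta m (F x) \<and> Norm (F x) x \<noteq> 0"
      unfolding choice_iff by (elim exE) (rule that)
    have "open {y. Norm (F x) y \<noteq> 0}" for x
    proof (rule open_Collect_neq)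
      show "continuous_on UNIV (Norm (F x))" using F by (intro c1_holomorphic_continuous[OF Norm_c1[of m]]) simp
    qed simp
    then obtain T where T: "T \<subseteq> cball 0 R" "finite T" "cball 0 R \<subseteq> (\<Union>x\<in>T. {y. Norm (F x) y \<noteq> 0})"
      using F by (elim compactE_image[OF compact_cball, of "cball 0 R" "\<lambda>x. {y. Norm (F x) y \<noteq> 0}", rotated 2]) auto
    obtain xs where xs: "set xs = T" using finite_list[OF T(2)] by (elim exE) (rule that)
    let ?fs = "map Norm (s # map F xs)"
    have th: "\<exists>t. theta m t \<and> f = Norm t" if "f \<in> set ?fs" for f
      using that s F by auto
    have coh: "\<exists>e. e \<noteq> 0 \<and> (\<forall>f\<in>set ?fs. f y = e * f x)" if Qxy: "Q x = Q y" for x y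
    proof -
      obtain e where e: "e \<noteq> 0" "\<And>s. theta m s \<Longrightarrow> Norm s y = e * Norm s x"
        by (rule Norm_coherent[OF Qxy]) (rule that)
      then show ?thesis using th by (intro exI[of _ e]) blast
    qed
    have "linear_system J Q ?fs"
      unfolding linear_system_def
    proof (intro conjI allI impI ballI)
      show "c1_holomorphic J f" if "f \<in> set ?fs" for f using th[OF that] Norm_c1 by blast
      show "\<exists>e. e \<noteq> 0 \<and> (\<forall>f\<in>set ?fs. f y = e * f x)" if "Q x = Q y" for x y by (rule coh[OF that])
      fix x
      obtain x' where x': "x' \<in> cball 0 R" "Q x' = Q x" using R(2) by blast
      then obtain z where z: "z \<in> T" "Norm (F z) x' \<noteq> 0" using T(3) by blast
      obtain e where e: "e \<noteq> 0" "\<forall>f\<in>set ?fs. f x = e * f x'" using coh[OF x'(2)] by (elim exE conjE) (rule that)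
      have mem: "Norm (F z) \<in> set ?fs" using z(1) xs by simp
      have "Norm (F z) x = e * Norm (F z) x'" using bspec[OF e(2) mem] .
      then have "Norm (F z) x \<noteq> 0" using e(1) z(2) by simp
      then show "\<exists>f\<in>set ?fs. f x \<noteq> 0" using mem by (intro bexI[of _ "Norm (F z)"])
    qed
    moreover have "Norm s \<in> set ?fs" by simp
    ultimately show "\<exists>fs. linear_system J Q fs \<and> Norm s \<in> set fs" by blast
  qed
qed

text \<open>A theta function vanishing over y but nowhere on the orbit of x has a norm that vanishes
  at y and not at x.\<close>

lemma separating_system:
  assumes ne: "Q x \<noteq> Q y"
  obtains fs where "linear_system J Q fs" "\<not> proportional fs x y"
proof -
  obtain m0 where m0: "\<And>m s. m \<ge> m0 \<Longrightarrow> theta m s \<Longrightarrow> \<exists>fs. linear_system J Q fs \<and> Norm s \<in> set fs"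
    by (rule linear_system_with) (rule that)
  \<comment> \<open>The point is \<gamma> one y instead of y because the lift of the identity may be
    a nonzero lattice translation.\<close>
  let ?P = "(\<lambda>i. \<gamma> i x) ` I" and ?p = "\<gamma> one y"
  have far: "\<gamma> i x - ?p \<notin> \<Lambda>" if i: "i \<in> I" for i
  proof
    assume "\<gamma> i x - ?p \<in> \<Lambda>"
    then have "(\<gamma> i x - ?p) + b one \<in> \<Lambda>" using one(3) by (rule lattice_add)
    then have "\<gamma> i x - y \<in> \<Lambda>" by (simp add: one(2) algebra_simps)
    then show False using ne i unfolding Q_eq_iff by blast
  qed
  obtain w :: "real^'n" where w: "w \<noteq> 0" using one_neq_zero vec_eq_iff[of 1 0] by (metis one_index zero_index)
  obtain m1 where m1: "\<And>m. m \<ge> m1 \<Longrightarrow>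
    \<exists>f. theta m f \<and> f ?p = 0 \<and> frechet_derivative f (at ?p) w \<noteq> 0 \<and> (\<forall>a\<in>?P. f a \<noteq> 0)"
  proof (rule theta_interpolation[of ?P ?p w])
    show "finite ?P" using finite_I by simp
    show "?p \<notin> ?P"
    proof
      assume "?p \<in> ?P"
      then obtain i where "i \<in> I" "?p = \<gamma> i x" by auto
      then show False using far[of i] lattice_zero by simp
    qed
    show "w \<noteq> 0" by (rule w)
    show "a - a' \<notin> \<Lambda>" if mem: "a \<in> insert ?p ?P" "a' \<in> insert ?p ?P" and ne': "a \<noteq> a'" for a a'
    proof -
      consider (both) "a \<in> ?P" "a' \<in> ?P" | (left) "a \<in> ?P" "a' = ?p" | (right) "a = ?p" "a' \<in> ?P"
        using mem ne' by auto
      then show ?thesis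
      proof cases
        case both
        then obtain i j where "i \<in> I" "j \<in> I" "a = \<gamma> i x" "a' = \<gamma> j x" by (elim imageE) blast
        then show ?thesis using free[of i j x] ne' by auto
      next
        case left
        then show ?thesis using far by auto
      next
        case right
        then show ?thesis using far lattice_minus[of "a - a'"] by auto
      qed
    qed
  qed (rule that)
  define m where "m = max m0 m1"
  obtain f where f: "theta m f" "f ?p = 0" "\<forall>a\<in>?P. f a \<noteq> 0"
    using m1[of m] by (auto simp: m_def)
  obtain fs where fs: "linear_system J Q fs" "Norm f \<in> set fs"
    using m0[OF _ f(1)] by (auto simp: m_def)
  have Nx: "Norm f x \<noteq> 0" using f(3) finite_I by (simp add: Norm_def)
  have Ny: "Norm f y = 0" using f(2) finite_I one(1) by (auto simp: Norm_def)
  have "\<not> proportional fs x y"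
  proof
    assume "proportional fs x y"
    then obtain e where e: "\<forall>f\<in>set fs. f y = e * f x" unfolding proportional_def by (elim exE) (rule that)
    then have "e = 0" using bspec[OF e fs(2)] Nx Ny by simp
    then show False using e linear_systemD(3)[OF fs(1), of y] by auto
  qed
  then show thesis using that fs(1) by blast
qed

text \<open>By freeness a theta function can be chosen to vanish at one point of the orbit, with
  nonzero derivative, and at no other. One term of the product rule survives; the norm then vanishes
  at x with nonzero derivative along w, which excludes criticality.\<close>

lemma immersive_system:
  assumes w: "w \<noteq> 0"
  obtains fs where "linear_system J Q fs" "\<not> critical fs x w"
proof -
  obtain m0 where m0: "\<And>m s. m \<ge> m0 \<Longrightarrow> theta m s \<Longrightarrow> \<exists>fs. linear_system J Q fs \<and> Norm s \<in> set fs"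
    by (rule linear_system_with) (rule that)
  let ?P = "(\<lambda>i. \<gamma> i x) ` (I - {one})" and ?p = "\<gamma> one x"
  obtain m1 where m1: "\<And>m. m \<ge> m1 \<Longrightarrow>
    \<exists>f. theta m f \<and> f ?p = 0 \<and> frechet_derivative f (at ?p) w \<noteq> 0 \<and> (\<forall>a\<in>?P. f a \<noteq> 0)"
  proof (rule theta_interpolation[of ?P ?p w])
    show "finite ?P" using finite_I by simp
    show "?p \<notin> ?P"
    proof
      assume "?p \<in> ?P"
      then obtain i where "i \<in> I" "i \<noteq> one" "?p = \<gamma> i x" by auto
      then show False using free[of one i x] one(1) lattice_zero by simp
    qed
    show "w \<noteq> 0" by (rule w)
    show "a - a' \<notin> \<Lambda>" if "a \<in> insert ?p ?P" "a' \<in> insert ?p ?P" "a \<noteq> a'" for a a'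
    proof -
      have "a \<in> (\<lambda>i. \<gamma> i x) ` I" "a' \<in> (\<lambda>i. \<gamma> i x) ` I" using that(1,2) one(1) by auto
      then obtain i j where "i \<in> I" "j \<in> I" "a = \<gamma> i x" "a' = \<gamma> j x" by (elim imageE) blast
      then show ?thesis using free[of i j x] that(3) by auto
    qed
  qed (rule that)
  define m where "m = max m0 m1"
  obtain f where f: "theta m f" "f ?p = 0" "frechet_derivative f (at ?p) w \<noteq> 0" "\<forall>a\<in>?P. f a \<noteq> 0"
    using m1[of m] by (auto simp: m_def)
  obtain fs where fs: "linear_system J Q fs" "Norm f \<in> set fs"
    using m0[OF _ f(1)] by (auto simp: m_def)
  have fc: "c1_holomorphic J f" using f(1) by (simp add: theta_def)
  have c1: "c1_holomorphic J (\<lambda>x. f (\<gamma> i x))" if "i \<in> I" for i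
    by (rule c1_holomorphic_affine(1)[OF fc A_J[OF that]])
  have split: "Norm f = (\<lambda>x. f (\<gamma> one x) * (\<Prod>i\<in>I - {one}. f (\<gamma> i x)))"
    unfolding Norm_def[abs_def] by (intro ext prod.remove finite_I one(1))
  have "frechet_derivative (Norm f) (at x) w =
      f (\<gamma> one x) * frechet_derivative (\<lambda>x. \<Prod>i\<in>I - {one}. f (\<gamma> i x)) (at x) w +
      frechet_derivative (\<lambda>x. f (\<gamma> one x)) (at x) w * (\<Prod>i\<in>I - {one}. f (\<gamma> i x))"
    unfolding split by (rule c1_holomorphic_mult(2)[OF c1[OF one(1)] c1_holomorphic_prod]) (use finite_I c1 in auto)
  also have "\<dots> = frechet_derivative f (at ?p) w * (\<Prod>i\<in>I - {one}. f (\<gamma> i x))"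
    using c1_holomorphic_affine(2)[OF fc A_J[OF one(1)], of "b one" x w] f(2) by (simp add: one(2))
  finally have "frechet_derivative (Norm f) (at x) w \<noteq> 0" using f(3,4) finite_I by simp
  moreover have "Norm f x = 0" unfolding split using f(2) by simp
  ultimately have "\<not> critical fs x w" unfolding critical_def using fs(2) by (metis mult_zero_right)
  then show thesis using that fs(1) by blast
qed

lemma Q_open:
  assumes "open S"
  shows "open {x. Q x \<in> Q ` S}"
proof -
  have "{x. Q x \<in> Q ` S} = (\<Union>i\<in>I. \<Union>l\<in>\<Lambda>. (\<lambda>x. \<gamma> i x - l) -` S)"
  proof (intro equalityI subsetI)
    fix x assume "x \<in> {x. Q x \<in> Q ` S}"
    then obtain y where y: "y \<in> S" "Q x = Q y" by auto
    then obtain i where i: "i \<in> I" "\<gamma> i x - y \<in> \<Lambda>" unfolding Q_eq_iff by blast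
    show "x \<in> (\<Union>i\<in>I. \<Union>l\<in>\<Lambda>. (\<lambda>x. \<gamma> i x - l) -` S)"
      using y(1) by (intro UN_I[OF i(1)] UN_I[OF i(2)]) simp
  next
    fix x assume "x \<in> (\<Union>i\<in>I. \<Union>l\<in>\<Lambda>. (\<lambda>x. \<gamma> i x - l) -` S)"
    then obtain i l where i: "i \<in> I" "l \<in> \<Lambda>" "\<gamma> i x - l \<in> S" by auto
    then have "Q x = Q (\<gamma> i x - l)" unfolding Q_eq_iff by (intro bexI[of _ i]) auto
    then show "x \<in> {x. Q x \<in> Q ` S}" using i(3) by auto
  qed
  moreover have "open ((\<lambda>x. \<gamma> i x - l) -` S)" for i l
    by (rule open_vimage[OF assms]) (intro continuous_intros)
  ultimately show ?thesis by (simp only:) (intro open_UN ballI)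
qed

text \<open>Immersivity on unit tangent vectors over a compact ball extends to nonzero vectors by
  scaling. Separation is then obtained near each pair: for distinct orbits by
  \<open>separating_system\<close>, for equal orbits by the local injectivity of the immersive list
  \<open>fs1\<close>.\<close>

theorem projective_quotient: "projective_cspace (quotient_cspace Q (linear_cspace J))"
proof -
  obtain R where R: "R > 0" "\<And>x. \<exists>x'\<in>cball 0 R. Q x' = Q x"
    by (rule fundamental_domain) (rule that)
  let ?K = "cball (0::real^'n) R"
  obtain fs1 where fs1: "linear_system J Q fs1" "\<forall>z\<in>?K \<times> sphere 0 1. \<not> critical fs1 (fst z) (snd z)"
  proof (rule linear_system_compactness[of "?K \<times> sphere 0 1" J Q "\<lambda>fs z. \<not> critical fs (fst z) (snd z)"])
    show "compact (?K \<times> sphere (0::real^'n) 1)" by (intro compact_Times) simp_all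
    fix z :: "(real^'n) \<times> (real^'n)" assume "z \<in> ?K \<times> sphere 0 1"
    then have "snd z \<noteq> 0" by auto
    then obtain fs where fs: "linear_system J Q fs" "\<not> critical fs (fst z) (snd z)"
      by (rule immersive_system) (rule that)
    then show "\<exists>fs U. linear_system J Q fs \<and> open U \<and> z \<in> U \<and> (\<forall>z'\<in>U. \<not> critical fs (fst z') (snd z'))"
      by (intro exI[of _ fs] exI[of _ "{z. \<not> critical fs (fst z) (snd z)}"]) (simp add: open_not_critical[OF fs(1)])
  next
    fix fs gs and z :: "(real^'n) \<times> (real^'n)"
    assume "linear_system J Q fs" "linear_system J Q gs" "\<not> critical fs (fst z) (snd z) \<or> \<not> critical gs (fst z) (snd z)"
    then show "\<not> critical (segre fs gs) (fst z) (snd z)" using critical_segre by blast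
  qed (rule that)
  have imm1: "\<not> critical fs1 x w" if x: "x \<in> ?K" and w: "w \<noteq> 0" for x w
  proof
    assume "critical fs1 x w"
    then obtain \<kappa> where \<kappa>: "\<forall>f\<in>set fs1. frechet_derivative f (at x) w = \<kappa> * f x"
      unfolding critical_def by (elim exE) (rule that)
    have "frechet_derivative f (at x) ((1 / norm w) *\<^sub>R w) = (of_real (1 / norm w) * \<kappa>) * f x" if f: "f \<in> set fs1" for f
    proof -
      have "linear (frechet_derivative f (at x))"
        using c1_holomorphicD(1)[OF linear_systemD(1)[OF fs1(1) f]] by (rule has_derivative_linear)
      then show ?thesis using bspec[OF \<kappa> f] by (simp only: linear_scale) (simp add: scaleR_conv_of_real)
    qed
    then have "critical fs1 x ((1 / norm w) *\<^sub>R w)" unfolding critical_def by (intro exI ballI)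
    moreover have "(x, (1 / norm w) *\<^sub>R w) \<in> ?K \<times> sphere 0 1" using x w by simp
    ultimately show False using bspec[OF fs1(2)] by fastforce
  qed
  obtain fs2 where fs2: "linear_system J Q fs2" "\<forall>z\<in>?K \<times> ?K. proportional fs2 (fst z) (snd z) \<longrightarrow> Q (fst z) = Q (snd z)"
  proof (rule linear_system_compactness[of "?K \<times> ?K" J Q "\<lambda>fs z. proportional fs (fst z) (snd z) \<longrightarrow> Q (fst z) = Q (snd z)"])
    show "compact (?K \<times> ?K)" by (intro compact_Times) simp_all
    fix z assume z: "z \<in> ?K \<times> ?K"
    obtain x y where xy: "z = (x, y)" "x \<in> ?K" using z by auto
    show "\<exists>fs U. linear_system J Q fs \<and> open U \<and> z \<in> U \<and> (\<forall>z'\<in>U. proportional fs (fst z') (snd z') \<longrightarrow> Q (fst z') = Q (snd z'))"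
    proof (cases "Q x = Q y")
      case False
      then obtain fs where fs: "linear_system J Q fs" "\<not> proportional fs x y"
        by (rule separating_system) (rule that)
      then show ?thesis
        by (intro exI[of _ fs] exI[of _ "{z. \<not> proportional fs (fst z) (snd z)}"]) (simp add: open_not_proportional[OF fs(1)] xy(1))
    next
      case True
      obtain S where S: "open S" "x \<in> S" "\<And>u v. u \<in> S \<Longrightarrow> v \<in> S \<Longrightarrow> proportional fs1 u v \<Longrightarrow> u = v"
        by (rule immersive_imp_locally_separating[OF J fs1(1) imm1[OF xy(2)]]) (assumption, rule that)
      obtain i where i: "i \<in> I" "\<gamma> i y - x \<in> \<Lambda>" using True[symmetric] unfolding Q_eq_iff by (elim bexE) (rule that)
      \<comment> \<open>This affine map preserves the classes of Q and sends y to x, so it reduces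
        pairs near (x, y) to pairs near the diagonal.\<close>
      let ?t = "\<lambda>v. \<gamma> i v - (\<gamma> i y - x)"
      have "open (S \<times> ?t -` S)"
        using S(1) by (intro open_Times open_vimage continuous_intros)
      moreover have "z \<in> S \<times> ?t -` S" using S(2) by (simp add: xy(1))
      moreover have "Q (fst z') = Q (snd z')" if z': "z' \<in> S \<times> ?t -` S" and p: "proportional fs1 (fst z') (snd z')" for z'
      proof -
        have "\<gamma> i (snd z') - ?t (snd z') = \<gamma> i y - x" by (simp add: algebra_simps)
        then have Qt: "Q (snd z') = Q (?t (snd z'))"
          unfolding Q_eq_iff using i by (intro bexI[of _ i]) (simp_all only:)
        obtain e where e: "\<forall>f\<in>set fs1. f (?t (snd z')) = e * f (snd z')"
          using linear_systemD(2)[OF fs1(1) Qt] by (elim exE conjE) (rule that)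
        obtain d where d: "\<forall>f\<in>set fs1. f (snd z') = d * f (fst z')" using p unfolding proportional_def by (elim exE) (rule that)
        have "proportional fs1 (fst z') (?t (snd z'))"
          unfolding proportional_def
        proof (intro exI[of _ "e * d"] ballI)
          fix f assume f: "f \<in> set fs1"
          show "f (?t (snd z')) = e * d * f (fst z')" by (simp only: bspec[OF e f] bspec[OF d f] mult.assoc)
        qed
        then have "fst z' = ?t (snd z')" using z' by (intro S(3)) auto
        then show ?thesis using Qt by simp
      qed
      ultimately show ?thesis using fs1(1) by blast
    qed
  next
    fix fs gs and z :: "(real^'n) \<times> (real^'n)"
    assume "linear_system J Q fs" "linear_system J Q gs"
      "(proportional fs (fst z) (snd z) \<longrightarrow> Q (fst z) = Q (snd z)) \<or> (proportional gs (fst z) (snd z) \<longrightarrow> Q (fst z) = Q (snd z))"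
    then show "proportional (segre fs gs) (fst z) (snd z) \<longrightarrow> Q (fst z) = Q (snd z)" using proportional_segre by blast
  qed (rule that)
  define fs where "fs = segre fs1 fs2"
  have fs: "linear_system J Q fs" unfolding fs_def by (rule linear_system_segre[OF fs1(1) fs2(1)])
  have "projective_embedding Q J ?K fs"
  proof
    show "J ** J = - mat 1" by (rule J)
    show "compact ?K" by simp
    show "Q ` ?K = range Q" using R(2) by (metis (no_types, lifting) image_iff image_mono order_antisym subsetI subset_UNIV rangeE)
    show "open {x. Q x \<in> Q ` S}" if "open S" for S by (rule Q_open[OF that])
    show "c1_holomorphic J f" if "f \<in> set fs" for f by (rule linear_systemD(1)[OF fs that])
    show "\<exists>e. e \<noteq> 0 \<and> (\<forall>f\<in>set fs. f y = e * f x)" if "Q x = Q y" for x y by (rule linear_systemD(2)[OF fs that])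
    show "\<exists>f\<in>set fs. f x \<noteq> 0" for x by (rule linear_systemD(3)[OF fs])
    show "v = 0" if x: "x \<in> ?K" and c: "\<forall>f\<in>set fs. frechet_derivative f (at x) v = \<kappa> * f x" for x v \<kappa>
    proof (rule ccontr)
      assume "v \<noteq> 0"
      have "critical fs x v" unfolding critical_def using c by (rule exI)
      then have "critical fs1 x v" unfolding fs_def by (rule critical_segre(1)[OF fs1(1) fs2(1)])
      then show False using imm1[OF x \<open>v \<noteq> 0\<close>] by simp
    qed
    show "Q x = Q y" if p: "\<forall>f\<in>set fs. f y = e * f x" for x y e
    proof -
      obtain x' where x': "x' \<in> ?K" "Q x' = Q x" using R(2) by blast
      obtain y' where y': "y' \<in> ?K" "Q y' = Q y" using R(2) by blast
      obtain c where c: "\<forall>f\<in>set fs. f x = c * f x'" using linear_systemD(2)[OF fs x'(2)] by (elim exE conjE) (rule that)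
      obtain d where d: "\<forall>f\<in>set fs. f y' = d * f y" using linear_systemD(2)[OF fs y'(2)[symmetric]] by (elim exE conjE) (rule that)
      have "proportional fs x' y'" unfolding proportional_def
      proof (intro exI[of _ "d * e * c"] ballI)
        fix f assume f: "f \<in> set fs"
        show "f y' = d * e * c * f x'" by (simp only: bspec[OF d f] bspec[OF p f] bspec[OF c f] mult.assoc)
      qed
      then have "proportional fs2 x' y'" unfolding fs_def by (rule proportional_segre(2)[OF fs1(1) fs2(1)])
      then have "Q x' = Q y'" using bspec[OF fs2(2), of "(x', y')"] x'(1) y'(1) by simp
      then show ?thesis using x'(2) y'(2) by simp
    qed
  qed
  then show ?thesis by (rule projective_embedding.projective)
qed

end

section \<open>Iterated quotients and groups of affine maps of the torus\<close>

lemma quotient_topology_comp: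
  "quotient_topology r (quotient_topology q X) = quotient_topology (r \<circ> q) X"
proof -
  have "{x \<in> topspace X. q x \<in> {y \<in> q ` topspace X. r y \<in> U}} = {x \<in> topspace X. (r \<circ> q) x \<in> U}" for U
    by auto
  moreover have "{y \<in> q ` topspace X. r y \<in> U} \<subseteq> q ` topspace X" for U by (rule Collect_restrict)
  ultimately show ?thesis
    by (simp only: topology_eq openin_quotient_topology topspace_quotient_topology image_comp simp_thms)
qed

text \<open>Presents T / G as a single quotient of the vector space, where the functions
  live.\<close>

lemma quotient_cspace_comp:
  "quotient_cspace r (quotient_cspace q X) = quotient_cspace (r \<circ> q) X"
proof -
  have "{x \<in> topspace (cs_top X). q x \<in> {y \<in> q ` topspace (cs_top X). r y \<in> U}} =
      {x \<in> topspace (cs_top X). (r \<circ> q) x \<in> U}" for U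
    by auto
  then show ?thesis
    by (simp add: quotient_cspace_def quotient_topology_comp comp_assoc del: comp_apply)
qed

text \<open>A and b choose affine lifts. A g is determined by g and is multiplicative, while b g is
  determined only modulo \<Lambda>.\<close>

locale affine_torus_group =
  fixes \<Lambda> :: "(real^'n) set" and G :: "((real^'n) set \<Rightarrow> (real^'n) set) set"
    and A :: "((real^'n) set \<Rightarrow> (real^'n) set) \<Rightarrow> real^'n^'n"
    and b :: "((real^'n) set \<Rightarrow> (real^'n) set) \<Rightarrow> real^'n"
  assumes lat: "full_lattice \<Lambda>" and G: "subgroup G (BijGroup (torus_points \<Lambda>))"
    and act: "g \<in> G \<Longrightarrow> g (lattice_coset \<Lambda> x) = lattice_coset \<Lambda> (A g *v x + b g)"
begin

abbreviation lc :: "real^'n \<Rightarrow> (real^'n) set" where "lc \<equiv> lattice_coset \<Lambda>"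
abbreviation B where "B \<equiv> BijGroup (torus_points \<Lambda>)"

lemma lc_eq_iff: "lc x = lc y \<longleftrightarrow> x - y \<in> \<Lambda>"
  by (rule lattice_coset_eq_iff[OF lat])

lemma lc_torus_points [simp]: "lc x \<in> torus_points \<Lambda>"
  by (simp add: torus_points_def)

lemma carrier_G: "g \<in> G \<Longrightarrow> g \<in> Bij (torus_points \<Lambda>)"
  using subgroup.subset[OF G] by (auto simp: BijGroup_def)

lemma one_apply: "\<one>\<^bsub>B\<^esub> (lc x) = lc x"
  by (simp add: BijGroup_def)

lemma mult_apply: "g \<in> G \<Longrightarrow> h \<in> G \<Longrightarrow> (g \<otimes>\<^bsub>B\<^esub> h) (lc x) = g (h (lc x))"
  by (simp add: BijGroup_def carrier_G compose_def)

text \<open>Elements of \<open>Bij\<close> are extensional, so agreement on torus points is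
  equality.\<close>

lemma ext_G:
  assumes "g \<in> G" "h \<in> G" "\<And>x. g (lc x) = h (lc x)"
  shows "g = h"
proof (rule extensionalityI)
  show "g \<in> extensional (torus_points \<Lambda>)" "h \<in> extensional (torus_points \<Lambda>)"
    using carrier_G[OF assms(1)] carrier_G[OF assms(2)] by (simp_all add: Bij_def)
  show "g p = h p" if "p \<in> torus_points \<Lambda>" for p
    using that assms(3) by (auto simp: torus_points_def)
qed

lemma inverse_G:
  assumes "g \<in> G"
  obtains h where "h \<in> G" "\<And>x. h (g (lc x)) = lc x" "\<And>x. g (h (lc x)) = lc x"
proof -
  interpret B: group B by (rule group_BijGroup)
  let ?h = "inv\<^bsub>B\<^esub> g"
  have h: "?h \<in> G" using subgroup.m_inv_closed[OF G assms] .
  have gB: "g \<in> carrier B" using subgroup.mem_carrier[OF G assms] .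
  show thesis
  proof (rule that[OF h])
    show "?h (g (lc x)) = lc x" for x
      using mult_apply[OF h assms, of x] B.l_inv[OF gB] one_apply[of x] by simp
    show "g (?h (lc x)) = lc x" for x
      using mult_apply[OF assms h, of x] B.r_inv[OF gB] one_apply[of x] by simp
  qed
qed

lemma linear_part_G: "g \<in> G \<Longrightarrow> linear_part \<Lambda> g = A g"
  by (rule linear_part_eq[OF lat act])

lemma A_unique:
  assumes "g \<in> G" "\<And>x. g (lc x) = lc (M *v x + c)"
  shows "A g = M"
  using linear_part_eq[OF lat assms(2)] linear_part_G[OF assms(1)] by simp

lemma one_G: "\<one>\<^bsub>B\<^esub> \<in> G"
  by (rule subgroup.one_closed[OF G])

lemma mult_G: "g \<in> G \<Longrightarrow> h \<in> G \<Longrightarrow> g \<otimes>\<^bsub>B\<^esub> h \<in> G"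
  by (rule subgroup.m_closed[OF G])

lemma A_one: "A \<one>\<^bsub>B\<^esub> = mat 1"
  by (rule A_unique[OF one_G, of _ 0]) (simp add: one_apply)

lemma b_one: "b \<one>\<^bsub>B\<^esub> \<in> \<Lambda>"
  using act[OF one_G, of 0] full_lattice_subgroup(3)[OF lat, of "- b \<one>\<^bsub>B\<^esub>"]
  by (simp add: one_apply lc_eq_iff)

lemma A_mult:
  assumes g: "g \<in> G" and h: "h \<in> G"
  shows "A (g \<otimes>\<^bsub>B\<^esub> h) = A g ** A h"
proof (rule A_unique[OF mult_G[OF g h]])
  show "(g \<otimes>\<^bsub>B\<^esub> h) (lc x) = lc ((A g ** A h) *v x + (A g *v b h + b g))" for x
    by (simp add: mult_apply[OF g h] act[OF g] act[OF h] matrix_vector_right_distrib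
        matrix_vector_mul_assoc add.assoc)
qed

lemma A_invertible:
  assumes g: "g \<in> G"
  shows "invertible (A g)"
proof -
  obtain h where h: "h \<in> G" "\<And>x. h (g (lc x)) = lc x"
    by (rule inverse_G[OF g]) (rule that)
  have "h \<otimes>\<^bsub>B\<^esub> g = \<one>\<^bsub>B\<^esub>"
    by (rule ext_G[OF mult_G[OF h(1) g] one_G]) (simp add: mult_apply[OF h(1) g] h(2) one_apply)
  then have "A h ** A g = mat 1" using A_mult[OF h(1) g] A_one by simp
  then show ?thesis unfolding invertible_left_inverse by (rule exI)
qed

lemma A_lattice:
  assumes g: "g \<in> G" and l: "l \<in> \<Lambda>"
  shows "A g *v l \<in> \<Lambda>"
proof -
  have "lc l = lc 0" using l by (simp add: lc_eq_iff)
  then have "lc (A g *v l + b g) = lc (A g *v 0 + b g)" using act[OF g, of l] act[OF g, of 0] by simp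
  then show ?thesis by (simp add: lc_eq_iff)
qed

abbreviation orbit :: "real^'n \<Rightarrow> (real^'n) set set" where "orbit x \<equiv> {g (lc x) |g. g \<in> G}"

lemma orbit_eq_iff: "orbit x = orbit y \<longleftrightarrow> (\<exists>g\<in>G. A g *v x + b g - y \<in> \<Lambda>)"
proof
  assume e: "orbit x = orbit y"
  have "\<one>\<^bsub>B\<^esub> (lc y) \<in> orbit y" using one_G by (intro CollectI exI conjI) simp_all
  then have "lc y \<in> orbit x" using e one_apply[of y] by simp
  then obtain g where g: "g \<in> G" "lc y = g (lc x)" by (elim CollectE exE conjE) (rule that)
  then have "lc (A g *v x + b g) = lc y" using act[OF g(1), of x] by simp
  then show "\<exists>g\<in>G. A g *v x + b g - y \<in> \<Lambda>" using g(1) unfolding lc_eq_iff by (intro bexI)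
next
  have sub: "orbit y \<subseteq> orbit x" if g: "g \<in> G" "g (lc x) = lc y" for g x y
  proof
    fix p assume "p \<in> orbit y"
    then obtain h where h: "h \<in> G" "p = h (lc y)" by (elim CollectE exE conjE) (rule that)
    then have "p = (h \<otimes>\<^bsub>B\<^esub> g) (lc x)" using g mult_apply[OF h(1) g(1), of x] by simp
    then show "p \<in> orbit x" using mult_G[OF h(1) g(1)] by (intro CollectI exI conjI)
  qed
  assume "\<exists>g\<in>G. A g *v x + b g - y \<in> \<Lambda>"
  then obtain g where g: "g \<in> G" "A g *v x + b g - y \<in> \<Lambda>" by (elim bexE) (rule that)
  then have gxy: "g (lc x) = lc y" using act[OF g(1), of x] by (simp add: lc_eq_iff)
  obtain h where h: "h \<in> G" "\<And>x. h (g (lc x)) = lc x"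
    by (rule inverse_G[OF g(1)]) (rule that)
  have hyx: "h (lc y) = lc x" using h(2)[of x] gxy by simp
  show "orbit x = orbit y"
    using sub[OF g(1) gxy] sub[OF h(1) hyx] by (intro equalityI)
qed

text \<open>If g and h agree at one point, the product of the inverse of h with g fixes it and is
  the identity by freeness.\<close>

lemma free_lattice:
  assumes free: "acts_freely G (torus_points \<Lambda>)" and g: "g \<in> G" and h: "h \<in> G" and ne: "g \<noteq> h"
  shows "(A g *v x + b g) - (A h *v x + b h) \<notin> \<Lambda>"
proof
  assume "(A g *v x + b g) - (A h *v x + b h) \<in> \<Lambda>"
  then have e: "g (lc x) = h (lc x)" by (simp only: act[OF g] act[OF h] lc_eq_iff)
  obtain k where k: "k \<in> G" "\<And>x. k (h (lc x)) = lc x" "\<And>x. h (k (lc x)) = lc x"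
    by (rule inverse_G[OF h]) (rule that)
  have "(k \<otimes>\<^bsub>B\<^esub> g) (lc x) = lc x" using mult_apply[OF k(1) g, of x] e k(2)[of x] by simp
  then have one: "k \<otimes>\<^bsub>B\<^esub> g = \<one>\<^bsub>B\<^esub>"
    using free mult_G[OF k(1) g] lc_torus_points[of x] unfolding acts_freely_def by blast
  have "g (lc z) = h (lc z)" for z
  proof -
    have "k (g (lc z)) = lc z" using mult_apply[OF k(1) g, of z] one one_apply[of z] by simp
    then have "h (k (g (lc z))) = h (lc z)" by (rule arg_cong)
    then show ?thesis using k(3)[of "A g *v z + b g"] act[OF g, of z] by simp
  qed
  then show False using ne ext_G[OF g h] by simp
qed

lemma right_translation:
  assumes fin: "finite G" and g: "g \<in> G"
  shows "bij_betw (\<lambda>h. h \<otimes>\<^bsub>B\<^esub> g) G G"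
    and "h \<in> G \<Longrightarrow> (A h *v (A g *v x + b g) + b h) - (A (h \<otimes>\<^bsub>B\<^esub> g) *v x + b (h \<otimes>\<^bsub>B\<^esub> g)) \<in> \<Lambda>"
proof -
  interpret B: group B by (rule group_BijGroup)
  have "inj_on (\<lambda>h. h \<otimes>\<^bsub>B\<^esub> g) G"
    by (rule inj_on_subset[OF B.inj_on_multc[OF subgroup.mem_carrier[OF G g]] subgroup.subset[OF G]])
  moreover from this have "(\<lambda>h. h \<otimes>\<^bsub>B\<^esub> g) ` G = G"
    using mult_G[OF _ g] by (intro endo_inj_surj[OF fin]) auto
  ultimately show "bij_betw (\<lambda>h. h \<otimes>\<^bsub>B\<^esub> g) G G" by (simp add: bij_betw_def)
  show "(A h *v (A g *v x + b g) + b h) - (A (h \<otimes>\<^bsub>B\<^esub> g) *v x + b (h \<otimes>\<^bsub>B\<^esub> g)) \<in> \<Lambda>" if h: "h \<in> G"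
    unfolding lc_eq_iff[symmetric] act[OF mult_G[OF h g], symmetric] act[OF h, symmetric] act[OF g, symmetric]
    by (rule mult_apply[OF h g, symmetric])
qed

end

theorem proposition1p11:
  fixes k :: nat
    and \<Lambda> :: "(real^'n) set"
    and J0 :: "real^'n^'n"
    and G :: "((real^'n) set \<Rightarrow> (real^'n) set) set"
  assumes "CARD('n) = 2 * k"
    and "full_lattice \<Lambda>"
    and "linear_complex_structure J0"
    and "subgroup G (BijGroup (torus_points \<Lambda>))"
    and "finite G"
    and "\<And>g. g \<in> G \<Longrightarrow> biholomorphism (complex_torus \<Lambda> J0) (complex_torus \<Lambda> J0) g"
    and "acts_freely G (torus_points \<Lambda>)"
  shows "\<exists>J :: real \<Rightarrow> real^'n^'n.
      path J \<and> path_image J \<subseteq> deformation_space \<Lambda> G \<and> pathstart J = J0 \<and>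
      projective_cspace (group_quotient (complex_torus \<Lambda> (pathfinish J)) G)"
proof -
  have J0: "J0 ** J0 = - mat 1" using assms(3) by (simp add: linear_complex_structure_def)
  \<comment> \<open>Linear and translation part form a pair so that a single choice over G fixes
    both.\<close>
  have "\<exists>Ab. (\<forall>x. g (lattice_coset \<Lambda> x) = lattice_coset \<Lambda> (fst Ab *v x + snd Ab)) \<and> fst Ab ** J0 = J0 ** fst Ab"
    if g: "g \<in> G" for g
  proof -
    obtain A b where Ab: "\<And>x. g (lattice_coset \<Lambda> x) = lattice_coset \<Lambda> (A *v x + b)" "A ** J0 = J0 ** A"
      by (rule torus_automorphism_affine[OF assms(2) J0 assms(6)[OF g]]) (rule that)
    show ?thesis by (rule exI[of _ "(A, b)"]) (simp add: Ab)
  qed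
  then have "\<forall>g\<in>G. \<exists>Ab. (\<forall>x. g (lattice_coset \<Lambda> x) = lattice_coset \<Lambda> (fst Ab *v x + snd Ab)) \<and> fst Ab ** J0 = J0 ** fst Ab" ..
  from bchoice[OF this] obtain Ab where
    Ab: "\<forall>g\<in>G. (\<forall>x. g (lattice_coset \<Lambda> x) = lattice_coset \<Lambda> (fst (Ab g) *v x + snd (Ab g))) \<and> fst (Ab g) ** J0 = J0 ** fst (Ab g)"
    by (elim exE) (rule that)
  define A b where "A g = fst (Ab g)" and "b g = snd (Ab g)" for g
  have act: "g (lattice_coset \<Lambda> x) = lattice_coset \<Lambda> (A g *v x + b g)" and A_J0: "A g ** J0 = J0 ** A g"
    if "g \<in> G" for g x
    using bspec[OF Ab that] by (simp_all add: A_def b_def)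
  interpret affine_torus_group \<Lambda> G A b
    by (rule affine_torus_group.intro[OF assms(2,4) act])
  obtain p and J E :: "real^'n^'n" where p: "path p" "pathstart p = J0" "pathfinish p = J"
    and pJ: "\<And>t. t \<in> {0..1} \<Longrightarrow> p t ** p t = - mat 1"
    and pS: "\<And>t \<mu>. t \<in> {0..1} \<Longrightarrow> \<mu> \<in> A ` G \<Longrightarrow> \<mu> ** p t = p t ** \<mu>"
    and E: "transpose E = - E" "transpose J ** E ** J = E"
      "\<And>x. x \<noteq> 0 \<Longrightarrow> (J *v x) \<bullet> (E *v x) > 0"
      "\<And>l l'. l \<in> \<Lambda> \<Longrightarrow> l' \<in> \<Lambda> \<Longrightarrow> \<exists>k::int. l \<bullet> (E *v l') = 2 * of_int k"
  proof (rule polarizable_deformation[OF lat J0, of "A ` G"])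
    show "finite (A ` G)" using assms(5) by (rule finite_imageI)
    show "mat 1 \<in> A ` G" using imageI[OF one_G, of A] A_one by simp
    show "\<mu> ** \<nu> \<in> A ` G" if "\<mu> \<in> A ` G" "\<nu> \<in> A ` G" for \<mu> \<nu>
      using that A_mult mult_G by (metis (no_types, lifting) imageE imageI)
    show "invertible \<mu>" if "\<mu> \<in> A ` G" for \<mu> using that A_invertible by (elim imageE) simp
    show "\<mu> ** J0 = J0 ** \<mu>" if "\<mu> \<in> A ` G" for \<mu> using that A_J0 by (elim imageE) simp
    show "\<mu> *v l \<in> \<Lambda>" if "\<mu> \<in> A ` G" "l \<in> \<Lambda>" for \<mu> l using that A_lattice by (elim imageE) simp
  qed (rule that)
  have deform: "path_image p \<subseteq> deformation_space \<Lambda> G"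
    unfolding path_image_def deformation_space_def linear_complex_structure_def
    using pJ pS linear_part_G by auto
  have one01: "(1::real) \<in> {0..1}" by simp
  have JJ: "J ** J = - mat 1" and AJ: "A g ** J = J ** A g" if "g \<in> G" for g
    using pJ[OF one01] pS[OF one01 imageI[OF that]] p(3) by (simp_all add: pathfinish_def)
  interpret free_torus_quotient \<Lambda> J E G A b "\<one>\<^bsub>B\<^esub>" orbit
  proof
    show "J ** J = - mat 1" using JJ[OF one_G] .
    show "\<exists>\<sigma>. bij_betw \<sigma> G G \<and> (\<forall>h\<in>G. \<forall>x. (A h *v (A g *v x + b g) + b h) - (A (\<sigma> h) *v x + b (\<sigma> h)) \<in> \<Lambda>)"
      if "g \<in> G" for g
      using right_translation[OF assms(5) that] by (intro exI[of _ "\<lambda>h. h \<otimes>\<^bsub>B\<^esub> g"]) blast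
  qed (fact lat E assms(5) AJ A_lattice orbit_eq_iff free_lattice[OF assms(7)] one_G A_one b_one)+
  \<comment> \<open>The two successive quotients are merged into the quotient by the orbit map, the
    form for which projectivity is proved.\<close>
  have "group_quotient (complex_torus \<Lambda> J) G = quotient_cspace orbit (linear_cspace J)"
    unfolding group_quotient_def complex_torus_def quotient_cspace_comp by (simp add: comp_def)
  then have "projective_cspace (group_quotient (complex_torus \<Lambda> (pathfinish p)) G)"
    using projective_quotient p(3) by simp
  then show ?thesis using p(1,2) deform by (intro exI[of _ p] conjI)
qed

end
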